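(* Let $\Omega\subset\mathbb R^N$ be a bounded connected domain with $C^1$ boundary, let $1<p<q<\gamma<p^*$, and let $a,b\in L^\infty(\Omega)$ satisfy $a(x)\ge\sigma_a$ and $b(x)\ge\sigma_b$ for a.e. $x\in\Omega$, where $\sigma_a,\sigma_b>0$ are constants. For $\varepsilon>0$ consider the Dirichlet problem $$(P_\varepsilon)\qquad -\varepsilon\Delta_p u = a(x)|u|^{q-2}u-b(x)|u|^{\gamma-2}u \ \text{ in }\Omega,\qquad u=0\ \text{ on }\partial\Omega .$$ Let $u_\varepsilon$, $0<\varepsilon<\varepsilon_e^*$ (with $\varepsilon_e^*$ defined in the context), be any family of positive ground states of $(P_\varepsilon)$. Set $$\bar u_0(x)=\left(\frac{a(x)}{b(x)}\right)^{1/(\gamma-q)}\quad\text{for a.e. }x\in\Omega .$$ Then, as $\varepsilon\to0^+$, $$u_\varepsilon\to\bar u_0\quad\text{in measure in }\Omega .$$ Moreover, as $\varepsilon\to0^+$, $$u_\varepsilon-\bar u_0\to0\quad\text{strongly in }L^r(\Omega)\ \text{ for every }1\le r<\gamma,$$ and $$u_\varepsilon-\bar u_0\rightharpoonup0\quad\text{weakly in }L^r(\Omega)\ \text{ for every }1<r\le\gamma .$$ The limit function satisfies $a(x)\bar u_0^{q-1}(x)-b(x)\bar u_0^{\gamma-1}(x)=0$ for a.e. $x\in\Omega$.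
   Context: $\Delta_p u=\operatorname{div}(|\nabla u|^{p-2}\nabla u)$ is the $p$-Laplacian. The critical exponent is $p^*=\frac{pN}{N-p}$ if $p<N$ and $p^*=+\infty$ if $p\ge N$. $W^{1,p}_0(\Omega)$ is the closure of $C_0^\infty(\Omega)$ in $W^{1,p}(\Omega)$. The energy functional on $W^{1,p}_0(\Omega)$ is $$\Phi_\varepsilon(u)=\frac{\varepsilon}{p}\int_\Omega|\nabla u|^p\,dx-\frac1q\int_\Omega a|u|^q\,dx+\frac1\gamma\int_\Omega b|u|^\gamma\,dx .$$ A weak solution of $(P_\varepsilon)$ is a critical point $u\in W^{1,p}_0(\Omega)$ of $\Phi_\varepsilon$. A weak solution $u$ is a ground state if $\Phi_\varepsilon(u)\le\Phi_\varepsilon(w)$ for every weak solution $w\in W^{1,p}_0(\Omega)$ of $(P_\varepsilon)$ (the trivial solution $w=0$ included). "Positive" means $u>0$ in $\Omega$. Let $\mathcal D=\{u\in W^{1,p}_0(\Omega)\setminus\{0\}:\int_\Omega a|u|^q\,dx>0\}$ and $$\varepsilon_e^*=c_{e,p,q,\gamma}\sup_{u\in\mathcal D}\frac{\left(\int_\Omega a|u|^q\,dx\right)^{\frac{\gamma-p}{\gamma-q}}}{\int_\Omega|\nabla u|^p\,dx\,\left(\int_\Omega b|u|^\gamma\,dx\right)^{\frac{q-p}{\gamma-q}}},\qquad c_{e,p,q,\gamma}=\frac{p(\gamma-q)}{q(\gamma-p)}\left(\frac{\gamma(q-p)}{q(\gamma-p)}\right)^{\frac{q-p}{\gamma-q}}.$$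 *)

theory Defs
  imports "HOL-Analysis.Analysis"
begin

section \<open>Lebesgue spaces and modes of convergence\<close>

text \<open>Elements of the function spaces below are functions, not equivalence classes. The
  spaces on a domain \<open>\<Omega>\<close> are taken over \<open>lebesgue_on \<Omega>\<close>, so values outside \<open>\<Omega>\<close> and on null
  sets do not matter.\<close>

definition Lp_space :: "'a measure \<Rightarrow> real \<Rightarrow> ('a \<Rightarrow> 'b::real_normed_vector) set" where
  "Lp_space M r = {f \<in> borel_measurable M. integrable M (\<lambda>x. norm (f x) powr r)}"

definition Lp_norm :: "'a measure \<Rightarrow> real \<Rightarrow> ('a \<Rightarrow> 'b::real_normed_vector) \<Rightarrow> real" where
  "Lp_norm M r f = (\<integral>x. norm (f x) powr r \<partial>M) powr (1 / r)"

definition Linfty_space :: "'a measure \<Rightarrow> ('a \<Rightarrow> real) set" where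
  "Linfty_space M = {f \<in> borel_measurable M. \<exists>C. AE x in M. \<bar>f x\<bar> \<le> C}"

definition tendsto_in_measure ::
    "'a measure \<Rightarrow> ('i \<Rightarrow> 'a \<Rightarrow> real) \<Rightarrow> ('a \<Rightarrow> real) \<Rightarrow> 'i filter \<Rightarrow> bool" where
  "tendsto_in_measure M f g F \<longleftrightarrow>
     (\<forall>\<delta>>0. ((\<lambda>i. emeasure M {x \<in> space M. \<bar>f i x - g x\<bar> \<ge> \<delta>}) \<longlongrightarrow> 0) F)"

text \<open>Membership in \<open>L\<^sup>r\<close> is part of the following two notions, because the Bochner integral of
  a non-integrable function is \<open>0\<close> by convention.\<close>

definition tendsto_strongly_Lp ::
    "'a measure \<Rightarrow> real \<Rightarrow> ('i \<Rightarrow> 'a \<Rightarrow> real) \<Rightarrow> ('a \<Rightarrow> real) \<Rightarrow> 'i filter \<Rightarrow> bool" where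
  "tendsto_strongly_Lp M r f g F \<longleftrightarrow>
     (\<forall>\<^sub>F i in F. f i \<in> Lp_space M r) \<and> g \<in> Lp_space M r \<and>
     ((\<lambda>i. Lp_norm M r (\<lambda>x. f i x - g x)) \<longlongrightarrow> 0) F"

text \<open>Weak convergence in \<open>L\<^sup>r\<close> for \<open>1 < r < \<infinity>\<close>, by testing against the dual space \<open>L\<^sup>s\<close> with
  \<open>s = r / (r - 1)\<close>.\<close>

definition tendsto_weakly_Lp ::
    "'a measure \<Rightarrow> real \<Rightarrow> ('i \<Rightarrow> 'a \<Rightarrow> real) \<Rightarrow> ('a \<Rightarrow> real) \<Rightarrow> 'i filter \<Rightarrow> bool" where
  "tendsto_weakly_Lp M r f g F \<longleftrightarrow>
     (\<forall>\<^sub>F i in F. f i \<in> Lp_space M r) \<and> g \<in> Lp_space M r \<and>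
     (\<forall>\<psi> \<in> Lp_space M (r / (r - 1)).
        ((\<lambda>i. \<integral>x. f i x * \<psi> x \<partial>M) \<longlongrightarrow> (\<integral>x. g x * \<psi> x \<partial>M)) F)"


section \<open>Smooth functions and domains with \<open>C\<^sup>1\<close> boundary\<close>

primrec C_k :: "nat \<Rightarrow> ('a::euclidean_space \<Rightarrow> real) \<Rightarrow> bool" where
  "C_k 0 f \<longleftrightarrow> continuous_on UNIV f"
| "C_k (Suc k) f \<longleftrightarrow>
     (\<exists>G. (\<forall>x. GDERIV f x :> G x) \<and> (\<forall>b\<in>Basis. C_k k (\<lambda>x. G x \<bullet> b)))"

text \<open>The functions in \<open>C\<^sub>0\<^sup>\<infinity>(\<Omega>)\<close> are extended by zero to the whole space.\<close>

definition test_functions :: "'a::euclidean_space set \<Rightarrow> ('a \<Rightarrow> real) set" where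
  "test_functions \<Omega> = {\<phi>. (\<forall>k. C_k k \<phi>) \<and>
     compact (closure {x. \<phi> x \<noteq> 0}) \<and> closure {x. \<phi> x \<noteq> 0} \<subseteq> \<Omega>}"

text \<open>Near every boundary point, \<open>\<Omega>\<close> is the region above the graph of a \<open>C\<^sup>1\<close> function in
  suitably rotated coordinates: \<open>\<nu>\<close> is the direction of the last coordinate axis, and a
  function of the remaining coordinates is a function \<open>g\<close> on the whole space that is invariant
  under translations along \<open>\<nu>\<close>.\<close>

definition C1_boundary :: "'a::euclidean_space set \<Rightarrow> bool" where
  "C1_boundary \<Omega> \<longleftrightarrow>
     (\<forall>z \<in> frontier \<Omega>. \<exists>r>0. \<exists>\<nu> g. norm \<nu> = 1 \<and> C_k 1 g \<and>
        (\<forall>x t. g (x + t *\<^sub>R \<nu>) = g x) \<and>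
        \<Omega> \<inter> ball z r = {x \<in> ball z r. x \<bullet> \<nu> > g x})"


section \<open>Sobolev spaces\<close>

definition locally_integrable ::
    "'a::euclidean_space set \<Rightarrow> ('a \<Rightarrow> 'b::euclidean_space) \<Rightarrow> bool" where
  "locally_integrable \<Omega> f \<longleftrightarrow> (\<forall>K. compact K \<and> K \<subseteq> \<Omega> \<longrightarrow> integrable (lebesgue_on K) f)"

definition gradient :: "('a::euclidean_space \<Rightarrow> real) \<Rightarrow> 'a \<Rightarrow> 'a" where
  "gradient f x = (THE D. GDERIV f x :> D)"

definition is_weak_gradient ::
    "'a::euclidean_space set \<Rightarrow> ('a \<Rightarrow> real) \<Rightarrow> ('a \<Rightarrow> 'a) \<Rightarrow> bool" where
  "is_weak_gradient \<Omega> u G \<longleftrightarrow> locally_integrable \<Omega> u \<and> locally_integrable \<Omega> G \<and>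
     (\<forall>\<phi> \<in> test_functions \<Omega>.
        (\<integral>x. u x *\<^sub>R gradient \<phi> x \<partial>lebesgue_on \<Omega>) = - (\<integral>x. \<phi> x *\<^sub>R G x \<partial>lebesgue_on \<Omega>))"

text \<open>The weak gradient is determined almost everywhere; an arbitrary representative is chosen.\<close>

definition weak_grad :: "'a::euclidean_space set \<Rightarrow> ('a \<Rightarrow> real) \<Rightarrow> 'a \<Rightarrow> 'a" where
  "weak_grad \<Omega> u = (SOME G. is_weak_gradient \<Omega> u G)"

definition W1p :: "'a::euclidean_space set \<Rightarrow> real \<Rightarrow> ('a \<Rightarrow> real) set" where
  "W1p \<Omega> p = {u \<in> Lp_space (lebesgue_on \<Omega>) p.
     \<exists>G \<in> Lp_space (lebesgue_on \<Omega>) p. is_weak_gradient \<Omega> u G}"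

definition W1p_norm :: "'a::euclidean_space set \<Rightarrow> real \<Rightarrow> ('a \<Rightarrow> real) \<Rightarrow> real" where
  "W1p_norm \<Omega> p u = ((\<integral>x. \<bar>u x\<bar> powr p \<partial>lebesgue_on \<Omega>) +
     (\<integral>x. norm (weak_grad \<Omega> u x) powr p \<partial>lebesgue_on \<Omega>)) powr (1 / p)"

definition W1p0 :: "'a::euclidean_space set \<Rightarrow> real \<Rightarrow> ('a \<Rightarrow> real) set" where
  "W1p0 \<Omega> p = {u \<in> W1p \<Omega> p.
     \<forall>e>0. \<exists>\<phi> \<in> test_functions \<Omega>. W1p_norm \<Omega> p (\<lambda>x. u x - \<phi> x) < e}"

definition critical_exponent :: "nat \<Rightarrow> real \<Rightarrow> ereal" where
  "critical_exponent N p = (if p < real N then ereal (p * real N / (real N - p)) else \<infinity>)"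


section \<open>The variational problem\<close>

definition energy :: "'a::euclidean_space set \<Rightarrow> real \<Rightarrow> real \<Rightarrow> real \<Rightarrow> ('a \<Rightarrow> real) \<Rightarrow>
    ('a \<Rightarrow> real) \<Rightarrow> real \<Rightarrow> ('a \<Rightarrow> real) \<Rightarrow> real" where
  "energy \<Omega> p q \<gamma> a b \<epsilon> u =
     \<epsilon> / p * (\<integral>x. norm (weak_grad \<Omega> u x) powr p \<partial>lebesgue_on \<Omega>)
     - 1 / q * (\<integral>x. a x * \<bar>u x\<bar> powr q \<partial>lebesgue_on \<Omega>)
     + 1 / \<gamma> * (\<integral>x. b x * \<bar>u x\<bar> powr \<gamma> \<partial>lebesgue_on \<Omega>)"

text \<open>A weak solution is a critical point of the energy on \<open>W\<^sub>0\<^sup>1\<^sup>,\<^sup>p(\<Omega>)\<close>: the derivative of the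
  energy at \<open>u\<close> vanishes in every direction \<open>v\<close> of that space.\<close>

definition weak_solution :: "'a::euclidean_space set \<Rightarrow> real \<Rightarrow> real \<Rightarrow> real \<Rightarrow> ('a \<Rightarrow> real) \<Rightarrow>
    ('a \<Rightarrow> real) \<Rightarrow> real \<Rightarrow> ('a \<Rightarrow> real) \<Rightarrow> bool" where
  "weak_solution \<Omega> p q \<gamma> a b \<epsilon> u \<longleftrightarrow> u \<in> W1p0 \<Omega> p \<and>
     (\<forall>v \<in> W1p0 \<Omega> p.
        ((\<lambda>t. energy \<Omega> p q \<gamma> a b \<epsilon> (\<lambda>x. u x + t * v x)) has_real_derivative 0) (at 0))"

definition ground_state :: "'a::euclidean_space set \<Rightarrow> real \<Rightarrow> real \<Rightarrow> real \<Rightarrow> ('a \<Rightarrow> real) \<Rightarrow>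
    ('a \<Rightarrow> real) \<Rightarrow> real \<Rightarrow> ('a \<Rightarrow> real) \<Rightarrow> bool" where
  "ground_state \<Omega> p q \<gamma> a b \<epsilon> u \<longleftrightarrow> weak_solution \<Omega> p q \<gamma> a b \<epsilon> u \<and>
     (\<forall>w. weak_solution \<Omega> p q \<gamma> a b \<epsilon> w \<longrightarrow>
        energy \<Omega> p q \<gamma> a b \<epsilon> u \<le> energy \<Omega> p q \<gamma> a b \<epsilon> w)"

definition positive_ground_state :: "'a::euclidean_space set \<Rightarrow> real \<Rightarrow> real \<Rightarrow> real \<Rightarrow>
    ('a \<Rightarrow> real) \<Rightarrow> ('a \<Rightarrow> real) \<Rightarrow> real \<Rightarrow> ('a \<Rightarrow> real) \<Rightarrow> bool" where
  "positive_ground_state \<Omega> p q \<gamma> a b \<epsilon> u \<longleftrightarrow>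
     ground_state \<Omega> p q \<gamma> a b \<epsilon> u \<and> (AE x in lebesgue_on \<Omega>. u x > 0)"

definition admissible_set :: "'a::euclidean_space set \<Rightarrow> real \<Rightarrow> real \<Rightarrow> ('a \<Rightarrow> real) \<Rightarrow>
    ('a \<Rightarrow> real) set" where
  "admissible_set \<Omega> p q a = {u \<in> W1p0 \<Omega> p. \<not> (AE x in lebesgue_on \<Omega>. u x = 0) \<and>
     (\<integral>x. a x * \<bar>u x\<bar> powr q \<partial>lebesgue_on \<Omega>) > 0}"

definition c_e :: "real \<Rightarrow> real \<Rightarrow> real \<Rightarrow> real" where
  "c_e p q \<gamma> = p * (\<gamma> - q) / (q * (\<gamma> - p)) *
     (\<gamma> * (q - p) / (q * (\<gamma> - p))) powr ((q - p) / (\<gamma> - q))"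

text \<open>The supremum is taken in the extended reals, so that its finiteness is not presupposed.\<close>

definition eps_e :: "'a::euclidean_space set \<Rightarrow> real \<Rightarrow> real \<Rightarrow> real \<Rightarrow> ('a \<Rightarrow> real) \<Rightarrow>
    ('a \<Rightarrow> real) \<Rightarrow> ereal" where
  "eps_e \<Omega> p q \<gamma> a b = ereal (c_e p q \<gamma>) * (SUP u \<in> admissible_set \<Omega> p q a. ereal (
     (\<integral>x. a x * \<bar>u x\<bar> powr q \<partial>lebesgue_on \<Omega>) powr ((\<gamma> - p) / (\<gamma> - q)) /
     ((\<integral>x. norm (weak_grad \<Omega> u x) powr p \<partial>lebesgue_on \<Omega>) *
      (\<integral>x. b x * \<bar>u x\<bar> powr \<gamma> \<partial>lebesgue_on \<Omega>) powr ((q - p) / (\<gamma> - q)))))"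

end

theory Submission
  imports Defs "HOL-Complex_Analysis.Great_Picard" "HOL-Library.Diagonal_Subsequence"
begin

text \<open>Up to the factor \<open>\<epsilon> / p\<close> in front of the Dirichlet energy, the functional integrates
  \<open>F(x, s) = b(x) s\<^sup>\<gamma> / \<gamma> - a(x) s\<^sup>q / q\<close>, whose unique minimum over \<open>s \<ge> 0\<close> is at
  \<open>u\<^sub>0(x)\<close>. A global minimizer over \<open>W\<^sub>0\<^sup>1\<^sup>,\<^sup>p\<close> exists and is a weak solution, so the energy of a
  ground state is at most that of any test function. Test functions close to \<open>u\<^sub>0\<close> in
  \<open>L\<^sup>\<gamma>\<close> then show that the nonnegative gap \<open>F(x, u\<^sub>\<epsilon>) - F(x, u\<^sub>0)\<close> tends to \<open>0\<close> in
  \<open>L\<^sup>1\<close>. The gap controls \<open>\<bar>u\<^sub>\<epsilon> - u\<^sub>0\<bar>\<^sup>\<gamma>\<close> up to an arbitrarily small constant, which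
  gives strong convergence in \<open>L\<^sup>\<gamma>\<close> and with it all the assertions.\<close>

section \<open>Inequalities for powers\<close>

text \<open>By definition a ground state is compared with weak solutions only, so test functions
  become competitors only through a minimizer that is itself a weak solution. Its existence carries
  most of the work: minimizing sequences have to converge strongly in L^\<gamma>, so that both
  integrals of powers of u pass to the limit, and this is where \<gamma> < p^* enters. Compactness
  comes from averages over small cubes, which are equi-Lipschitz for a fixed side and close to the
  functions in L^\<gamma> for a small side, uniformly on bounded subsets of the Sobolev space.

  Since a and b are merely bounded, \<open>u0\<close> may fail to lie in W_0^{1,p} and cannot be
  inserted into the energy. A test function near \<open>u0\<close> is therefore fixed before
  \<epsilon> tends to 0, so that \<epsilon> / p times its Dirichlet integral disappears in the
  limit.

  The gap controls the distance to \<open>u0\<close> uniformly in x because the substitution s =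
  u0(x) t turns F(x, s) into the weight b(x) u0(x)^\<gamma> times one fixed function of t.\<close>

lemma powr_tangent_strict:
  fixes p t :: real
  assumes "1 < p" "0 \<le> t" "t \<noteq> 1"
  shows "1 + p * (t - 1) < t powr p"
proof -
  \<comment> \<open>The mean value theorem is applied between t and 1, on either side of 1. The
    point t = 0 is split off because the derivative rule for \<open>powr\<close> fails
    there.\<close>
  consider "t = 0" | "0 < t" "t < 1" | "1 < t" using assms by linarith
  then show ?thesis
  proof cases
    case 2
    have "\<exists>z. t < z \<and> z < 1 \<and> 1 powr p - t powr p = (1 - t) * (p * z powr (p - 1))"
      using 2 by (intro MVT2) (auto intro!: derivative_eq_intros)
    then obtain z where z: "t < z" "z < 1" "1 - t powr p = (1 - t) * (p * z powr (p - 1))" by auto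
    have "z powr (p - 1) < 1 powr (p - 1)" using z 2 assms by (intro powr_less_mono2) auto
    then have "(1 - t) * (p * z powr (p - 1)) < (1 - t) * (p * 1)"
      using 2 assms by (intro mult_strict_left_mono) auto
    then show ?thesis using z(3) by (simp add: algebra_simps)
  next
    case 3
    have "\<exists>z. 1 < z \<and> z < t \<and> t powr p - 1 powr p = (t - 1) * (p * z powr (p - 1))"
      using 3 by (intro MVT2) (auto intro!: derivative_eq_intros)
    then obtain z where z: "1 < z" "z < t" "t powr p - 1 = (t - 1) * (p * z powr (p - 1))" by auto
    have "1 powr (p - 1) < z powr (p - 1)" using z assms by (intro powr_less_mono2) auto
    then have "(t - 1) * (p * 1) < (t - 1) * (p * z powr (p - 1))"
      using 3 assms by (intro mult_strict_left_mono) auto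
    then show ?thesis using z(3) by (simp add: algebra_simps)
  qed (use assms in auto)
qed

lemma powr_tangent_strict':
  fixes p m t :: real
  assumes "1 < p" "0 \<le> t" "0 < m" "t \<noteq> m"
  shows "m powr p + p * m powr (p - 1) * (t - m) < t powr p"
proof -
  have "1 + p * (t / m - 1) < (t / m) powr p"
    using assms by (intro powr_tangent_strict) (auto simp: field_simps)
  then have "m powr p * (1 + p * (t / m - 1)) < m powr p * (t powr p / m powr p)"
    using assms by (intro mult_strict_left_mono) (auto simp: powr_divide)
  moreover have "m powr p * (1 + p * (t / m - 1)) = m powr p + p * (m powr p / m) * (t - m)"
    using assms by (simp add: field_simps)
  moreover have "m powr p / m = m powr (p - 1)" using assms by (simp add: powr_diff)
  ultimately show ?thesis using assms by simp
qed

lemma powr_tangent: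
  fixes p m t :: real
  assumes "1 \<le> p" "0 \<le> t" "0 \<le> m"
  shows "m powr p + p * m powr (p - 1) * (t - m) \<le> t powr p"
\<comment> \<open>For m = 0 the left side is 0, since \<open>0 powr x = 0\<close> for every x,
  including x = 0.\<close>
proof (cases "m = 0 \<or> t = m \<or> p = 1")
  case False
  then show ?thesis using powr_tangent_strict'[of p t m] assms by simp
qed (use assms in auto)

section \<open>Uniform convexity of the p-th power of the norm\<close>

lemma midpoint_powr_less:
  fixes p s t :: real
  assumes "1 < p" "0 \<le> s" "0 \<le> t" "s \<noteq> t"
  shows "((s + t) / 2) powr p < (s powr p + t powr p) / 2"
proof -
  define m where "m = (s + t) / 2"
  have m: "m > 0" "s \<noteq> m" "t \<noteq> m" and st: "s - m = - (t - m)"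
    using assms by (auto simp: m_def field_simps)
  \<comment> \<open>The tangent at the midpoint has linear terms d and -d at the two end points, and
    they cancel on adding.\<close>
  define d where "d = p * m powr (p - 1) * (t - m)"
  have "p * m powr (p - 1) * (s - m) = - d"
    by (simp only: st mult_minus_right d_def)
  then have "m powr p - d < s powr p"
    using powr_tangent_strict'[of p s m] m assms by auto
  moreover have "m powr p + d < t powr p"
    using powr_tangent_strict'[of p t m] m assms by (auto simp: d_def)
  ultimately show ?thesis by (simp add: m_def[symmetric])
qed

text \<open>Strictness has two sources: for different norms it is the scalar inequality, and for
  equal norms the parallelogram law shows that the midpoint is strictly shorter.\<close>

lemma norm_midpoint_powr_less:
  fixes x y :: "'a::real_inner"
  assumes "1 < p" "x \<noteq> y"
  shows "norm ((1/2) *\<^sub>R (x + y)) powr p < (norm x powr p + norm y powr p) / 2"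
proof (cases "norm x = norm y")
  case False
  have "norm ((1/2) *\<^sub>R (x + y)) powr p \<le> ((norm x + norm y) / 2) powr p"
    using assms norm_triangle_ineq[of x y] by (intro powr_mono2) auto
  also have "\<dots> < (norm x powr p + norm y powr p) / 2"
    using False assms by (intro midpoint_powr_less) auto
  finally show ?thesis .
next
  case True
  have "(norm (x + y))\<^sup>2 + (norm (x - y))\<^sup>2 = 2 * (norm x)\<^sup>2 + 2 * (norm y)\<^sup>2"
    by (simp add: power2_norm_eq_inner inner_add inner_diff inner_commute)
  moreover have "(norm (x - y))\<^sup>2 > 0" using assms by simp
  moreover have "(2 * norm x)\<^sup>2 = 4 * (norm y)\<^sup>2" "(norm x)\<^sup>2 = (norm y)\<^sup>2"
    using True by (auto simp: power_mult_distrib)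
  ultimately have "(norm (x + y))\<^sup>2 < (2 * norm x)\<^sup>2" by linarith
  then have "norm (x + y) < 2 * norm x" by (rule power2_less_imp_less) auto
  then have "norm ((1/2) *\<^sub>R (x + y)) powr p < norm x powr p"
    using assms by (intro powr_less_mono2) auto
  then show ?thesis using True by simp
qed

lemma norm_midpoint_powr_le:
  fixes x y :: "'a::real_inner"
  assumes "1 < p"
  shows "norm ((1/2) *\<^sub>R (x + y)) powr p \<le> (norm x powr p + norm y powr p) / 2"
proof (cases "x = y")
  case True
  then have "(1/2) *\<^sub>R (x + y) = y" by (simp flip: scaleR_2)
  with True show ?thesis by simp
qed (use norm_midpoint_powr_less[OF assms] less_imp_le in blast)

lemma continuous_on_norm_powr [continuous_intros]:
  assumes "0 < p" "continuous_on S f"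
  shows "continuous_on S (\<lambda>x. norm (f x) powr p)"
  using assms by (intro continuous_on_powr') (auto intro: continuous_intros)

text \<open>Quantitative strict convexity of \<open>x \<mapsto> \<bar>x\<bar>\<^sup>p\<close>. By homogeneity it is enough to bound the
  convexity gap from below on the compact set \<open>\<bar>x\<bar>\<^sup>p + \<bar>y\<bar>\<^sup>p = 1\<close>, \<open>\<bar>x - y\<bar>\<^sup>p \<ge> \<eta>\<close>.\<close>

lemma norm_powr_uniformly_convex:
  fixes p \<eta> :: real
  assumes p: "1 < p" and \<eta>: "0 < \<eta>"
  obtains C where "0 \<le> C" "\<And>x y :: 'a::euclidean_space. norm (x - y) powr p \<le>
    \<eta> * (norm x powr p + norm y powr p) +
    C * ((norm x powr p + norm y powr p) / 2 - norm ((1/2) *\<^sub>R (x + y)) powr p)"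
proof -
  define S where "S = {z :: 'a \<times> 'a. norm (fst z) powr p + norm (snd z) powr p = 1 \<and>
    norm (fst z - snd z) powr p \<ge> \<eta>}"
  define gap where "gap = (\<lambda>z :: 'a \<times> 'a. (norm (fst z) powr p + norm (snd z) powr p) / 2 -
    norm ((1/2) *\<^sub>R (fst z + snd z)) powr p)"
  have bd: "norm v \<le> 1" if "norm v powr p \<le> 1" for v :: 'a
  proof (rule ccontr)
    assume "\<not> ?thesis"
    then have "1 powr p < norm v powr p" using p by (intro powr_less_mono2) auto
    then show False using that by simp
  qed
  have "closed S" unfolding S_def using p
    by (intro closed_Collect_conj closed_Collect_eq closed_Collect_le continuous_intros) auto
  moreover have "bounded S"
  proof (rule bounded_subset)
    show "bounded (cball 0 1 \<times> cball 0 1 :: ('a \<times> 'a) set)"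
      by (intro bounded_Times bounded_cball)
    show "S \<subseteq> cball 0 1 \<times> cball 0 1"
    proof
      fix z assume "z \<in> S"
      then have "norm (fst z) powr p + norm (snd z) powr p = 1" by (simp add: S_def)
      then have "norm (fst z) powr p \<le> 1" "norm (snd z) powr p \<le> 1"
        using powr_ge_zero[of "norm (fst z)" p] powr_ge_zero[of "norm (snd z)" p] by linarith+
      then show "z \<in> cball 0 1 \<times> cball 0 1" using bd by (cases z) auto
    qed
  qed
  ultimately have S: "compact S" by (simp add: compact_eq_bounded_closed)
  have pos: "gap z > 0" if "z \<in> S" for z
  proof -
    have "fst z \<noteq> snd z" using that \<eta> by (auto simp: S_def)
    then show ?thesis using norm_midpoint_powr_less[OF p, of "fst z" "snd z"] by (simp add: gap_def)
  qed
  have "\<exists>c>0. \<forall>z\<in>S. c \<le> gap z"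
  proof (cases "S = {}")
    case False
    have "continuous_on S gap" unfolding gap_def using p
      by (intro continuous_intros) auto
    then obtain z where "z \<in> S" "\<forall>w\<in>S. gap z \<le> gap w"
      using continuous_attains_inf[OF S False] by blast
    with pos show ?thesis by blast
  qed (auto intro: exI[of _ 1])
  then obtain c where c: "c > 0" "\<And>z. z \<in> S \<Longrightarrow> c \<le> gap z" by blast
  \<comment> \<open>On S both norms are at most 1, so the left side is at most 2^p = C c, which is
    at most C times the gap. Off S the term \<eta> is enough.\<close>
  define C where "C = 2 powr p / c"
  have C: "C \<ge> 0" using c by (simp add: C_def)
  have unit: "norm (x - y) powr p \<le> \<eta> * 1 + C * gap (x, y)"
    if n1: "norm x powr p + norm y powr p = 1" for x y :: 'a
  proof (cases "(x, y) \<in> S")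
    case True
    have "norm x powr p \<le> 1" "norm y powr p \<le> 1" using n1
      using powr_ge_zero[of "norm x" p] powr_ge_zero[of "norm y" p] by linarith+
    then have "norm (x - y) \<le> 2" using bd[of x] bd[of y] norm_triangle_ineq4[of x y] by linarith
    then have "norm (x - y) powr p \<le> 2 powr p" using p by (intro powr_mono2) auto
    also have "\<dots> = C * c" using c by (simp add: C_def)
    also have "\<dots> \<le> C * gap (x, y)" using C c(2)[OF True] by (rule mult_left_mono[rotated])
    finally show ?thesis using \<eta> by simp
  next
    case False
    then have "norm (x - y) powr p \<le> \<eta>" using n1 by (simp add: S_def)
    moreover have "gap (x, y) \<ge> 0" using norm_midpoint_powr_le[OF p, of x y] by (simp add: gap_def)
    ultimately show ?thesis using C by (simp add: add_increasing2)
  qed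
  have "norm (x - y) powr p \<le> \<eta> * (norm x powr p + norm y powr p) +
    C * ((norm x powr p + norm y powr p) / 2 - norm ((1/2) *\<^sub>R (x + y)) powr p)" for x y :: 'a
  proof (cases "x = 0 \<and> y = 0")
    case True
    then show ?thesis by simp
  next
    case False
    define R where "R = norm x powr p + norm y powr p"
    have R: "R > 0" using False unfolding R_def
      by (metis add_pos_nonneg add_nonneg_pos powr_ge_zero zero_less_norm_iff powr_gt_zero norm_zero
          less_irrefl)
    define k where "k = (1 / R) powr (1 / p)"
    have k: "k > 0" "k powr p = 1 / R" using R p by (auto simp: k_def powr_powr)
    have sc: "norm (k *\<^sub>R v) powr p = norm v powr p / R" for v :: 'a
      using k by (simp add: powr_mult)
    have "norm (k *\<^sub>R x - k *\<^sub>R y) powr p \<le> \<eta> * 1 + C * gap (k *\<^sub>R x, k *\<^sub>R y)"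
    proof (rule unit)
      show "norm (k *\<^sub>R x) powr p + norm (k *\<^sub>R y) powr p = 1"
        using R unfolding sc by (simp add: R_def flip: add_divide_distrib)
    qed
    moreover have "norm (k *\<^sub>R x - k *\<^sub>R y) powr p = norm (x - y) powr p / R"
      using sc[of "x - y"] by (simp add: scaleR_diff_right)
    moreover have "norm ((1/2) *\<^sub>R (k *\<^sub>R x + k *\<^sub>R y)) powr p = norm ((1/2) *\<^sub>R (x + y)) powr p / R"
      using sc[of "(1/2) *\<^sub>R (x + y)"] by (simp add: scaleR_add_right mult.commute)
    ultimately have "norm (x - y) powr p / R \<le> \<eta> +
        C * ((norm x powr p / R + norm y powr p / R) / 2 - norm ((1/2) *\<^sub>R (x + y)) powr p / R)"
      by (simp only: gap_def fst_conv snd_conv sc mult_1_right)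
    then have "R * (norm (x - y) powr p / R) \<le> R * (\<eta> +
        C * ((norm x powr p / R + norm y powr p / R) / 2 - norm ((1/2) *\<^sub>R (x + y)) powr p / R))"
      using R by (intro mult_left_mono) auto
    also have "\<dots> = \<eta> * R + C * ((norm x powr p + norm y powr p) / 2 - norm ((1/2) *\<^sub>R (x + y)) powr p)"
      using R by (simp add: field_simps)
    finally show ?thesis using R by (simp add: R_def)
  qed
  with C show thesis by (rule that)
qed

text \<open>Bounding the sum by twice the larger norm covers all exponents r >= 0 at once. This is
  the source of the factor 2^r in every quasi-triangle inequality below.\<close>

lemma norm_add_powr_le:
  fixes x y :: "'a::real_normed_vector"
  assumes "0 \<le> r"
  shows "norm (x + y) powr r \<le> 2 powr r * (norm x powr r + norm y powr r)"
proof -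
  have "norm (x + y) powr r \<le> (2 * max (norm x) (norm y)) powr r"
    using assms norm_triangle_ineq[of x y] by (intro powr_mono2) auto
  also have "\<dots> = 2 powr r * max (norm x) (norm y) powr r" by (simp add: powr_mult)
  also have "max (norm x) (norm y) powr r \<le> norm x powr r + norm y powr r"
    by (auto simp: max_def)
  finally show ?thesis by simp
qed

text \<open>If the distance d of the arguments is small relative to t, then s / t is near 1 and
  continuity of the power at 1 gives the term with \<eta>. Otherwise both s and t are bounded by a
  fixed multiple of d.\<close>

lemma norm_powr_diff_le:
  fixes r \<eta> :: real
  assumes r: "0 < r" and \<eta>: "0 < \<eta>"
  obtains C where "0 \<le> C" "\<And>x y :: 'a::real_normed_vector.
    \<bar>norm x powr r - norm y powr r\<bar> \<le> \<eta> * norm y powr r + C * norm (x - y) powr r"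
proof -
  have "isCont (\<lambda>\<tau>::real. \<tau> powr r) 1" by (intro continuous_intros) auto
  then obtain \<kappa>0 where \<kappa>0: "\<kappa>0 > 0" "\<And>\<tau>::real. \<bar>\<tau> - 1\<bar> < \<kappa>0 \<Longrightarrow> \<bar>\<tau> powr r - 1\<bar> < \<eta>"
    using \<eta> unfolding continuous_at_eps_delta by (auto simp: dist_real_def)
  define \<kappa> where "\<kappa> = \<kappa>0 / 2"
  have \<kappa>: "\<kappa> > 0" "\<And>\<tau>::real. \<bar>\<tau> - 1\<bar> \<le> \<kappa> \<Longrightarrow> \<bar>\<tau> powr r - 1\<bar> \<le> \<eta>"
    using \<kappa>0(1) \<kappa>0(2) unfolding \<kappa>_def by (auto intro!: less_imp_le)
  define C where "C = (1 / \<kappa> + 1) powr r"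
  have *: "\<bar>s powr r - t powr r\<bar> \<le> \<eta> * t powr r + C * d powr r"
    if st: "0 \<le> s" "0 \<le> t" "\<bar>s - t\<bar> \<le> d" for s t d :: real
  proof (cases "d \<le> \<kappa> * t \<and> t > 0")
    case True
    then have t: "t > 0" by simp
    have "\<bar>s / t - 1\<bar> = \<bar>s - t\<bar> / t" using t by (simp add: field_simps)
    also have "\<dots> \<le> \<kappa>" using True st t by (simp add: field_simps)
    finally have "\<bar>(s / t) powr r - 1\<bar> \<le> \<eta>" by (rule \<kappa>)
    then have "\<bar>(s / t) powr r - 1\<bar> * t powr r \<le> \<eta> * t powr r" by (intro mult_right_mono) auto
    moreover have "\<bar>(s / t) powr r - 1\<bar> * t powr r = \<bar>((s / t) powr r - 1) * t powr r\<bar>"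
      by (simp add: abs_mult)
    moreover have "((s / t) powr r - 1) * t powr r = s powr r - t powr r"
      using t st by (simp add: powr_divide field_simps)
    ultimately show ?thesis by (simp add: C_def add_increasing2)
  next
    case False
    then have td: "t \<le> d / \<kappa>" using st \<kappa>(1) by (auto simp: field_simps not_le)
    have d: "d \<ge> 0" using st by auto
    have sd: "s \<le> (1 / \<kappa> + 1) * d" using td st by (auto simp: algebra_simps)
    have td': "t \<le> (1 / \<kappa> + 1) * d" using td d by (auto simp: algebra_simps)
    have "s powr r \<le> ((1 / \<kappa> + 1) * d) powr r" "t powr r \<le> ((1 / \<kappa> + 1) * d) powr r"
      using sd td' st r by (auto intro!: powr_mono2)
    moreover have "((1 / \<kappa> + 1) * d) powr r = C * d powr r"
      using d \<kappa> by (simp add: C_def powr_mult)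
    ultimately have "\<bar>s powr r - t powr r\<bar> \<le> C * d powr r"
      using powr_ge_zero[of s r] powr_ge_zero[of t r] by linarith
    then show ?thesis using \<eta> by (simp add: add_increasing)
  qed
  show thesis
  proof (rule that[of C])
    show "\<bar>norm x powr r - norm y powr r\<bar> \<le> \<eta> * norm y powr r + C * norm (x - y) powr r" for x y :: 'a
      by (intro *) (auto intro: norm_triangle_ineq3)
  qed (simp add: C_def)
qed

section \<open>The normalized gap function and its coercivity\<close>

lemma powr_gap_nonneg:
  fixes q \<gamma> t :: real
  assumes "0 < q" "q < \<gamma>" "0 \<le> t"
  shows "1 / \<gamma> - 1 / q \<le> t powr \<gamma> / \<gamma> - t powr q / q" (is ?le)
    and "t \<noteq> 1 \<Longrightarrow> 1 / \<gamma> - 1 / q < t powr \<gamma> / \<gamma> - t powr q / q" (is "_ \<Longrightarrow> ?less")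
proof -
  show less: ?less if "t \<noteq> 1"
  proof -
    \<comment> \<open>In the variable t^q the claim is the strict tangent inequality at 1 for the
      exponent \<gamma> / q > 1, divided by \<gamma>.\<close>
    have "t powr q \<noteq> 1"
      using that assms powr_less_mono2[of q t 1] powr_less_mono2[of q 1 t] by (cases "t < 1") auto
    then have "1 + (\<gamma>/q) * (t powr q - 1) < (t powr q) powr (\<gamma>/q)"
      using assms by (intro powr_tangent_strict) auto
    also have "\<dots> = t powr \<gamma>" using assms by (simp add: powr_powr)
    finally have "(1 + (\<gamma>/q) * (t powr q - 1)) / \<gamma> < t powr \<gamma> / \<gamma>"
      using assms by (intro divide_strict_right_mono) auto
    moreover have "(1 + (\<gamma>/q) * (t powr q - 1)) / \<gamma> = 1 / \<gamma> + t powr q / q - 1 / q"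
      using assms by (simp add: add_divide_distrib diff_divide_distrib right_diff_distrib)
    ultimately show ?thesis by simp
  qed
  show ?le using less by (cases "t = 1") (auto simp: less_imp_le)
qed

text \<open>Three regimes: for large t the power \<gamma> dominates; where t is bounded and |t -
  1|^\<gamma> >= \<delta>, compactness gives the gap a positive minimum; near 1 the term \<delta>
  suffices. The loss of \<delta> is what permits the power \<gamma> on the left although the gap may
  vanish to another order at 1.\<close>

lemma powr_gap_coercive:
  fixes q \<gamma> \<delta> :: real
  assumes q: "0 < q" "q < \<gamma>" and \<delta>: "0 < \<delta>"
  obtains C where "0 \<le> C" "\<And>t. 0 \<le> t \<Longrightarrow> \<bar>t - 1\<bar> powr \<gamma> \<le>
    \<delta> + C * (t powr \<gamma> / \<gamma> - t powr q / q - (1 / \<gamma> - 1 / q))"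
proof -
  define H where "H = (\<lambda>t. t powr \<gamma> / \<gamma> - t powr q / q - (1 / \<gamma> - 1 / q))"
  \<comment> \<open>Beyond this T the term t^q / q is at most half of t^\<gamma> / \<gamma>. The
    maximum with 1 gives |t - 1| <= T on [0, T].\<close>
  define T where "T = max 1 ((2 * \<gamma> / q) powr (1 / (\<gamma> - q)))"
  have T1: "T \<ge> 1" by (simp add: T_def)
  have large: "\<bar>t - 1\<bar> powr \<gamma> \<le> 2 * \<gamma> * H t" if "t \<ge> T" for t
  proof -
    have t: "t \<ge> 1" using T1 that by simp
    have "((2 * \<gamma> / q) powr (1 / (\<gamma> - q))) powr (\<gamma> - q) \<le> t powr (\<gamma> - q)"
      using that q t by (intro powr_mono2) (auto simp: T_def)
    then have "2 * \<gamma> / q \<le> t powr (\<gamma> - q)" using q by (simp add: powr_powr)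
    then have "2 * \<gamma> / q * t powr q \<le> t powr (\<gamma> - q) * t powr q" by (intro mult_right_mono) auto
    also have "\<dots> = t powr \<gamma>" by (simp flip: powr_add)
    finally have *: "t powr q / q \<le> t powr \<gamma> / (2 * \<gamma>)" using q by (simp add: field_simps)
    have "1 / \<gamma> \<le> 1 / q" using q by (intro divide_left_mono) auto
    then have "H t \<ge> t powr \<gamma> / \<gamma> - t powr \<gamma> / (2 * \<gamma>)" using * by (simp add: H_def)
    then have "t powr \<gamma> / (2 * \<gamma>) \<le> H t" by (simp add: field_simps)
    moreover have "\<bar>t - 1\<bar> powr \<gamma> \<le> t powr \<gamma>" using t q by (intro powr_mono2) auto
    ultimately show ?thesis using q by (simp add: field_simps)
  qed
  define S where "S = {t. 0 \<le> t \<and> t \<le> T \<and> \<delta> \<le> \<bar>t - 1\<bar> powr \<gamma>}"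
  have "S = {0..T} \<inter> {t. \<delta> \<le> \<bar>t - 1\<bar> powr \<gamma>}" by (auto simp: S_def)
  moreover have "closed {t::real. \<delta> \<le> \<bar>t - 1\<bar> powr \<gamma>}"
    using continuous_on_norm_powr[of \<gamma> UNIV "\<lambda>t::real. t - 1"] q
    by (intro closed_Collect_le) (auto simp: continuous_on_diff)
  ultimately have S: "compact S" by (simp add: compact_Int_closed)
  have pos: "H t > 0" if "t \<in> S" for t
  proof -
    have "t \<noteq> 1" "t \<ge> 0" using that \<delta> by (auto simp: S_def)
    then show ?thesis using powr_gap_nonneg(2)[OF q, of t] by (simp add: H_def)
  qed
  have nn: "H t \<ge> 0" if "t \<ge> 0" for t
    using powr_gap_nonneg(1)[OF q that] by (simp add: H_def)
  have "\<exists>c>0. \<forall>z\<in>S. c \<le> H z"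
  proof (cases "S = {}")
    case False
    have "continuous_on S (\<lambda>t. t powr r)" if "r > 0" for r
      using that by (intro continuous_on_powr') (auto simp: S_def intro: continuous_intros)
    then have "continuous_on S H" unfolding H_def using q
      by (intro continuous_on_diff continuous_on_divide continuous_on_const) auto
    then obtain z where "z \<in> S" "\<forall>w\<in>S. H z \<le> H w"
      using continuous_attains_inf[OF S False] by blast
    with pos show ?thesis by blast
  qed (auto intro: exI[of _ 1])
  then obtain c where c: "c > 0" "\<And>z. z \<in> S \<Longrightarrow> c \<le> H z" by blast
  \<comment> \<open>The first summand serves t >= T. The second serves S, where the left side is at
    most T^\<gamma> and the gap is at least c.\<close>
  define C where "C = 2 * \<gamma> + T powr \<gamma> / c"
  have C: "C \<ge> 0" using c q by (simp add: C_def)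
  have "\<bar>t - 1\<bar> powr \<gamma> \<le> \<delta> + C * H t" if t: "t \<ge> 0" for t
  proof -
    consider "t \<ge> T" | "t \<in> S" | "\<bar>t - 1\<bar> powr \<gamma> \<le> \<delta>"
      using t by (cases "T \<le> t"; cases "\<delta> \<le> \<bar>t - 1\<bar> powr \<gamma>") (auto simp: S_def)
    then show ?thesis
    proof cases
      case 1
      have "2 * \<gamma> * H t \<le> C * H t" using nn[OF t] c by (intro mult_right_mono) (auto simp: C_def)
      then show ?thesis using large[OF 1] \<delta> by simp
    next
      case 2
      have "\<bar>t - 1\<bar> powr \<gamma> \<le> T powr \<gamma>" using 2 q T1 by (intro powr_mono2) (auto simp: S_def)
      also have "\<dots> = T powr \<gamma> / c * c" using c by simp
      also have "\<dots> \<le> C * H t" using c 2 q C by (intro mult_mono) (auto simp: C_def)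
      finally show ?thesis using \<delta> by simp
    next
      case 3
      then show ?thesis using C nn[OF t] by (simp add: add_increasing2)
    qed
  qed
  with C show thesis by (intro that) (auto simp: H_def)
qed

section \<open>Lebesgue spaces\<close>

lemma Lp_space_measurable: "f \<in> Lp_space M r \<Longrightarrow> f \<in> borel_measurable M"
  by (simp add: Lp_space_def)

lemma Lp_space_integrable: "f \<in> Lp_space M r \<Longrightarrow> integrable M (\<lambda>x. norm (f x) powr r)"
  by (simp add: Lp_space_def)

lemma Lp_space_add:
  fixes f g :: "'a \<Rightarrow> 'b::{banach, second_countable_topology}"
  assumes "0 \<le> r" and f: "f \<in> Lp_space M r" and g: "g \<in> Lp_space M r"
  shows "(\<lambda>x. f x + g x) \<in> Lp_space M r"
proof -
  note [measurable] = Lp_space_measurable[OF f] Lp_space_measurable[OF g]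
  have "integrable M (\<lambda>x. 2 powr r * (norm (f x) powr r + norm (g x) powr r))"
    by (intro integrable_mult_right Bochner_Integration.integrable_add Lp_space_integrable f g)
  then have "integrable M (\<lambda>x. norm (f x + g x) powr r)"
    by (rule Bochner_Integration.integrable_bound)
       (use norm_add_powr_le[OF assms(1)] in \<open>auto simp: abs_mult\<close>)
  then show ?thesis by (simp add: Lp_space_def)
qed

lemma Lp_space_scaleR:
  fixes f :: "'a \<Rightarrow> 'b::{banach, second_countable_topology}"
  assumes f: "f \<in> Lp_space M r"
  shows "(\<lambda>x. c *\<^sub>R f x) \<in> Lp_space M r"
proof -
  note [measurable] = Lp_space_measurable[OF f]
  show ?thesis using Lp_space_integrable[OF f] by (simp add: Lp_space_def powr_mult)
qed

lemma Lp_space_cmult: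
  fixes f :: "'a \<Rightarrow> real"
  shows "f \<in> Lp_space M r \<Longrightarrow> (\<lambda>x. c * f x) \<in> Lp_space M r"
  using Lp_space_scaleR[of f M r c] by simp

lemma Lp_space_diff:
  fixes f g :: "'a \<Rightarrow> 'b::{banach, second_countable_topology}"
  assumes "0 \<le> r" "f \<in> Lp_space M r" "g \<in> Lp_space M r"
  shows "(\<lambda>x. f x - g x) \<in> Lp_space M r"
  using Lp_space_add[OF assms(1,2) Lp_space_scaleR[OF assms(3), of "-1"]] by simp

lemma Lp_space_bound:
  fixes f :: "'a \<Rightarrow> 'b::{banach, second_countable_topology}"
    and g :: "'a \<Rightarrow> 'c::{banach, second_countable_topology}"
  assumes g: "g \<in> Lp_space M r" and "0 \<le> r" and [measurable]: "f \<in> borel_measurable M"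
    and le: "AE x in M. norm (f x) \<le> norm (g x)"
  shows "f \<in> Lp_space M r" "(\<integral>x. norm (f x) powr r \<partial>M) \<le> (\<integral>x. norm (g x) powr r \<partial>M)"
proof -
  have ae: "AE x in M. norm (f x) powr r \<le> norm (g x) powr r"
    using le by eventually_elim (auto intro!: powr_mono2 assms)
  have int: "integrable M (\<lambda>x. norm (f x) powr r)"
    by (rule Bochner_Integration.integrable_bound[OF Lp_space_integrable[OF g]]) (use ae in auto)
  then show "f \<in> Lp_space M r" by (simp add: Lp_space_def)
  show "(\<integral>x. norm (f x) powr r \<partial>M) \<le> (\<integral>x. norm (g x) powr r \<partial>M)"
    by (intro integral_mono_AE int Lp_space_integrable g ae)
qed

lemma Lp_space_cong_AE:
  fixes f g :: "'a \<Rightarrow> 'b::{banach, second_countable_topology}"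
  assumes "f \<in> Lp_space M r" "0 \<le> r" "g \<in> borel_measurable M" "AE x in M. f x = g x"
  shows "g \<in> Lp_space M r"
proof (rule Lp_space_bound(1)[OF assms(1-3)])
  show "AE x in M. norm (g x) \<le> norm (f x)" using assms(4) by eventually_elim simp
qed

lemma integral_norm_powr_nonneg [simp]: "0 \<le> (\<integral>x. norm (f x) powr r \<partial>M)"
  by simp

lemma integrable_bounded_mult_powr:
  fixes f :: "'a \<Rightarrow> 'b::{banach, second_countable_topology}"
  assumes f: "f \<in> Lp_space M r" and [measurable]: "c \<in> borel_measurable M"
    and K: "AE x in M. \<bar>c x\<bar> \<le> (K::real)"
  shows "integrable M (\<lambda>x. c x * norm (f x) powr r)"
proof -
  note [measurable] = Lp_space_measurable[OF f]
  have "integrable M (\<lambda>x. K * norm (f x) powr r)"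
    by (intro integrable_mult_right Lp_space_integrable f)
  then show ?thesis
  proof (rule Bochner_Integration.integrable_bound)
    show "AE x in M. norm (c x * norm (f x) powr r) \<le> norm (K * norm (f x) powr r)"
      using K by eventually_elim (auto simp: abs_mult intro!: mult_right_mono)
  qed simp
qed

text \<open>Integrating \<open>norm_powr_diff_le\<close> splits the error in two: \<eta> is chosen
  first, so that the part carried by f costs at most e / 2, and the resulting C then determines d.
  Closeness is measured by the integral of the r-th power itself.\<close>

lemma Lp_powr_integral_continuous:
  fixes f :: "'a \<Rightarrow> 'b::{banach, second_countable_topology}"
  assumes r: "0 < r" and f: "f \<in> Lp_space M r" and c [measurable]: "c \<in> borel_measurable M"
    and K: "AE x in M. \<bar>c x\<bar> \<le> (K::real)" and e: "0 < e"
  obtains d where "0 < d" "\<And>g. g \<in> Lp_space M r \<Longrightarrow> (\<integral>x. norm (g x - f x) powr r \<partial>M) < d \<Longrightarrow>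
    \<bar>(\<integral>x. c x * norm (g x) powr r \<partial>M) - (\<integral>x. c x * norm (f x) powr r \<partial>M)\<bar> < e"
proof -
  define I where "I = (\<integral>x. norm (f x) powr r \<partial>M)"
  define K' where "K' = \<bar>K\<bar>"
  have I: "I \<ge> 0" and K': "K' \<ge> 0" by (auto simp: I_def K'_def)
  have half: "x * (e / (2 * x * y)) * y = e / 2" if "x > 0" "y > 0" for x y :: real
    using that by (simp add: field_simps)
  define \<eta> where "\<eta> = e / (2 * (K' + 1) * (I + 1))"
  have \<eta>: "\<eta> > 0" using e I K' by (auto simp: \<eta>_def)
  obtain C where C: "0 \<le> C" "\<And>x y :: 'b. \<bar>norm x powr r - norm y powr r\<bar> \<le>
      \<eta> * norm y powr r + C * norm (x - y) powr r"
    using norm_powr_diff_le[OF r \<eta>] by blast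
  define d where "d = e / (2 * (K' + 1) * (C + 1))"
  have d: "d > 0" using e C K' by (auto simp: d_def)
  have "\<bar>(\<integral>x. c x * norm (g x) powr r \<partial>M) - (\<integral>x. c x * norm (f x) powr r \<partial>M)\<bar> < e"
    if g: "g \<in> Lp_space M r" and gd: "(\<integral>x. norm (g x - f x) powr r \<partial>M) < d" for g
  proof -
    have gf: "(\<lambda>x. g x - f x) \<in> Lp_space M r" using r f g by (intro Lp_space_diff) auto
    let ?X = "\<integral>x. norm (g x - f x) powr r \<partial>M"
    have int: "integrable M (\<lambda>x. c x * norm (g x) powr r)" "integrable M (\<lambda>x. c x * norm (f x) powr r)"
      using integrable_bounded_mult_powr[OF _ c K] f g by auto
    have "(\<integral>x. c x * norm (g x) powr r \<partial>M) - (\<integral>x. c x * norm (f x) powr r \<partial>M) =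
        (\<integral>x. c x * norm (g x) powr r - c x * norm (f x) powr r \<partial>M)" using int by simp
    also have "\<bar>\<dots>\<bar> \<le> (\<integral>x. K' * (\<eta> * norm (f x) powr r + C * norm (g x - f x) powr r) \<partial>M)"
    proof (rule order_trans[OF integral_abs_bound], rule integral_mono_AE)
      show "integrable M (\<lambda>x. K' * (\<eta> * norm (f x) powr r + C * norm (g x - f x) powr r))"
        using Lp_space_integrable[OF f] Lp_space_integrable[OF gf] by auto
      show "AE x in M. \<bar>c x * norm (g x) powr r - c x * norm (f x) powr r\<bar> \<le>
          K' * (\<eta> * norm (f x) powr r + C * norm (g x - f x) powr r)"
        using K
      proof eventually_elim
        case (elim x)
        have "\<bar>c x * norm (g x) powr r - c x * norm (f x) powr r\<bar> =
            \<bar>c x\<bar> * \<bar>norm (g x) powr r - norm (f x) powr r\<bar>"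
          by (simp flip: right_diff_distrib add: abs_mult)
        also have "\<dots> \<le> K' * (\<eta> * norm (f x) powr r + C * norm (g x - f x) powr r)"
          using C(2)[of "g x" "f x"] K' elim by (intro mult_mono) (auto simp: K'_def)
        finally show ?case .
      qed
    qed (use int in auto)
    also have "\<dots> = K' * \<eta> * I + K' * C * ?X"
      using Lp_space_integrable[OF f] Lp_space_integrable[OF gf] by (simp add: I_def algebra_simps)
    also have "K' * \<eta> * I \<le> (K' + 1) * \<eta> * (I + 1)" using K' \<eta> I by (intro mult_mono) auto
    also have "\<dots> = e / 2" unfolding \<eta>_def using K' I by (intro half) auto
    also have "K' * C * ?X \<le> (K' + 1) * (C + 1) * ?X"
      using K' C by (intro mult_mono) auto
    also have "(K' + 1) * (C + 1) * ?X < (K' + 1) * (C + 1) * d"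
      using K' C gd by (intro mult_strict_left_mono) auto
    also have "\<dots> = (K' + 1) * d * (C + 1)" by (simp add: mult_ac)
    also have "\<dots> = e / 2" unfolding d_def using K' C by (intro half) auto
    finally show ?thesis by simp
  qed
  with d show thesis by (rule that)
qed

text \<open>Either t^q <= \<eta>, or t^(\<gamma> - q) is at least \<eta>^((\<gamma> - q) / q) and
  multiplying by t^q gives the second term. Integrated over a finite measure, this yields both the
  inclusion of L^\<gamma> in L^q and the absorption of the q-term in the energy.\<close>

lemma powr_le_eta_powr:
  fixes t q \<gamma> \<eta> :: real
  assumes "0 < q" "q \<le> \<gamma>" "0 < \<eta>" "0 \<le> t"
  shows "t powr q \<le> \<eta> + \<eta> powr ((q - \<gamma>) / q) * t powr \<gamma>"
proof (cases "t powr q \<le> \<eta>")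
  case False
  then have t: "t > 0" using assms by (cases "t = 0") auto
  have "\<eta> powr ((\<gamma> - q) / q) \<le> (t powr q) powr ((\<gamma> - q) / q)"
    using False assms by (intro powr_mono2) auto
  also have "\<dots> = t powr (\<gamma> - q)" using assms by (simp add: powr_powr)
  finally have "\<eta> powr ((\<gamma> - q) / q) * t powr q \<le> t powr (\<gamma> - q) * t powr q"
    by (intro mult_right_mono) auto
  also have "\<dots> = t powr \<gamma>" by (simp flip: powr_add)
  finally have "\<eta> powr ((q - \<gamma>) / q) * (\<eta> powr ((\<gamma> - q) / q) * t powr q) \<le>
      \<eta> powr ((q - \<gamma>) / q) * t powr \<gamma>" by (intro mult_left_mono) auto
  moreover have "\<eta> powr ((q - \<gamma>) / q) * \<eta> powr ((\<gamma> - q) / q) = 1"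
    using assms by (simp flip: powr_add add_divide_distrib)
  then have "\<eta> powr ((q - \<gamma>) / q) * (\<eta> powr ((\<gamma> - q) / q) * t powr q) = t powr q"
    by (simp only: mult.assoc[symmetric] mult_1_left)
  ultimately show ?thesis using assms by simp
qed (use assms in \<open>simp add: add_increasing2\<close>)

lemma (in finite_measure) Lp_space_mono:
  fixes f :: "'a \<Rightarrow> 'b::{banach, second_countable_topology}"
  assumes f: "f \<in> Lp_space M \<gamma>" and "0 < q" "q \<le> \<gamma>"
  shows "f \<in> Lp_space M q"
proof -
  note [measurable] = Lp_space_measurable[OF f]
  have "integrable M (\<lambda>x. 1 + 1 powr ((q - \<gamma>) / q) * norm (f x) powr \<gamma>)"
    by (intro Bochner_Integration.integrable_add integrable_mult_right Lp_space_integrable f) auto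
  then have "integrable M (\<lambda>x. norm (f x) powr q)"
    by (rule Bochner_Integration.integrable_bound)
       (use powr_le_eta_powr[of q \<gamma> 1] assms in \<open>auto intro!: AE_I2\<close>)
  then show ?thesis by (simp add: Lp_space_def)
qed

text \<open>The constant \<eta> integrates to at most e / 2 over the finite measure; smallness of
  the \<gamma>-integral then takes care of the other term.\<close>

lemma (in finite_measure) Lp_small_exponent:
  assumes q: "0 < q" "q \<le> \<gamma>" and e: "0 < e"
  obtains d where "0 < d" "\<And>f :: 'a \<Rightarrow> 'b::{banach, second_countable_topology}.
    f \<in> Lp_space M \<gamma> \<Longrightarrow> (\<integral>x. norm (f x) powr \<gamma> \<partial>M) < d \<Longrightarrow> (\<integral>x. norm (f x) powr q \<partial>M) < e"
proof -
  define V where "V = measure M (space M)"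
  define \<eta> where "\<eta> = e / (2 * (V + 1))"
  have V: "V \<ge> 0" by (simp add: V_def)
  have \<eta>: "\<eta> > 0" using e V by (simp add: \<eta>_def)
  define C where "C = \<eta> powr ((q - \<gamma>) / q)"
  have C: "C > 0" using \<eta> by (simp add: C_def)
  have "(\<integral>x. norm (f x) powr q \<partial>M) < e"
    if f: "f \<in> Lp_space M \<gamma>" and fd: "(\<integral>x. norm (f x) powr \<gamma> \<partial>M) < e / (2 * C)"
    for f :: "'a \<Rightarrow> 'b"
  proof -
    have "(\<integral>x. norm (f x) powr q \<partial>M) \<le> (\<integral>x. \<eta> + C * norm (f x) powr \<gamma> \<partial>M)"
      using f q \<eta> by (intro integral_mono Bochner_Integration.integrable_add integrable_mult_right
        Lp_space_integrable Lp_space_mono[OF f]) (auto intro: powr_le_eta_powr simp: C_def)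
    also have "\<dots> = \<eta> * V + C * (\<integral>x. norm (f x) powr \<gamma> \<partial>M)"
      using Lp_space_integrable[OF f] by (simp add: V_def)
    also have "\<eta> * V \<le> \<eta> * (V + 1)" using \<eta> by auto
    also have "\<dots> = e / 2" using V by (simp add: \<eta>_def field_simps)
    also have "C * (\<integral>x. norm (f x) powr \<gamma> \<partial>M) < C * (e / (2 * C))"
      using fd C by (intro mult_strict_left_mono) auto
    also have "\<dots> = e / 2" using C by simp
    finally show ?thesis by simp
  qed
  with e C show thesis by (intro that[of "e / (2 * C)"]) auto
qed

section \<open>Fatou's lemma and completeness of L^r\<close>

lemma Lp_fatou:
  fixes f :: "'a \<Rightarrow> 'b::{banach, second_countable_topology}"
  assumes r: "0 < r" and [measurable]: "f \<in> borel_measurable M"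
    and F: "\<And>n. F n \<in> Lp_space M r" and le: "\<And>n. (\<integral>x. norm (F n x) powr r \<partial>M) \<le> K"
    and lim: "AE x in M. (\<lambda>n. F n x) \<longlonglongrightarrow> f x"
  shows "f \<in> Lp_space M r" "(\<integral>x. norm (f x) powr r \<partial>M) \<le> K"
proof -
  note [measurable] = Lp_space_measurable[OF F]
  have K: "K \<ge> 0" using le[of 0] integral_norm_powr_nonneg order_trans by blast
  have "(\<integral>\<^sup>+x. norm (f x) powr r \<partial>M) \<le> (\<integral>\<^sup>+x. liminf (\<lambda>n. ennreal (norm (F n x) powr r)) \<partial>M)"
  proof (rule nn_integral_mono_AE, use lim in eventually_elim)
    case (elim x)
    have "(\<lambda>n. norm (F n x) powr r) \<longlonglongrightarrow> norm (f x) powr r"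
      using elim r by (intro tendsto_powr' tendsto_norm tendsto_const) auto
    then have "liminf (\<lambda>n. ennreal (norm (F n x) powr r)) = ennreal (norm (f x) powr r)"
      by (intro lim_imp_Liminf tendsto_ennrealI) auto
    then show ?case by simp
  qed
  also have "\<dots> \<le> liminf (\<lambda>n. \<integral>\<^sup>+x. norm (F n x) powr r \<partial>M)"
    by (rule nn_integral_liminf) simp
  also have "\<dots> \<le> ennreal K"
  proof (rule Liminf_le)
    show "\<forall>\<^sub>F n in sequentially. (\<integral>\<^sup>+x. norm (F n x) powr r \<partial>M) \<le> ennreal K"
      using le by (intro always_eventually allI)
        (auto simp: nn_integral_eq_integral[OF Lp_space_integrable[OF F]] intro!: ennreal_leI)
  qed simp
  finally have *: "(\<integral>\<^sup>+x. norm (f x) powr r \<partial>M) \<le> ennreal K" .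
  then have "integrable M (\<lambda>x. norm (f x) powr r)"
    by (intro integrableI_bounded) (auto intro: le_less_trans)
  then show "f \<in> Lp_space M r" by (simp add: Lp_space_def)
  show "(\<integral>x. norm (f x) powr r \<partial>M) \<le> K"
    using * K \<open>integrable M (\<lambda>x. norm (f x) powr r)\<close> by (simp add: nn_integral_eq_integral)
qed

text \<open>Along a subsequence the r-th powers of the increments have integral at most 4^(-k). Even
  after weighting with 2^k their integrals are summable, so almost everywhere the k-th increment is
  eventually at most 2^(-k/r), and the telescoping series converges geometrically. The argument
  covers every r > 0.\<close>

lemma Lp_complete:
  fixes F :: "nat \<Rightarrow> 'a \<Rightarrow> 'b::{banach, second_countable_topology}"
  assumes r: "0 < r" and F: "\<And>n. F n \<in> Lp_space M r"
    and cauchy: "\<And>e. 0 < e \<Longrightarrow> \<exists>N. \<forall>m\<ge>N. \<forall>n\<ge>N. (\<integral>x. norm (F m x - F n x) powr r \<partial>M) < e"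
  obtains f where "f \<in> Lp_space M r" "(\<lambda>n. \<integral>x. norm (F n x - f x) powr r \<partial>M) \<longlonglongrightarrow> 0"
proof -
  note [measurable] = Lp_space_measurable[OF F]
  have dif: "(\<lambda>x. F m x - F n x) \<in> Lp_space M r" for m n using r F by (intro Lp_space_diff) auto
  have "\<exists>N. \<forall>m\<ge>N. \<forall>n\<ge>N. (\<integral>x. norm (F m x - F n x) powr r \<partial>M) < (1/4) ^ k" for k :: nat
    by (rule cauchy) simp
  then obtain N where N: "\<And>k m n. m \<ge> N k \<Longrightarrow> n \<ge> N k \<Longrightarrow>
      (\<integral>x. norm (F m x - F n x) powr r \<partial>M) < (1/4) ^ k" by metis
  \<comment> \<open>The recursion makes s strictly increasing while keeping s k beyond N k.\<close>
  define s where "s = rec_nat (N 0) (\<lambda>k sk. max (Suc sk) (N (Suc k)))"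
  have s_Suc: "s (Suc k) = max (Suc (s k)) (N (Suc k))" for k by (simp add: s_def)
  have sN: "s k \<ge> N k" for k by (cases k) (auto simp: s_Suc, simp add: s_def)
  have smono: "strict_mono s" by (rule strict_monoI_Suc) (simp add: s_Suc)
  define D where "D = (\<lambda>k x. F (s (Suc k)) x - F (s k) x)"
  have D: "(\<integral>x. norm (D k x) powr r \<partial>M) \<le> (1/4) ^ k" for k
  proof -
    have "N k \<le> s (Suc k)" using sN[of k] s_Suc[of k] by simp
    then show ?thesis unfolding D_def using sN[of k] by (intro less_imp_le[OF N])
  qed
  have Dm [measurable]: "D k \<in> borel_measurable M" for k unfolding D_def by measurable
  have "(\<integral>\<^sup>+x. (\<Sum>k. ennreal (2 ^ k * norm (D k x) powr r)) \<partial>M) =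
      (\<Sum>k. (\<integral>\<^sup>+x. ennreal (2 ^ k * norm (D k x) powr r) \<partial>M))"
    by (rule nn_integral_suminf) measurable
  also have "\<dots> \<le> (\<Sum>k. ennreal ((1/2) ^ k))"
  proof (rule suminf_le)
    fix k
    have "integrable M (\<lambda>x. 2 ^ k * norm (D k x) powr r)"
      unfolding D_def by (intro integrable_mult_right Lp_space_integrable dif)
    then have "(\<integral>\<^sup>+x. ennreal (2 ^ k * norm (D k x) powr r) \<partial>M) =
        ennreal (2 ^ k * (\<integral>x. norm (D k x) powr r \<partial>M))"
      by (subst nn_integral_eq_integral) auto
    also have "\<dots> \<le> ennreal (2 ^ k * (1/4) ^ k)"
      by (intro ennreal_leI mult_left_mono D) auto
    also have "(2::real) ^ k * (1/4) ^ k = (1/2) ^ k" by (simp flip: power_mult_distrib)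
    finally show "(\<integral>\<^sup>+x. ennreal (2 ^ k * norm (D k x) powr r) \<partial>M) \<le> ennreal ((1/2) ^ k)" .
  qed auto
  also have "\<dots> = ennreal (\<Sum>k. (1/2) ^ k)" by (intro suminf_ennreal2) auto
  also have "\<dots> < \<infinity>" by simp
  finally have "AE x in M. (\<Sum>k. ennreal (2 ^ k * norm (D k x) powr r)) \<noteq> \<infinity>"
    by (intro nn_integral_PInf_AE) auto
  then have ae: "AE x in M. convergent (\<lambda>k. F (s k) x)"
  proof eventually_elim
    case (elim x)
    have "summable (\<lambda>k. 2 ^ k * norm (D k x) powr r)"
      using elim by (intro summable_suminf_not_top) auto
    then have "(\<lambda>k. 2 ^ k * norm (D k x) powr r) \<longlonglongrightarrow> 0" by (rule summable_LIMSEQ_zero)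
    then have "\<forall>\<^sub>F k in sequentially. 2 ^ k * norm (D k x) powr r < 1"
      by (rule order_tendstoD) simp
    then have ev: "\<forall>\<^sub>F k in sequentially. norm (D k x) \<le> ((1/2) powr (1/r)) ^ k"
    proof eventually_elim
      case (elim k)
      have "norm (D k x) powr r \<le> (1/2) ^ k" 
        using elim by (simp add: power_one_over field_simps)
      then have "(norm (D k x) powr r) powr (1/r) \<le> ((1/2) ^ k) powr (1/r)"
        using r by (intro powr_mono2) auto
      also have "((1/2::real) ^ k) powr (1/r) = ((1/2) powr real k) powr (1/r)"
        by (subst powr_realpow) auto
      also have "\<dots> = ((1/2) powr (1/r)) powr real k"
        by (simp only: powr_powr mult.commute)
      also have "\<dots> = ((1/2) powr (1/r)) ^ k" by (rule powr_realpow) simp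
      finally show ?case using r by (simp add: powr_powr)
    qed
    have "summable (\<lambda>k. ((1/2::real) powr (1/r)) ^ k)"
      using r powr_less_mono2[of "1/r" "1/2" 1] by (intro summable_geometric) auto
    with ev have "summable (\<lambda>k. D k x)" by (rule summable_comparison_test_ev)
    then have "convergent (\<lambda>n. F (s 0) x + (\<Sum>k<n. D k x))"
      by (intro convergent_add convergent_const) (simp add: summable_iff_convergent)
    also have "(\<lambda>n. F (s 0) x + (\<Sum>k<n. D k x)) = (\<lambda>n. F (s n) x)"
    proof
      show "F (s 0) x + (\<Sum>k<n. D k x) = F (s n) x" for n 
      proof (induct n)
        case (Suc n)
        then show ?case by (simp add: D_def flip: add.assoc)
      qed simp
    qed
    finally show ?case .
  qed
  define f where "f = (\<lambda>x. lim (\<lambda>k. F (s k) x))"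
  have fm [measurable]: "f \<in> borel_measurable M" unfolding f_def by measurable
  have lim: "AE x in M. (\<lambda>k. F (s k) x) \<longlonglongrightarrow> f x"
    using ae by eventually_elim (simp add: f_def convergent_LIMSEQ_iff)
  \<comment> \<open>Fatou with m fixed and the subsequence index tending to infinity turns the
    Cauchy bound into a bound on the distance to f.\<close>
  have key: "(\<lambda>x. F m x - f x) \<in> Lp_space M r \<and> (\<integral>x. norm (F m x - f x) powr r \<partial>M) \<le> e"
    if K: "\<forall>m\<ge>K. \<forall>n\<ge>K. (\<integral>x. norm (F m x - F n x) powr r \<partial>M) < e" "m \<ge> K" for K m e
  proof -
    have "s (n + K) \<ge> K" for n using strict_mono_imp_increasing[OF smono, of "n + K"] by simp
    then have le: "(\<integral>x. norm (F m x - F (s (n + K)) x) powr r \<partial>M) \<le> e" for n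
      using K by (auto intro: less_imp_le)
    have "AE x in M. (\<lambda>n. F m x - F (s (n + K)) x) \<longlonglongrightarrow> F m x - f x"
      using lim by eventually_elim (intro tendsto_intros LIMSEQ_ignore_initial_segment)
    then show ?thesis using Lp_fatou[OF r _ dif le, of "\<lambda>x. F m x - f x"] by auto
  qed
  obtain K where "\<forall>m\<ge>K. \<forall>n\<ge>K. (\<integral>x. norm (F m x - F n x) powr r \<partial>M) < 1" using cauchy[of 1] by auto
  then have "(\<lambda>x. F K x - f x) \<in> Lp_space M r" using key by blast
  from Lp_space_diff[OF less_imp_le[OF r] F[of K] this] have "f \<in> Lp_space M r" by simp
  moreover have "(\<lambda>n. \<integral>x. norm (F n x - f x) powr r \<partial>M) \<longlonglongrightarrow> 0"
  proof (rule LIMSEQ_I)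
    fix e :: real assume "e > 0"
    then obtain K where "\<forall>m\<ge>K. \<forall>n\<ge>K. (\<integral>x. norm (F m x - F n x) powr r \<partial>M) < e / 2"
      using cauchy[of "e / 2"] by auto
    then have "\<forall>m\<ge>K. (\<integral>x. norm (F m x - f x) powr r \<partial>M) \<le> e / 2" using key by blast
    then show "\<exists>K. \<forall>n\<ge>K. norm ((\<integral>x. norm (F n x - f x) powr r \<partial>M) - 0) < e"
      using \<open>e > 0\<close> by (auto intro!: exI[of _ K] intro: le_less_trans)
  qed
  ultimately show thesis by (rule that)
qed

section \<open>Differentiation of power integrals along lines, and a scaled Young inequality\<close>

lemma powr_diff_bound:
  fixes s t r :: real
  assumes "1 \<le> r" "0 \<le> s" "0 \<le> t"
  shows "\<bar>s powr r - t powr r\<bar> \<le> r * max s t powr (r - 1) * \<bar>s - t\<bar>"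
proof -
  \<comment> \<open>The tangent at the larger point b lies below the value at the smaller point
    a.\<close>
  have *: "b powr r - a powr r \<le> r * b powr (r - 1) * (b - a)" "a powr r \<le> b powr r"
    if "0 \<le> a" "a \<le> b" for a b
  proof -
    have "b powr r + r * b powr (r - 1) * (a - b) \<le> a powr r"
      using that assms by (intro powr_tangent) auto
    moreover have "r * b powr (r - 1) * (a - b) = - (r * b powr (r - 1) * (b - a))"
      by (simp flip: mult_minus_right)
    ultimately show "b powr r - a powr r \<le> r * b powr (r - 1) * (b - a)" by simp
    show "a powr r \<le> b powr r" using that assms by (intro powr_mono2) auto
  qed
  show ?thesis
    using *[of s t] *[of t s] assms by (cases "s \<le> t") (auto simp: max_def)
qed

text \<open>Away from a = 0 the function is a smooth power of the squared norm. At a = 0 the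
  difference quotient has size |t|^(r - 1) |b|^r, which tends to 0 because r > 1, and the right side
  of the formula is 0 as well.\<close>

lemma norm_powr_line_derivative:
  fixes a b :: "'b::euclidean_space"
  assumes r: "1 < r"
  shows "((\<lambda>t. norm (a + t *\<^sub>R b) powr r) has_real_derivative r * norm a powr (r - 2) * (a \<bullet> b)) (at 0)"
proof (cases "a = 0")
  case True
  have "((\<lambda>t. (norm (t *\<^sub>R b) powr r - 0) / t) \<longlongrightarrow> 0) (at (0::real))"
  proof (rule tendsto_norm_zero_cancel, rule Lim_null_comparison)
    show "\<forall>\<^sub>F t::real in at 0. norm (norm ((norm (t *\<^sub>R b) powr r - 0) / t)) \<le> \<bar>t\<bar> powr (r - 1) * norm b powr r"
      by (auto simp: eventually_at powr_mult powr_diff intro!: exI[of _ 1])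
    have "((\<lambda>t::real. \<bar>t\<bar> powr (r - 1) * norm b powr r) \<longlongrightarrow> \<bar>0\<bar> powr (r - 1) * norm b powr r) (at 0)"
      using r by (intro tendsto_intros tendsto_powr') auto
    then show "((\<lambda>t::real. \<bar>t\<bar> powr (r - 1) * norm b powr r) \<longlongrightarrow> 0) (at 0)" by simp
  qed
  then show ?thesis using True by (simp add: has_field_derivative_iff)
next
  case False
  have eq: "norm v powr r = (v \<bullet> v) powr (r / 2)" for v :: 'b
    by (simp add: norm_eq_sqrt_inner powr_half_sqrt[symmetric] powr_powr)
  have "((\<lambda>t. (a \<bullet> a + t * (2 * (a \<bullet> b)) + t * t * (b \<bullet> b)) powr (r / 2)) has_real_derivative
      r / 2 * (a \<bullet> a) powr (r / 2 - 1) * (2 * (a \<bullet> b))) (at 0)"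
    using False by (auto intro!: derivative_eq_intros)
  moreover have "(a \<bullet> a) powr (r / 2 - 1) = norm a powr (r - 2)"
    by (simp add: norm_eq_sqrt_inner powr_half_sqrt[symmetric] powr_powr diff_divide_distrib)
  moreover have "a \<bullet> a + t * (2 * (a \<bullet> b)) + t * t * (b \<bullet> b) = (a + t *\<^sub>R b) \<bullet> (a + t *\<^sub>R b)" for t
    by (simp add: inner_add inner_commute algebra_simps)
  ultimately show ?thesis by (simp add: eq mult_ac)
qed

text \<open>Dominated convergence for the difference quotients along sequences tending to 0.
  Existence of the derivative is all that is asserted, because at a minimum its value is forced to
  be 0.\<close>

lemma Lp_powr_integral_line_derivative:
  fixes f g :: "'a \<Rightarrow> 'b::euclidean_space"
  assumes r: "1 < r" and f: "f \<in> Lp_space M r" and g: "g \<in> Lp_space M r"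
    and c [measurable]: "c \<in> borel_measurable M" and K: "AE x in M. \<bar>c x\<bar> \<le> (K::real)"
  shows "\<exists>D. ((\<lambda>t. \<integral>x. c x * norm (f x + t *\<^sub>R g x) powr r \<partial>M) has_real_derivative D) (at 0)"
proof -
  note [measurable] = Lp_space_measurable[OF f] Lp_space_measurable[OF g]
  define h where "h = (\<lambda>t. \<integral>x. c x * norm (f x + t *\<^sub>R g x) powr r \<partial>M)"
  define d where "d = (\<lambda>x. c x * (r * norm (f x) powr (r - 2) * (f x \<bullet> g x)))"
  have L: "(\<lambda>x. f x + t *\<^sub>R g x) \<in> Lp_space M r" for t
    using r by (intro Lp_space_add Lp_space_scaleR f g) auto
  have int: "integrable M (\<lambda>x. c x * norm (f x + t *\<^sub>R g x) powr r)" for t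
    by (intro integrable_bounded_mult_powr[OF L c K])
  have "((\<lambda>t. (h t - h 0) / (t - 0)) \<longlongrightarrow> (\<integral>x. d x \<partial>M)) (at 0)"
    unfolding tendsto_at_iff_sequentially
  proof (intro allI impI)
    fix X :: "nat \<Rightarrow> real"
    assume X0: "\<forall>i. X i \<in> UNIV - {0}" and X: "X \<longlonglongrightarrow> 0"
    then have "bounded (range X)" by (intro convergent_imp_bounded)
    then obtain B0 where B0: "\<And>n. \<bar>X n\<bar> \<le> B0" by (auto simp: bounded_iff)
    \<comment> \<open>With B >= 1 the quantity m = |f| + B |g| bounds |f|, |f + X n g| and |g|. The
      estimate r m^(r - 1) |X n| |g| then gives the majorant \<open>w\<close> after division by X
      n.\<close>
    define B where "B = max 1 B0"
    have B: "B \<ge> 1" "\<And>n. \<bar>X n\<bar> \<le> B" using B0 by (auto simp: B_def max.coboundedI2)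
    define w where "w = (\<lambda>x. \<bar>K\<bar> * (r * norm (norm (f x) + B * norm (g x)) powr r))"
    define S where "S = (\<lambda>n x. c x * ((norm (f x + X n *\<^sub>R g x) powr r - norm (f x) powr r) / X n))"
    have nL: "(\<lambda>x. norm (f x)) \<in> Lp_space M r" "(\<lambda>x. norm (g x)) \<in> Lp_space M r"
      using f g by (auto simp: Lp_space_def)
    have "(\<lambda>n. \<integral>x. S n x \<partial>M) \<longlonglongrightarrow> (\<integral>x. d x \<partial>M)"
    proof (rule integral_dominated_convergence)
      show "integrable M w" unfolding w_def using r
        by (intro integrable_mult_right Lp_space_integrable Lp_space_add Lp_space_cmult nL) auto
      show "AE x in M. (\<lambda>n. S n x) \<longlonglongrightarrow> d x"
      proof (rule AE_I2)
        fix x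
        have "((\<lambda>t. (norm (f x + t *\<^sub>R g x) powr r - norm (f x + 0 *\<^sub>R g x) powr r) / (t - 0)) \<longlongrightarrow>
            r * norm (f x) powr (r - 2) * (f x \<bullet> g x)) (at 0)"
          using norm_powr_line_derivative[OF r, of "f x" "g x"] by (simp add: has_field_derivative_iff)
        then have "(\<lambda>n. (norm (f x + X n *\<^sub>R g x) powr r - norm (f x) powr r) / X n) \<longlonglongrightarrow>
            r * norm (f x) powr (r - 2) * (f x \<bullet> g x)"
          using X0 X unfolding tendsto_at_iff_sequentially by (auto simp: o_def)
        then show "(\<lambda>n. S n x) \<longlonglongrightarrow> d x" unfolding S_def d_def by (intro tendsto_mult tendsto_const)
      qed
      show "AE x in M. norm (S n x) \<le> w x" for n
        using K
      proof eventually_elim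
        case (elim x)
        let ?a = "norm (f x + X n *\<^sub>R g x)" and ?b = "norm (f x)"
        let ?m = "?b + B * norm (g x)"
        have "norm (X n *\<^sub>R g x) \<le> B * norm (g x)" using B by (auto intro!: mult_right_mono)
        then have ab: "?a \<le> ?m" "?b \<le> ?m" using norm_triangle_ineq[of "f x" "X n *\<^sub>R g x"] B by auto
        have "1 * norm (g x) \<le> B * norm (g x)" using B(1) by (rule mult_right_mono) simp
        then have "norm (g x) \<le> ?m" by (simp add: add_increasing)
        have X_pos: "\<bar>X n\<bar> > 0" using X0 by simp
        have "\<bar>?a powr r - ?b powr r\<bar> \<le> r * max ?a ?b powr (r - 1) * \<bar>?a - ?b\<bar>"
          using r by (intro powr_diff_bound) auto
        also have "\<dots> \<le> r * ?m powr (r - 1) * (\<bar>X n\<bar> * ?m)"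
        proof (intro mult_mono powr_mono2)
          have "\<bar>?a - ?b\<bar> \<le> norm (X n *\<^sub>R g x)" using norm_triangle_ineq3[of "f x + X n *\<^sub>R g x" "f x"] by simp
          also have "\<dots> \<le> \<bar>X n\<bar> * ?m" using \<open>norm (g x) \<le> ?m\<close> by (auto intro!: mult_left_mono)
          finally show "\<bar>?a - ?b\<bar> \<le> \<bar>X n\<bar> * ?m" .
        qed (use r ab in \<open>auto simp: le_max_iff_disj\<close>)
        also have "\<dots> = \<bar>X n\<bar> * (r * ?m powr r)"
          using powr_mult_base[of ?m "r - 1"] B by (simp add: mult_ac)
        finally have "\<bar>(?a powr r - ?b powr r) / X n\<bar> \<le> r * ?m powr r"
          using X_pos by (simp add: abs_divide divide_le_eq mult.commute)
        moreover have "\<bar>c x\<bar> \<le> \<bar>K\<bar>" using elim by linarith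
        ultimately have "\<bar>c x\<bar> * \<bar>(?a powr r - ?b powr r) / X n\<bar> \<le> \<bar>K\<bar> * (r * ?m powr r)"
          by (intro mult_mono) auto
        then show ?case unfolding S_def w_def real_norm_def abs_mult[of "c x"] using B by simp
      qed
    qed (auto simp: d_def S_def)
    moreover have "(\<integral>x. S n x \<partial>M) = (h (X n) - h 0) / (X n - 0)" for n
    proof -
      have "(h (X n) - h 0) = (\<integral>x. c x * norm (f x + X n *\<^sub>R g x) powr r - c x * norm (f x + 0 *\<^sub>R g x) powr r \<partial>M)"
        unfolding h_def by (rule Bochner_Integration.integral_diff[symmetric]; rule int)
      then show ?thesis by (simp add: S_def flip: right_diff_distrib)
    qed
    ultimately show "((\<lambda>t. (h t - h 0) / (t - 0)) \<circ> X) \<longlonglongrightarrow> (\<integral>x. d x \<partial>M)" by (simp add: o_def)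
  qed
  then show ?thesis by (auto simp: has_field_derivative_iff h_def)
qed

text \<open>Young's inequality for s / k and k t, with the factors 1 / r and (r - 1) / r bounded by
  1. The parameter k allows the term of a fixed dual function to be made small first.\<close>

lemma Young_scaled:
  fixes s t r k :: real
  assumes "1 < r" "0 < k" "0 \<le> s" "0 \<le> t"
  shows "s * t \<le> (1 / k) powr r * s powr r + k powr (r / (r - 1)) * t powr (r / (r - 1))"
proof -
  have "(s / k) * (k * t) \<le> (s / k) powr r / r + (k * t) powr (r / (r - 1)) / (r / (r - 1))"
    using assms by (intro Youngs_inequality) (auto simp: field_simps)
  also have "(s / k) powr r / r \<le> (s / k) powr r" using assms 
    using assms mult_left_mono[of 1 r "(s / k) powr r"] by (simp add: divide_le_eq)
  also have "(k * t) powr (r / (r - 1)) / (r / (r - 1)) \<le> (k * t) powr (r / (r - 1))"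
    using assms mult_left_mono[of "r - 1" r "(k * t) powr (r / (r - 1))"]
    by (simp add: divide_le_eq mult_ac)
  finally show ?thesis using assms by (simp add: powr_mult powr_divide)
qed

section \<open>Test functions\<close>

lemma C_k_SucE:
  assumes "C_k (Suc k) f"
  obtains G where "\<And>x. GDERIV f x :> G x" "\<And>b. b \<in> Basis \<Longrightarrow> C_k k (\<lambda>x. G x \<bullet> b)"
  using assms by auto

lemma C_k_SucI:
  "(\<And>x. GDERIV f x :> G x) \<Longrightarrow> (\<And>b. b \<in> Basis \<Longrightarrow> C_k k (\<lambda>x. G x \<bullet> b)) \<Longrightarrow> C_k (Suc k) f"
  by auto

lemma C_k_Suc_imp: "C_k (Suc k) f \<Longrightarrow> C_k k f"
proof (induction k arbitrary: f)
  case 0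
  then obtain G where "\<And>x. GDERIV f x :> G x" by auto
  then have "continuous_on UNIV f"
    by (auto simp: gderiv_def continuous_on_eq_continuous_at intro: has_derivative_continuous)
  then show ?case by simp
next
  case (Suc k)
  then show ?case by (metis C_k.simps(2))
qed

lemma C_k_const: "C_k k (\<lambda>x. c)"
proof (induction k arbitrary: c)
  case (Suc k)
  then show ?case by (auto intro!: exI[of _ "\<lambda>_. 0"] GDERIV_const)
qed simp

lemma C_k_inner: "C_k k (\<lambda>x. x \<bullet> v)"
proof (cases k)
  case (Suc k)
  then show ?thesis
    by (auto intro!: exI[of _ "\<lambda>_. v"] C_k_const has_derivative_inner_left simp: gderiv_def
      intro: derivative_eq_intros)
qed (auto intro: continuous_intros)

lemma C_k_add: "C_k k f \<Longrightarrow> C_k k g \<Longrightarrow> C_k k (\<lambda>x. f x + g x)"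
proof (induction k arbitrary: f g)
  case (Suc k)
  obtain F where F: "\<And>x. GDERIV f x :> F x" "\<And>b. b \<in> Basis \<Longrightarrow> C_k k (\<lambda>x. F x \<bullet> b)"
    using Suc.prems(1) by (rule C_k_SucE) blast
  obtain G where G: "\<And>x. GDERIV g x :> G x" "\<And>b. b \<in> Basis \<Longrightarrow> C_k k (\<lambda>x. G x \<bullet> b)"
    using Suc.prems(2) by (rule C_k_SucE) blast
  show ?case
  proof (rule C_k_SucI)
    show "GDERIV (\<lambda>x. f x + g x) x :> F x + G x" for x by (intro GDERIV_add F G)
    show "C_k k (\<lambda>x. (F x + G x) \<bullet> b)" if "b \<in> Basis" for b
      unfolding inner_add_left by (intro Suc.IH F G that)
  qed
qed (auto intro: continuous_intros)

lemma C_k_mult: "C_k k f \<Longrightarrow> C_k k g \<Longrightarrow> C_k k (\<lambda>x. f x * g x)"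
proof (induction k arbitrary: f g)
  case (Suc k)
  obtain F where F: "\<And>x. GDERIV f x :> F x" "\<And>b. b \<in> Basis \<Longrightarrow> C_k k (\<lambda>x. F x \<bullet> b)"
    using Suc.prems(1) by (rule C_k_SucE) blast
  obtain G where G: "\<And>x. GDERIV g x :> G x" "\<And>b. b \<in> Basis \<Longrightarrow> C_k k (\<lambda>x. G x \<bullet> b)"
    using Suc.prems(2) by (rule C_k_SucE) blast
  show ?case
  proof (rule C_k_SucI)
    show "GDERIV (\<lambda>x. f x * g x) x :> f x *\<^sub>R G x + g x *\<^sub>R F x" for x
      by (intro GDERIV_mult F G)
    show "C_k k (\<lambda>x. (f x *\<^sub>R G x + g x *\<^sub>R F x) \<bullet> b)" if "b \<in> Basis" for b
      unfolding inner_add_left inner_scaleR_left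
      by (intro C_k_add Suc.IH F G that Suc.prems[THEN C_k_Suc_imp])
  qed
qed (auto intro: continuous_intros)

lemma C_k_cmult: "C_k k f \<Longrightarrow> C_k k (\<lambda>x. c * f x)"
  by (intro C_k_mult C_k_const)

lemma C_k_diff: "C_k k f \<Longrightarrow> C_k k g \<Longrightarrow> C_k k (\<lambda>x. f x - g x)"
  using C_k_add[of k f "\<lambda>x. -1 * g x"] C_k_cmult[of k g "-1"] by simp

lemma C_k_sum: "finite I \<Longrightarrow> (\<And>i. i \<in> I \<Longrightarrow> C_k k (f i)) \<Longrightarrow> C_k k (\<lambda>x. \<Sum>i\<in>I. f i x)"
  by (induction I rule: finite_induct) (auto intro: C_k_const C_k_add)

lemma C_k_prod: "finite I \<Longrightarrow> (\<And>i. i \<in> I \<Longrightarrow> C_k k (f i)) \<Longrightarrow> C_k k (\<lambda>x. \<Prod>i\<in>I. f i x)"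
  by (induction I rule: finite_induct) (auto intro: C_k_const C_k_mult)

lemma C_k_power: "C_k k f \<Longrightarrow> C_k k (\<lambda>x. f x ^ n)"
  by (induction n) (auto intro: C_k_const C_k_mult)

lemma C_k_compose:
  fixes h :: "real \<Rightarrow> real"
  shows "C_k k h \<Longrightarrow> C_k k f \<Longrightarrow> C_k k (\<lambda>x. h (f x))"
proof (induction k arbitrary: h f)
  case (Suc k)
  obtain H where H: "\<And>t. GDERIV h t :> H t" "\<And>b. b \<in> Basis \<Longrightarrow> C_k k (\<lambda>x. H x \<bullet> b)"
    using Suc.prems(1) by (rule C_k_SucE) blast
  obtain F where F: "\<And>x. GDERIV f x :> F x" "\<And>b. b \<in> Basis \<Longrightarrow> C_k k (\<lambda>x. F x \<bullet> b)"
    using Suc.prems(2) by (rule C_k_SucE) blast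
  have H': "C_k k H" using H(2)[of 1] by simp
  show ?case
  proof (rule C_k_SucI)
    show "GDERIV (\<lambda>x. h (f x)) x :> H (f x) *\<^sub>R F x" for x
      using H(1) by (intro GDERIV_DERIV_compose F) simp
    show "C_k k (\<lambda>x. (H (f x) *\<^sub>R F x) \<bullet> b)" if "b \<in> Basis" for b
      unfolding inner_scaleR_left 
      by (rule C_k_mult[OF Suc.IH[OF H' Suc.prems(2)[THEN C_k_Suc_imp]] F(2)[OF that]])
  qed
next
  case 0
  then show ?case using continuous_on_compose2[of UNIV h UNIV f] by simp
qed

lemma C_k_real_polynomial_function:
  assumes "real_polynomial_function P"
  shows "C_k k P"
  using assms
proof induction
  case (linear f)
  have lin: "linear f" using linear by (rule bounded_linear.linear)
  have "f x = (\<Sum>b\<in>Basis. f b * (x \<bullet> b))" for x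
  proof -
    have "f x = f (\<Sum>b\<in>Basis. (x \<bullet> b) *\<^sub>R b)" by (simp only: euclidean_representation)
    also have "\<dots> = (\<Sum>b\<in>Basis. f ((x \<bullet> b) *\<^sub>R b))" by (rule linear_sum[OF lin])
    also have "\<dots> = (\<Sum>b\<in>Basis. f b * (x \<bullet> b))"
      by (rule sum.cong) (simp_all add: linear_cmul[OF lin] mult.commute)
    finally show ?thesis .
  qed
  then have "f = (\<lambda>x. \<Sum>b\<in>Basis. f b * (x \<bullet> b))" by (rule ext)
  then have "C_k k f = C_k k (\<lambda>x. \<Sum>b\<in>Basis. f b * (x \<bullet> b))" by (rule arg_cong)
  moreover have "C_k k (\<lambda>x. \<Sum>b\<in>Basis. f b * (x \<bullet> b))"
    by (intro C_k_sum C_k_cmult C_k_inner finite_Basis)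
  ultimately show ?case by (rule iffD2)
qed (auto intro: C_k_const C_k_add C_k_mult)

section \<open>A smooth function supported in a ball\<close>

definition bump :: "nat \<Rightarrow> real \<Rightarrow> real" where
  "bump n t = (if t \<le> 0 then 0 else exp (- inverse t) * inverse t ^ n)"

lemma bump_tendsto_0: "((\<lambda>t. bump n t) \<longlongrightarrow> 0) (at 0)"
proof (rule filterlim_split_at)
  show "((\<lambda>t. bump n t) \<longlongrightarrow> 0) (at_left 0)"
    by (rule tendsto_eventually) (auto simp: bump_def eventually_at_left_field intro!: exI[of _ "-1"])
  have "((\<lambda>t. inverse t ^ n / exp (inverse t)) \<longlongrightarrow> (0::real)) (at_right 0)"
    by (rule filterlim_compose[OF tendsto_power_div_exp_0 filterlim_inverse_at_top_right])
  moreover have "\<forall>\<^sub>F t in at_right 0. inverse t ^ n / exp (inverse t) = bump n t"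
    by (auto simp: bump_def eventually_at_right_field exp_minus field_simps intro!: exI[of _ 1])
  ultimately show "((\<lambda>t. bump n t) \<longlongrightarrow> 0) (at_right 0)"
    by (rule Lim_transform_eventually)
qed

lemma bump_derivative:
  "(bump n has_real_derivative bump (n + 2) t - real n * bump (n + 1) t) (at t)"
proof -
  consider "t < 0" | "t = 0" | "t > 0" by linarith
  then show ?thesis
  proof cases
    case 1
    have "((\<lambda>_. 0) has_real_derivative 0) (at t)" by simp
    then have "(bump n has_real_derivative 0) (at t)"
      by (rule has_field_derivative_transform_within_open[of _ _ _ "{..<0}"]) (use 1 in \<open>auto simp: bump_def\<close>)
    then show ?thesis using 1 by (simp add: bump_def)
  next
    case 2
    \<comment> \<open>At the origin the difference quotient of \<open>bump n\<close> is exactly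
      \<open>bump (Suc n)\<close>, also at h = 0, where division by 0 yields 0.\<close>
    have "bump (Suc n) = (\<lambda>h. (bump n h - bump n 0) / (h - 0))"
      by (auto simp: bump_def fun_eq_iff field_simps)
    then show ?thesis using bump_tendsto_0[of "Suc n"] 2
      by (simp add: has_field_derivative_iff) (simp add: bump_def)
  next
    case 3
    define i where "i = inverse t"
    have inv: "(inverse has_real_derivative - (i * i)) (at t)"
      using DERIV_inverse[of t] 3 by (simp add: i_def power2_eq_square)
    have pow: "((\<lambda>t. inverse t ^ n) has_real_derivative - real n * i ^ (n + 1)) (at t)"
      by (rule DERIV_cong[OF DERIV_power[OF inv]]) (cases n; simp add: i_def algebra_simps)
    have ex: "((\<lambda>t. exp (- inverse t)) has_real_derivative exp (- i) * (i * i)) (at t)"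
      by (rule DERIV_cong[OF DERIV_chain2[OF DERIV_exp DERIV_minus[OF inv]]]) (simp add: i_def)
    have "((\<lambda>t. exp (- inverse t) * inverse t ^ n) has_real_derivative
        bump (n + 2) t - real n * bump (n + 1) t) (at t)"
      by (rule DERIV_cong[OF DERIV_mult[OF ex pow]]) (use 3 in \<open>simp add: bump_def i_def algebra_simps\<close>)
    then show ?thesis
      by (rule has_field_derivative_transform_within_open[of _ _ _ "{0<..}"]) (use 3 in \<open>auto simp: bump_def\<close>)
  qed
qed

text \<open>The derivative of \<open>bump n\<close> is a linear combination of
  \<open>bump (n + 2)\<close> and \<open>bump (n + 1)\<close>. The extra index n thus closes the
  family under differentiation and lets the induction on k run.\<close>

lemma C_k_bump: "C_k k (bump n)"
proof (induction k arbitrary: n)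
  case 0
  have "continuous (at t) (bump n)" for t using bump_derivative[of n t] by (rule DERIV_isCont)
  then show ?case by (simp add: continuous_on_eq_continuous_at)
next
  case (Suc k)
  show ?case
  proof (rule C_k_SucI)
    show "GDERIV (bump n) t :> bump (n + 2) t - real n * bump (n + 1) t" for t
      unfolding gderiv_deriv by (rule bump_derivative)
    show "C_k k (\<lambda>t. (bump (n + 2) t - real n * bump (n + 1) t) \<bullet> b)" if "b \<in> Basis" for b
      unfolding inner_real_def using that by (intro C_k_mult C_k_const C_k_diff Suc)
  qed
qed

text \<open>The squared distance is written in coordinates so that the closure rules for
  \<open>C_k\<close> apply directly.\<close>

definition ball_bump :: "'a::euclidean_space \<Rightarrow> real \<Rightarrow> 'a \<Rightarrow> real" where
  "ball_bump c r x = bump 0 (r\<^sup>2 - (\<Sum>b\<in>Basis. (x \<bullet> b - c \<bullet> b) ^ 2))"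

lemma C_k_ball_bump: "C_k k (ball_bump c r)"
  unfolding ball_bump_def
  by (rule C_k_compose[OF C_k_bump])
     (intro C_k_diff C_k_const C_k_sum C_k_power C_k_inner finite_Basis)

lemma ball_bump_eq: "ball_bump c r x = bump 0 (r\<^sup>2 - (dist c x)\<^sup>2)"
proof -
  have "(\<Sum>b\<in>Basis. (x \<bullet> b - c \<bullet> b) ^ 2) = (x - c) \<bullet> (x - c)"
    by (subst euclidean_inner) (simp add: inner_diff_left power2_eq_square)
  moreover have "(dist c x)\<^sup>2 = (x - c) \<bullet> (x - c)"
    by (metis dist_commute dist_norm power2_norm_eq_inner)
  ultimately show ?thesis by (simp add: ball_bump_def)
qed

lemma ball_bump_nonneg: "0 \<le> ball_bump c r x" and ball_bump_le_1: "ball_bump c r x \<le> 1"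
  by (auto simp: ball_bump_eq bump_def)

lemma ball_bump_eq_0_iff: "0 < r \<Longrightarrow> ball_bump c r x = 0 \<longleftrightarrow> x \<notin> ball c r"
  using power_less_imp_less_base[of "dist c x" 2 r] power_strict_mono[of "dist c x" r 2]
  by (auto simp: ball_bump_eq bump_def not_le)

section \<open>The algebra of test functions and their gradients\<close>

lemma test_functionI:
  assumes "\<And>k. C_k k f" "compact K" "K \<subseteq> \<Omega>" "\<And>x. x \<notin> K \<Longrightarrow> f x = 0"
  shows "f \<in> test_functions \<Omega>"
proof -
  have "{x. f x \<noteq> 0} \<subseteq> K" using assms(4) by auto
  then have *: "closure {x. f x \<noteq> 0} \<subseteq> K"
    using assms(2) by (meson closure_minimal compact_imp_closed)
  then have "compact (closure {x. f x \<noteq> 0})"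
    using compact_Int_closed[OF assms(2) closed_closure, of "{x. f x \<noteq> 0}"] by (simp add: Int_absorb1)
  with * assms show ?thesis by (auto simp: test_functions_def)
qed

lemma test_functionE:
  assumes "f \<in> test_functions \<Omega>"
  obtains K where "\<And>k. C_k k f" "compact K" "K \<subseteq> \<Omega>" "\<And>x. x \<notin> K \<Longrightarrow> f x = 0"
proof (rule that[of "closure {x. f x \<noteq> 0}"])
  show "x \<notin> closure {x. f x \<noteq> 0} \<Longrightarrow> f x = 0" for x using closure_subset by force
qed (use assms in \<open>auto simp: test_functions_def\<close>)

lemma test_functions_mult_smooth:
  assumes "f \<in> test_functions \<Omega>" "\<And>k. C_k k g"
  shows "(\<lambda>x. g x * f x) \<in> test_functions \<Omega>"
proof -
  obtain K where "\<And>k. C_k k f" "compact K" "K \<subseteq> \<Omega>" "\<And>x. x \<notin> K \<Longrightarrow> f x = 0"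
    using assms(1) by (rule test_functionE) blast
  then show ?thesis using assms(2) by (intro test_functionI[of _ K] C_k_mult) auto
qed

lemma test_functions_cmult: "f \<in> test_functions \<Omega> \<Longrightarrow> (\<lambda>x. c * f x) \<in> test_functions \<Omega>"
  by (rule test_functions_mult_smooth) (auto intro: C_k_const)

lemma test_functions_mult: 
  "f \<in> test_functions \<Omega> \<Longrightarrow> g \<in> test_functions \<Omega> \<Longrightarrow> (\<lambda>x. f x * g x) \<in> test_functions \<Omega>"
  by (rule test_functions_mult_smooth) (auto simp: test_functions_def)

lemma test_functions_add:
  assumes "f \<in> test_functions \<Omega>" "g \<in> test_functions \<Omega>"
  shows "(\<lambda>x. f x + g x) \<in> test_functions \<Omega>"
proof -
  obtain K where K: "\<And>k. C_k k f" "compact K" "K \<subseteq> \<Omega>" "\<And>x. x \<notin> K \<Longrightarrow> f x = 0"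
    using assms(1) by (rule test_functionE) blast
  obtain L where "\<And>k. C_k k g" "compact L" "L \<subseteq> \<Omega>" "\<And>x. x \<notin> L \<Longrightarrow> g x = 0"
    using assms(2) by (rule test_functionE) blast
  with K show ?thesis by (intro test_functionI[of _ "K \<union> L"] C_k_add) auto
qed

lemma test_functions_diff:
  assumes "f \<in> test_functions \<Omega>" "g \<in> test_functions \<Omega>"
  shows "(\<lambda>x. f x - g x) \<in> test_functions \<Omega>"
  using test_functions_add[OF assms(1) test_functions_cmult[OF assms(2), of "-1"]] by simp

lemma test_functions_0: "(\<lambda>x. 0) \<in> test_functions \<Omega>"
  by (rule test_functionI[of _ "{}"]) (auto intro: C_k_const)

lemma ball_bump_test:
  assumes "0 < r" "cball c r \<subseteq> \<Omega>"
  shows "ball_bump c r \<in> test_functions \<Omega>"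
  using assms ball_bump_eq_0_iff[of r c]
  by (intro test_functionI[of _ "cball c r"] C_k_ball_bump) auto

lemma gradient_eq:
  assumes "GDERIV f x :> D"
  shows "gradient f x = D"
  unfolding gradient_def
proof (rule the_equality)
  fix D' assume "GDERIV f x :> D'"
  then have "(\<lambda>h. h \<bullet> D') = (\<lambda>h. h \<bullet> D)"
    using assms unfolding gderiv_def by (rule has_derivative_unique)
  then show "D' = D" using vector_eq_ldot[of D' D] vector_eq_rdot[of D' D] by (simp add: fun_eq_iff)
qed (rule assms)

lemma test_function_GDERIV:
  assumes "f \<in> test_functions \<Omega>"
  shows "GDERIV f x :> gradient f x" "continuous_on UNIV (gradient f)"
proof -
  have "C_k 1 f" using assms by (simp add: test_functions_def)
  then obtain G where G: "\<And>x. GDERIV f x :> G x" "\<And>b. b \<in> Basis \<Longrightarrow> continuous_on UNIV (\<lambda>x. G x \<bullet> b)"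
    by auto
  have eq: "gradient f = G" using gradient_eq[OF G(1)] by auto
  show "GDERIV f x :> gradient f x" using G(1) eq by simp
  show "continuous_on UNIV (gradient f)"
    unfolding eq by (rule continuous_on_componentwise[THEN iffD2]) (use G(2) in blast)
qed

lemma test_function_continuous: "f \<in> test_functions \<Omega> \<Longrightarrow> continuous_on UNIV f"
  by (auto simp: test_functions_def dest: spec[of _ 0])

lemma test_function_gradient_eq_0:
  assumes f: "f \<in> test_functions \<Omega>" and K: "compact K" "\<And>x. x \<notin> K \<Longrightarrow> f x = 0" "x \<notin> K"
  shows "gradient f x = 0"
proof (rule gradient_eq)
  have "((\<lambda>_. 0) has_derivative (\<lambda>_. 0)) (at x)" by simp
  then have "(f has_derivative (\<lambda>_. 0)) (at x)"
    by (rule has_derivative_transform_within_open[of _ _ _ _ "- K"])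
       (use K in \<open>auto simp: compact_imp_closed open_Compl\<close>)
  then show "GDERIV f x :> 0" by (simp add: gderiv_def)
qed

lemma gradient_diff:
  assumes "f \<in> test_functions \<Omega>" "g \<in> test_functions \<Omega>"
  shows "gradient (\<lambda>x. f x - g x) x = gradient f x - gradient g x"
  by (rule gradient_eq[OF GDERIV_diff[OF assms[THEN test_function_GDERIV(1)]]])

lemma gradient_add:
  assumes "f \<in> test_functions \<Omega>" "g \<in> test_functions \<Omega>"
  shows "gradient (\<lambda>x. f x + g x) x = gradient f x + gradient g x"
  by (rule gradient_eq[OF GDERIV_add[OF assms[THEN test_function_GDERIV(1)]]])

lemma gradient_cmult:
  assumes "f \<in> test_functions \<Omega>"
  shows "gradient (\<lambda>x. c * f x) x = c *\<^sub>R gradient f x"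
  using gradient_eq[OF GDERIV_mult[OF GDERIV_const test_function_GDERIV(1)[OF assms]]] by auto

lemma gradient_mult:
  assumes "f \<in> test_functions \<Omega>" "g \<in> test_functions \<Omega>"
  shows "gradient (\<lambda>x. f x * g x) x = f x *\<^sub>R gradient g x + g x *\<^sub>R gradient f x"
  by (rule gradient_eq[OF GDERIV_mult[OF assms[THEN test_function_GDERIV(1)]]])

section \<open>Integration by parts for test functions\<close>

lemma integrable_continuous_compact_support:
  fixes f :: "'a::euclidean_space \<Rightarrow> 'b::euclidean_space"
  assumes "continuous_on UNIV f" "compact K" "\<And>x. x \<notin> K \<Longrightarrow> f x = 0"
  shows "integrable lborel f"
proof -
  have "integrable lborel (\<lambda>x. indicator K x *\<^sub>R f x)"
    using assms by (intro borel_integrable_compact) (auto intro: continuous_on_subset)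
  also have "(\<lambda>x. indicator K x *\<^sub>R f x) = f" using assms(3) by (auto simp: fun_eq_iff indicator_def)
  finally show ?thesis .
qed

text \<open>The bridge between two settings: the problem is stated over
  \<open>lebesgue_on \<Omega>\<close>, whereas translation, scaling and Fubini arguments are carried
  out over \<open>lborel\<close>.\<close>

lemma lebesgue_on_lborel:
  fixes f :: "'a::euclidean_space \<Rightarrow> 'b::euclidean_space"
  assumes \<Omega>: "open \<Omega>" and f: "f \<in> borel_measurable borel" and 0: "\<And>x. x \<notin> \<Omega> \<Longrightarrow> f x = 0"
  shows "integrable (lebesgue_on \<Omega>) f \<longleftrightarrow> integrable lborel f"
    and "(\<integral>x. f x \<partial>lebesgue_on \<Omega>) = (\<integral>x. f x \<partial>lborel)"
proof -
  have S: "\<Omega> \<inter> space lebesgue \<in> sets lebesgue" using \<Omega> by auto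
  have eq: "(\<lambda>x. indicator \<Omega> x *\<^sub>R f x) = f" using 0 by (auto simp: fun_eq_iff indicator_def)
  show "integrable (lebesgue_on \<Omega>) f \<longleftrightarrow> integrable lborel f"
    using integrable_restrict_space[OF S, of f] f by (simp add: eq integrable_completion)
  show "(\<integral>x. f x \<partial>lebesgue_on \<Omega>) = (\<integral>x. f x \<partial>lborel)"
    using integral_restrict_space[OF S, of f] f by (simp add: eq integral_completion)
qed

lemma borel_measurable_lebesgue_on_borel:
  "f \<in> borel_measurable borel \<Longrightarrow> f \<in> borel_measurable (lebesgue_on \<Omega>)"
  by (rule measurable_restrict_space1) (simp add: measurable_completion)

lemma borel_measurable_continuous_lebesgue_on:
  fixes f :: "'a::euclidean_space \<Rightarrow> 'b::topological_space"
  shows "continuous_on UNIV f \<Longrightarrow> f \<in> borel_measurable (lebesgue_on \<Omega>)"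
  by (intro borel_measurable_lebesgue_on_borel borel_measurable_continuous_onI)

text \<open>Translation invariance of \<open>\<integral> f\<close> makes the integral of the difference quotients vanish.\<close>

lemma integral_gradient_eq_0:
  fixes f :: "'a::euclidean_space \<Rightarrow> real"
  assumes f: "f \<in> test_functions \<Omega>"
  shows "(\<integral>x. gradient f x \<partial>lborel) = 0"
proof -
  obtain K where K: "compact K" "\<And>x. x \<notin> K \<Longrightarrow> f x = 0" using f by (rule test_functionE) blast
  have G0: "\<And>x. x \<notin> K \<Longrightarrow> gradient f x = 0" using test_function_gradient_eq_0[OF f K] by blast
  note G = test_function_GDERIV[OF f]
  have intG: "integrable lborel (gradient f)"
    by (rule integrable_continuous_compact_support[OF G(2) K(1) G0])
  have intf: "integrable lborel f"
    by (rule integrable_continuous_compact_support[OF test_function_continuous[OF f] K])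
  have fm [measurable]: "f \<in> borel_measurable borel" using intf by simp
  obtain B where B: "B > 0" "\<And>x. x \<in> K \<Longrightarrow> norm (gradient f x) \<le> B"
  proof -
    have "compact (gradient f ` K)" using G(2) K(1)
      by (intro compact_continuous_image) (auto intro: continuous_on_subset)
    then show thesis using that by (auto dest!: compact_imp_bounded simp: bounded_pos)
  qed
  have B': "norm (gradient f x) \<le> B" for x using B G0[of x] by (cases "x \<in> K") auto
  \<comment> \<open>The sum of K with the unit ball contains the supports of all difference
    quotients of step at most 1, so B times its indicator is an integrable majorant.\<close>
  define K' where "K' = {x + y | x y. x \<in> K \<and> y \<in> cball 0 1}"
  have K': "compact K'" unfolding K'_def by (intro compact_sums K compact_cball)
  have "(\<integral>x. gradient f x \<bullet> b \<partial>lborel) = 0" if b: "b \<in> Basis" for b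
  proof -
    define h where "h = (\<lambda>n::nat. 1 / (real n + 1))"
    have h: "0 < h n" "h n \<le> 1" "h n \<noteq> 0" for n by (auto simp: h_def)
    define S where "S = (\<lambda>n x. (f (h n *\<^sub>R b + x) - f x) / h n)"
    have int: "integrable lborel (\<lambda>x. f (h n *\<^sub>R b + x))" "(\<integral>x. f (h n *\<^sub>R b + x) \<partial>lborel) = (\<integral>x. f x \<partial>lborel)" for n
      using integrable_distr_eq[of "(+) (h n *\<^sub>R b)" lborel borel f] intf
        integral_distr[of "(+) (h n *\<^sub>R b)" lborel borel f] by (simp_all add: lborel_distr_plus)
    have "(\<lambda>n. \<integral>x. S n x \<partial>lborel) \<longlonglongrightarrow> (\<integral>x. gradient f x \<bullet> b \<partial>lborel)"
    proof (rule integral_dominated_convergence)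
      show "integrable lborel (\<lambda>x. indicator K' x *\<^sub>R B)"
        using K' by (intro borel_integrable_compact) auto
      show "AE x in lborel. (\<lambda>n. S n x) \<longlonglongrightarrow> gradient f x \<bullet> b"
      proof (rule AE_I2)
        fix x
        have "((\<lambda>t. f (t *\<^sub>R b + x)) has_derivative (\<lambda>t. (t *\<^sub>R b) \<bullet> gradient f x)) (at 0)"
        proof -
          have "((\<lambda>t. t *\<^sub>R b + x) has_derivative (\<lambda>t. t *\<^sub>R b)) (at (0::real))"
            by (auto intro!: derivative_eq_intros)
          moreover have "(f has_derivative (\<lambda>h. h \<bullet> gradient f x)) (at (0 *\<^sub>R b + x))"
            using G(1)[of x] by (simp add: gderiv_def)
          ultimately show ?thesis by (rule has_derivative_compose)
        qed
        then have "((\<lambda>t. f (t *\<^sub>R b + x)) has_real_derivative (gradient f x \<bullet> b)) (at 0)"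
          by (rule has_derivative_imp_has_field_derivative) (simp add: inner_commute)
        then have "((\<lambda>t. (f (t *\<^sub>R b + x) - f x) / t) \<longlongrightarrow> gradient f x \<bullet> b) (at 0)"
          by (simp add: has_field_derivative_iff)
        moreover have "h \<longlonglongrightarrow> 0" unfolding h_def using LIMSEQ_inverse_real_of_nat
          by (simp add: inverse_eq_divide add.commute)
        ultimately show "(\<lambda>n. S n x) \<longlonglongrightarrow> gradient f x \<bullet> b"
          using h(3) unfolding tendsto_at_iff_sequentially S_def by (simp add: o_def)
      qed
      show "AE x in lborel. norm (S n x) \<le> indicator K' x *\<^sub>R B" for n
      proof (rule AE_I2)
        fix x
        have "norm (f (h n *\<^sub>R b + x) - f x) \<le> B * norm (h n *\<^sub>R b + x - x)"
        proof (rule differentiable_bound[of UNIV])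
          show "(f has_derivative (\<lambda>h. h \<bullet> gradient f x)) (at x within UNIV)" for x
            using G(1)[of x] by (simp add: gderiv_def)
          show "onorm (\<lambda>h. h \<bullet> gradient f x) \<le> B" for x
          proof (rule onorm_bound)
            show "norm (h \<bullet> gradient f x) \<le> B * norm h" for h
              using Cauchy_Schwarz_ineq2[of h "gradient f x"] mult_left_mono[OF B'[of x], of "norm h"]
              by (simp add: mult.commute)
          qed (use B in auto)
        qed auto
        then have *: "\<bar>S n x\<bar> \<le> B" using h(1)[of n] b by (simp add: S_def field_simps)
        show "norm (S n x) \<le> indicator K' x *\<^sub>R B"
        proof (cases "x \<in> K'")
          case False
          have "x + 0 \<in> K'" if "x \<in> K" unfolding K'_def using that by fastforce
          then have "x \<notin> K" using False by auto
          moreover have "h n *\<^sub>R b + x \<notin> K"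
          proof
            assume "h n *\<^sub>R b + x \<in> K"
            moreover have "- (h n *\<^sub>R b) \<in> cball 0 1" using b h[of n] by simp
            ultimately have "(h n *\<^sub>R b + x) + (- (h n *\<^sub>R b)) \<in> K'" unfolding K'_def by blast
            then show False using False by simp
          qed
          ultimately show ?thesis using K(2) B by (simp add: S_def)
        qed (use * in simp)
      qed
    qed (use intG in \<open>auto simp: S_def\<close>)
    moreover have "(\<integral>x. S n x \<partial>lborel) = 0" for n
      unfolding S_def using int intf by simp
    ultimately show ?thesis by (simp add: LIMSEQ_const_iff)
  qed
  moreover have "(\<integral>x. gradient f x \<bullet> b \<partial>lborel) = (\<integral>x. gradient f x \<partial>lborel) \<bullet> b" for b
    by (rule integral_inner_left) (rule intG)
  ultimately show ?thesis by - (rule euclidean_eqI, simp)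
qed

lemma integrable_continuous_lebesgue_on_compact:
  fixes f :: "'a::euclidean_space \<Rightarrow> 'b::euclidean_space"
  assumes "continuous_on UNIV f" "compact K"
  shows "integrable (lebesgue_on K) f"
proof -
  have m: "f \<in> borel_measurable borel" using assms by (intro borel_measurable_continuous_onI)
  have "integrable lborel (\<lambda>x. indicator K x *\<^sub>R f x)"
    using assms by (intro borel_integrable_compact) (auto intro: continuous_on_subset)
  then have "integrable lebesgue (\<lambda>x. indicator K x *\<^sub>R f x)"
    using m assms(2) by (subst integrable_completion) auto
  then show ?thesis using fmeasurableD[OF lmeasurable_compact[OF assms(2)]]
    by (subst integrable_restrict_space) auto
qed

text \<open>The product f g is again a test function, so the integral of its gradient vanishes; the
  product rule turns this into integration by parts.\<close>

lemma test_function_weak_gradient: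
  fixes f :: "'a::euclidean_space \<Rightarrow> real"
  assumes \<Omega>: "open \<Omega>" and f: "f \<in> test_functions \<Omega>"
  shows "is_weak_gradient \<Omega> f (gradient f)"
  unfolding is_weak_gradient_def locally_integrable_def
proof (intro conjI allI impI ballI)
  fix g assume g: "g \<in> test_functions \<Omega>"
  obtain K where K: "compact K" "K \<subseteq> \<Omega>" "\<And>x. x \<notin> K \<Longrightarrow> f x = 0" using f by (rule test_functionE) blast
  obtain L where L: "compact L" "L \<subseteq> \<Omega>" "\<And>x. x \<notin> L \<Longrightarrow> g x = 0" using g by (rule test_functionE) blast
  note c = test_function_continuous[OF f] test_function_continuous[OF g]
    test_function_GDERIV(2)[OF f] test_function_GDERIV(2)[OF g]
  have c1: "continuous_on UNIV (\<lambda>x. f x *\<^sub>R gradient g x)" and c2: "continuous_on UNIV (\<lambda>x. g x *\<^sub>R gradient f x)"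
    using c by (auto intro: continuous_intros)
  have i1: "integrable lborel (\<lambda>x. f x *\<^sub>R gradient g x)"
    by (rule integrable_continuous_compact_support[OF c1 K(1)]) (use K in auto)
  have i2: "integrable lborel (\<lambda>x. g x *\<^sub>R gradient f x)"
    by (rule integrable_continuous_compact_support[OF c2 L(1)]) (use L in auto)
  have "(\<integral>x. f x *\<^sub>R gradient g x + g x *\<^sub>R gradient f x \<partial>lborel) = 0"
    using integral_gradient_eq_0[OF test_functions_mult[OF f g]] by (simp add: gradient_mult[OF f g])
  then have "(\<integral>x. f x *\<^sub>R gradient g x \<partial>lborel) = - (\<integral>x. g x *\<^sub>R gradient f x \<partial>lborel)"
    using i1 i2 by (simp add: eq_neg_iff_add_eq_0)
  moreover have "(\<integral>x. f x *\<^sub>R gradient g x \<partial>lebesgue_on \<Omega>) = (\<integral>x. f x *\<^sub>R gradient g x \<partial>lborel)"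
    using K by (intro lebesgue_on_lborel(2) \<Omega> borel_measurable_continuous_onI c1) auto
  moreover have "(\<integral>x. g x *\<^sub>R gradient f x \<partial>lebesgue_on \<Omega>) = (\<integral>x. g x *\<^sub>R gradient f x \<partial>lborel)"
    using L by (intro lebesgue_on_lborel(2) \<Omega> borel_measurable_continuous_onI c2) auto
  ultimately show "(\<integral>x. f x *\<^sub>R gradient g x \<partial>lebesgue_on \<Omega>) = - (\<integral>x. g x *\<^sub>R gradient f x \<partial>lebesgue_on \<Omega>)"
    by simp
qed (use test_function_continuous[OF f] test_function_GDERIV[OF f] in
  \<open>auto intro!: integrable_continuous_lebesgue_on_compact\<close>)


subsection \<open>Density\<close>

text \<open>A measurable function is an almost everywhere limit of continuous ones; truncating at M
  preserves the limit and makes the approximants bounded, and Stone-Weierstrass replaces them on K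
  by polynomials with error 1 / (n + 1). The polynomials supply smoothness, the uniform bound
  supplies dominated convergence.\<close>

lemma bounded_polynomial_approximation:
  fixes g :: "'a::euclidean_space \<Rightarrow> real"
  assumes g: "g \<in> borel_measurable lebesgue" and M: "\<And>x. \<bar>g x\<bar> \<le> M" and K: "compact K"
  obtains P :: "nat \<Rightarrow> 'a \<Rightarrow> real" where "\<And>n. real_polynomial_function (P n)"
    "\<And>n x. x \<in> K \<Longrightarrow> \<bar>P n x\<bar> \<le> M + 1"
    "AE x in lebesgue. x \<in> K \<longrightarrow> (\<lambda>n. P n x) \<longlonglongrightarrow> g x"
proof -
  have "g measurable_on UNIV"
    using g measurable_on_iff_borel_measurable[of UNIV g] by (simp add: lebesgue_on_UNIV_eq)
  then obtain N h where N: "negligible N" and h: "\<And>n. continuous_on UNIV (h n)"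
    "\<And>x. x \<notin> N \<Longrightarrow> (\<lambda>n. h n x) \<longlonglongrightarrow> g x"
    unfolding measurable_on_def by auto
  have M0: "M \<ge> 0" using M[of undefined] by simp
  define k where "k = (\<lambda>n x. max (- M) (min M (h n x)))"
  have k: "continuous_on UNIV (k n)" "\<bar>k n x\<bar> \<le> M" for n x
    using M0 by (auto simp: k_def intro!: continuous_intros h)
  have klim: "(\<lambda>n. k n x) \<longlonglongrightarrow> g x" if "x \<notin> N" for x
  proof -
    have "(\<lambda>n. k n x) \<longlonglongrightarrow> max (- M) (min M (g x))"
      unfolding k_def by (intro tendsto_intros h that)
    moreover have "max (- M) (min M (g x)) = g x" using M[of x] by auto
    ultimately show ?thesis by simp
  qed
  have "\<exists>P. real_polynomial_function P \<and> (\<forall>x\<in>K. \<bar>k n x - P x\<bar> < 1 / (real n + 1))" for n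
    using Stone_Weierstrass_real_polynomial_function[OF K, of "k n" "1 / (real n + 1)"] k(1)
    by (metis continuous_on_subset subset_UNIV divide_pos_pos of_nat_0_le_iff zero_less_one add_nonneg_pos)
  then obtain P where P: "\<And>n. real_polynomial_function (P n)"
    "\<And>n x. x \<in> K \<Longrightarrow> \<bar>k n x - P n x\<bar> < 1 / (real n + 1)" by metis
  show thesis
  proof (rule that[of P])
    show "\<bar>P n x\<bar> \<le> M + 1" if "x \<in> K" for n x
    proof -
      have "1 / (real n + 1) \<le> 1" by simp
      then show ?thesis using P(2)[OF that, of n] k(2)[of n x] by linarith
    qed
    have "(\<lambda>n. P n x) \<longlonglongrightarrow> g x" if "x \<in> K" "x \<notin> N" for x
    proof -
      have "(\<lambda>n. k n x - P n x) \<longlonglongrightarrow> 0"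
      proof (rule Lim_null_comparison)
        show "\<forall>\<^sub>F n in sequentially. norm (k n x - P n x) \<le> 1 / (real n + 1)"
          using P(2)[OF that(1)] by (intro always_eventually allI) (simp add: less_imp_le)
        show "(\<lambda>n. 1 / (real n + 1)) \<longlonglongrightarrow> 0" using LIMSEQ_inverse_real_of_nat
          by (simp add: inverse_eq_divide add.commute)
      qed
      from tendsto_diff[OF klim[OF that(2)] this] show ?thesis by simp
    qed
    moreover have "AE x in lebesgue. x \<notin> N"
      using N by (intro AE_not_in) (simp add: negligible_iff_null_sets)
    ultimately show "AE x in lebesgue. x \<in> K \<longrightarrow> (\<lambda>n. P n x) \<longlonglongrightarrow> g x"
      by (auto elim: eventually_mono)
  qed (rule P)
qed

text \<open>Lindelof applied to all closed balls inside the set. Radius 0 stands for an empty ball: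
  it pads the index set so that it can be enumerated by the natural numbers even when the set is
  empty.\<close>

lemma open_countable_balls:
  fixes \<Omega> :: "'a::euclidean_space set"
  assumes \<Omega>: "open \<Omega>"
  obtains c :: "nat \<Rightarrow> 'a" and r :: "nat \<Rightarrow> real" where "\<And>n. 0 \<le> r n"
    "\<And>n. 0 < r n \<Longrightarrow> cball (c n) (r n) \<subseteq> \<Omega>" "\<Omega> = (\<Union>n. ball (c n) (r n))"
proof -
  define I where "I = insert (0, 0) {(c, r). 0 < r \<and> cball c r \<subseteq> \<Omega>}"
  define F where "F = (\<lambda>(c, r). ball c r) ` I"
  have F: "\<Union>F = \<Omega>"
  proof
    show "\<Union>F \<subseteq> \<Omega>" unfolding F_def I_def using ball_subset_cball by fastforce
    show "\<Omega> \<subseteq> \<Union>F"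
    proof
      fix x assume "x \<in> \<Omega>"
      then obtain r where "r > 0" "cball x r \<subseteq> \<Omega>" using \<Omega> open_contains_cball by blast
      then have "(x, r) \<in> I" "x \<in> ball x r" by (auto simp: I_def)
      then show "x \<in> \<Union>F" unfolding F_def by blast
    qed
  qed
  obtain F' where F': "F' \<subseteq> F" "countable F'" "\<Union>F' = \<Union>F"
    by (rule Lindelof[of F]) (auto simp: F_def)
  obtain J where J: "J \<subseteq> I" "countable J" "F' = (\<lambda>(c, r). ball c r) ` J"
    using F'(1,2) unfolding F_def by (metis countable_subset_image)
  define f where "f = from_nat_into (insert (0, 0) J)"
  have rf: "range f = insert (0, 0) J" unfolding f_def
    using J(2) by (intro range_from_nat_into) auto
  have "(0, 0) \<in> I" by (simp add: I_def)
  then have fI: "f n \<in> I" for n using rf J(1) rangeI[of f n] by auto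
  show thesis
  proof (rule that[of "\<lambda>n. snd (f n)" "\<lambda>n. fst (f n)"])
    show "0 \<le> snd (f n)" for n using fI[of n] by (auto simp: I_def)
    show "cball (fst (f n)) (snd (f n)) \<subseteq> \<Omega>" if "0 < snd (f n)" for n
      using fI[of n] that by (auto simp: I_def)
    have "(\<Union>n. ball (fst (f n)) (snd (f n))) = \<Union>((\<lambda>(c, r). ball c r) ` range f)"
      by (auto simp: split_def)
    also have "\<dots> = \<Union>F'" unfolding rf J(3) by simp
    finally show "\<Omega> = (\<Union>n. ball (fst (f n)) (snd (f n)))" using F F' by simp
  qed
qed

text \<open>With bumps \<psi> i on a countable ball cover, the function 1 - \<Prod>i<n. (1 - \<psi>
  i)^n is supported in finitely many of the closed balls. At a point of ball i the product is at
  most (1 - \<psi> i)^n as soon as n > i, and this tends to 0.\<close>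

lemma test_function_exhaustion:
  fixes \<Omega> :: "'a::euclidean_space set"
  assumes \<Omega>: "open \<Omega>"
  obtains \<tau> :: "nat \<Rightarrow> 'a \<Rightarrow> real" where "\<And>n. \<tau> n \<in> test_functions \<Omega>"
    "\<And>n x. 0 \<le> \<tau> n x" "\<And>n x. \<tau> n x \<le> 1" "\<And>x. x \<in> \<Omega> \<Longrightarrow> (\<lambda>n. \<tau> n x) \<longlonglongrightarrow> 1"
proof -
  obtain c :: "nat \<Rightarrow> 'a" and r :: "nat \<Rightarrow> real" where r: "\<And>n. 0 \<le> r n"
    "\<And>n. 0 < r n \<Longrightarrow> cball (c n) (r n) \<subseteq> \<Omega>" and cover: "\<Omega> = (\<Union>n. ball (c n) (r n))"
    by (rule open_countable_balls[OF \<Omega>]) blast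
  define \<psi> where "\<psi> = (\<lambda>n x. if r n = 0 then 0 else ball_bump (c n) (r n) x)"
  have \<psi>: "0 \<le> \<psi> n x" "\<psi> n x \<le> 1" for n x
    by (auto simp: \<psi>_def ball_bump_nonneg ball_bump_le_1)
  have Ck: "C_k k (\<psi> n)" for k n
    unfolding \<psi>_def by (cases "r n = 0") (auto intro: C_k_const C_k_ball_bump)
  define \<tau> where "\<tau> = (\<lambda>n x. 1 - (\<Prod>i<n. (1 - \<psi> i x) ^ n))"
  have pb: "0 \<le> (\<Prod>i<n. (1 - \<psi> i x) ^ n)" "(\<Prod>i<n. (1 - \<psi> i x) ^ n) \<le> 1" for n x
    using \<psi> by (auto intro!: prod_nonneg prod_le_1 power_le_one)
  show thesis
  proof (rule that[of \<tau>])
    show "\<tau> n \<in> test_functions \<Omega>" for n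
    proof (rule test_functionI[of _ "\<Union>i\<in>{i. i < n \<and> 0 < r i}. cball (c i) (r i)"])
      show "C_k k (\<tau> n)" for k unfolding \<tau>_def
        by (intro C_k_diff C_k_const C_k_prod C_k_power Ck) auto
      show "compact (\<Union>i\<in>{i. i < n \<and> 0 < r i}. cball (c i) (r i))"
        by (intro compact_UN) auto
      show "(\<Union>i\<in>{i. i < n \<and> 0 < r i}. cball (c i) (r i)) \<subseteq> \<Omega>" using r by blast
      show "\<tau> n x = 0" if "x \<notin> (\<Union>i\<in>{i. i < n \<and> 0 < r i}. cball (c i) (r i))" for x
      proof -
        have "\<psi> i x = 0" if i: "i < n" for i
        proof (cases "r i = 0")
          case False
          then have "r i > 0" using r(1)[of i] by simp
          moreover have "x \<notin> ball (c i) (r i)" using that i \<open>r i > 0\<close>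
            \<open>x \<notin> (\<Union>i\<in>{i. i < n \<and> 0 < r i}. cball (c i) (r i))\<close> by auto
          ultimately show ?thesis by (simp add: \<psi>_def ball_bump_eq_0_iff)
        qed (simp add: \<psi>_def)
        then show ?thesis by (simp add: \<tau>_def)
      qed
    qed
    show "0 \<le> \<tau> n x" "\<tau> n x \<le> 1" for n x using pb[of x n] by (auto simp: \<tau>_def)
    show "(\<lambda>n. \<tau> n x) \<longlonglongrightarrow> 1" if x: "x \<in> \<Omega>" for x
    proof -
      obtain i where i: "x \<in> ball (c i) (r i)" using x unfolding cover by blast
      then have ri: "r i > 0" using zero_le_dist[of "c i" x] unfolding mem_ball by linarith
      then have "\<psi> i x \<noteq> 0" using i ball_bump_eq_0_iff[of "r i" "c i" x] by (simp add: \<psi>_def)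
      then have i': "0 \<le> 1 - \<psi> i x" "1 - \<psi> i x < 1" using \<psi>[of i x] by auto
      have "(\<lambda>n. \<Prod>j<n. (1 - \<psi> j x) ^ n) \<longlonglongrightarrow> 0"
      proof (rule Lim_null_comparison)
        show "\<forall>\<^sub>F n in sequentially. norm (\<Prod>j<n. (1 - \<psi> j x) ^ n) \<le> (1 - \<psi> i x) ^ n"
          using eventually_gt_at_top[of i]
        proof eventually_elim
          case (elim n)
          have "(\<Prod>j<n. (1 - \<psi> j x) ^ n) = (1 - \<psi> i x) ^ n * (\<Prod>j\<in>{..<n} - {i}. (1 - \<psi> j x) ^ n)"
            using elim by (intro prod.remove) auto
          also have "\<dots> \<le> (1 - \<psi> i x) ^ n * 1"
            using \<psi> i' by (intro mult_left_mono prod_le_1) (auto intro!: power_le_one)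
          finally show ?case using pb(1)[of x n] by simp
        qed
        show "(\<lambda>n. (1 - \<psi> i x) ^ n) \<longlonglongrightarrow> 0" using i' by (intro LIMSEQ_realpow_zero) auto
      qed
      from tendsto_diff[OF tendsto_const[of 1] this] show ?thesis by (simp add: \<tau>_def)
    qed
  qed
qed

lemma finite_measure_lebesgue_on_bounded:
  "open \<Omega> \<Longrightarrow> bounded \<Omega> \<Longrightarrow> finite_measure (lebesgue_on \<Omega>)"
  by (intro finite_measure_lebesgue_on lmeasurable_open)

text \<open>Polynomials supply the approximation and the cutoffs \<tau> n supply compact support.
  Their product converges almost everywhere with a uniform bound, and the measure is finite.\<close>

lemma test_functions_dense:
  fixes g :: "'a::euclidean_space \<Rightarrow> real"
  assumes \<Omega>: "open \<Omega>" "bounded \<Omega>" and g: "g \<in> borel_measurable (lebesgue_on \<Omega>)"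
    and M: "AE x in lebesgue_on \<Omega>. \<bar>g x\<bar> \<le> M" and r: "0 < r" and e: "0 < e"
  obtains \<phi> where "\<phi> \<in> test_functions \<Omega>" "(\<integral>x. norm (\<phi> x - g x) powr r \<partial>lebesgue_on \<Omega>) < e"
proof -
  interpret finite_measure "lebesgue_on \<Omega>" using \<Omega> by (rule finite_measure_lebesgue_on_bounded)
  have S: "\<Omega> \<in> sets lebesgue" "\<Omega> \<inter> space lebesgue \<in> sets lebesgue" using \<Omega> by auto
  define B where "B = \<bar>M\<bar>"
  \<comment> \<open>The bound on g holds almost everywhere only. Truncation and extension by 0 give
    a representative bounded on the whole space, as the polynomial approximation demands.\<close>
  define g' where "g' = (\<lambda>x. if x \<in> \<Omega> then max (- B) (min B (g x)) else 0)"
  have g'b: "\<bar>g' x\<bar> \<le> B" for x by (auto simp: g'_def B_def)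
  have "(\<lambda>x. max (- B) (min B (g x))) \<in> borel_measurable (lebesgue_on \<Omega>)" using g by measurable
  then have g'm: "g' \<in> borel_measurable lebesgue"
    using borel_measurable_if_I[OF _ S(1)] unfolding g'_def by auto
  have gg': "AE x in lebesgue_on \<Omega>. g' x = g x"
    using M by (subst (asm) AE_restrict_space_iff[OF S(2)], subst AE_restrict_space_iff[OF S(2)])
      (auto simp: g'_def B_def elim!: eventually_mono)
  have cl: "compact (closure \<Omega>)" using \<Omega> by (simp add: compact_closure)
  obtain P where P: "\<And>n. real_polynomial_function (P n)"
    "\<And>n x. x \<in> closure \<Omega> \<Longrightarrow> \<bar>P n x\<bar> \<le> B + 1"
    "AE x in lebesgue. x \<in> closure \<Omega> \<longrightarrow> (\<lambda>n. P n x) \<longlonglongrightarrow> g' x"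
    by (rule bounded_polynomial_approximation[OF g'm g'b cl]) blast
  obtain \<tau> :: "nat \<Rightarrow> 'a \<Rightarrow> real" where \<tau>: "\<And>n. \<tau> n \<in> test_functions \<Omega>"
    "\<And>n x. 0 \<le> \<tau> n x" "\<And>n x. \<tau> n x \<le> 1" "\<And>x. x \<in> \<Omega> \<Longrightarrow> (\<lambda>n. \<tau> n x) \<longlonglongrightarrow> 1"
    by (rule test_function_exhaustion[OF \<Omega>(1)]) blast
  define \<phi> where "\<phi> = (\<lambda>n x. P n x * \<tau> n x)"
  have \<phi>: "\<phi> n \<in> test_functions \<Omega>" for n
    unfolding \<phi>_def by (intro test_functions_mult_smooth \<tau> C_k_real_polynomial_function P)
  have \<phi>m: "\<phi> n \<in> borel_measurable (lebesgue_on \<Omega>)" for n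
    by (intro borel_measurable_continuous_lebesgue_on test_function_continuous[OF \<phi>])
  have "(\<lambda>n. \<integral>x. norm (\<phi> n x - g x) powr r \<partial>lebesgue_on \<Omega>) \<longlonglongrightarrow> (\<integral>x. 0 \<partial>lebesgue_on \<Omega>)"
  proof (rule integral_dominated_convergence)
    show "integrable (lebesgue_on \<Omega>) (\<lambda>x. (2 * B + 1) powr r)" by simp
    have "AE x in lebesgue_on \<Omega>. (\<lambda>n. P n x) \<longlonglongrightarrow> g' x"
      using P(3) closure_subset[of \<Omega>] by (subst AE_restrict_space_iff[OF S(2)]) (auto elim!: eventually_mono)
    moreover have "AE x in lebesgue_on \<Omega>. x \<in> \<Omega>" using AE_space[of "lebesgue_on \<Omega>"] by simp
    ultimately show "AE x in lebesgue_on \<Omega>. (\<lambda>n. norm (\<phi> n x - g x) powr r) \<longlonglongrightarrow> 0" using gg'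
    proof eventually_elim
      case (elim x)
      have "(\<lambda>n. \<phi> n x) \<longlonglongrightarrow> g' x * 1" unfolding \<phi>_def by (intro tendsto_mult elim(1) \<tau>(4) elim(2))
      then have "(\<lambda>n. \<phi> n x) \<longlonglongrightarrow> g x" using elim(3) by simp
      then have "(\<lambda>n. norm (\<phi> n x - g x)) \<longlonglongrightarrow> 0" by (intro tendsto_norm_zero LIM_zero)
      from tendsto_powr'[OF this tendsto_const[of r]] r show ?case by simp
    qed
    have "AE x in lebesgue_on \<Omega>. x \<in> \<Omega>" using AE_space[of "lebesgue_on \<Omega>"] by simp
    then show "AE x in lebesgue_on \<Omega>. norm (norm (\<phi> n x - g x) powr r) \<le> (2 * B + 1) powr r" for n
      using gg'
    proof eventually_elim
      case (elim x)
      have "\<bar>P n x\<bar> * \<bar>\<tau> n x\<bar> \<le> (B + 1) * 1"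
        using P(2)[of x n] \<tau>(2,3)[of n x] elim closure_subset[of \<Omega>]
        by (intro mult_mono) (auto simp: B_def)
      then have "\<bar>\<phi> n x\<bar> \<le> B + 1" by (simp add: \<phi>_def abs_mult)
      then have "norm (\<phi> n x - g x) \<le> 2 * B + 1" using g'b[of x] elim(2) by simp
      then show ?case using r by (auto intro!: powr_mono2)
    qed
  qed (use \<phi>m g in measurable)
  then have "\<forall>\<^sub>F n in sequentially. (\<integral>x. norm (\<phi> n x - g x) powr r \<partial>lebesgue_on \<Omega>) < e"
    using e by (intro order_tendstoD) auto
  then show thesis using that \<phi> by (auto simp: eventually_sequentially)
qed

lemma locally_integrable_mult_test:
  fixes h :: "'a::euclidean_space \<Rightarrow> 'b::euclidean_space"
  assumes \<Omega>: "open \<Omega>" and h: "locally_integrable \<Omega> h" and f: "f \<in> test_functions \<Omega>"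
  shows "integrable (lebesgue_on \<Omega>) (\<lambda>x. f x *\<^sub>R h x)"
proof -
  obtain K where K: "compact K" "K \<subseteq> \<Omega>" "\<And>x. x \<notin> K \<Longrightarrow> f x = 0" using f by (rule test_functionE) blast
  have SK: "K \<in> sets lebesgue" using lmeasurable_compact[OF K(1)] by (rule fmeasurableD)
  have S\<Omega>: "\<Omega> \<in> sets lebesgue" using \<Omega> by auto
  have c: "continuous_on UNIV f" using f by (rule test_function_continuous)
  have "compact (f ` K)" using c K(1) by (intro compact_continuous_image) (auto intro: continuous_on_subset)
  then obtain B where "\<forall>x\<in>K. \<bar>f x\<bar> \<le> B" by (auto dest!: compact_imp_bounded simp: bounded_iff)
  then have B: "\<bar>f x\<bar> \<le> B" if "x \<in> K" for x using that by blast
  have hK: "integrable (lebesgue_on K) h" using h K by (auto simp: locally_integrable_def)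
  then have "integrable (lebesgue_on K) (\<lambda>x. B *\<^sub>R h x)" by simp
  then have "integrable (lebesgue_on K) (\<lambda>x. f x *\<^sub>R h x)"
  proof (rule Bochner_Integration.integrable_bound)
    have "h \<in> borel_measurable (lebesgue_on K)" "f \<in> borel_measurable (lebesgue_on K)"
      using hK c by (auto intro: borel_measurable_continuous_lebesgue_on)
    then show "(\<lambda>x. f x *\<^sub>R h x) \<in> borel_measurable (lebesgue_on K)" by measurable
    show "AE x in lebesgue_on K. norm (f x *\<^sub>R h x) \<le> norm (B *\<^sub>R h x)"
    proof (rule AE_I2)
      fix x assume "x \<in> space (lebesgue_on K)"
      then have "\<bar>f x\<bar> \<le> \<bar>B\<bar>" using B[of x] by auto
      then show "norm (f x *\<^sub>R h x) \<le> norm (B *\<^sub>R h x)" by (auto intro: mult_right_mono)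
    qed
  qed
  then have "integrable lebesgue (\<lambda>x. indicator K x *\<^sub>R f x *\<^sub>R h x)"
    using SK by (simp add: integrable_restrict_space)
  also have "(\<lambda>x. indicator K x *\<^sub>R f x *\<^sub>R h x) = (\<lambda>x. indicator \<Omega> x *\<^sub>R f x *\<^sub>R h x)"
    using K by (auto simp: fun_eq_iff indicator_def)
  finally show ?thesis using S\<Omega> by (simp add: integrable_restrict_space)
qed

text \<open>On a ball h is tested with a bump \<psi> times polynomials converging boundedly to the
  sign of h. In the limit the integral of \<psi> |h| vanishes, and \<psi> is positive inside the
  ball. Countably many balls cover the set.\<close>

lemma fundamental_lemma_variations:
  fixes h :: "'a::euclidean_space \<Rightarrow> real"
  assumes \<Omega>: "open \<Omega>" and h: "h \<in> borel_measurable (lebesgue_on \<Omega>)"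
    and int: "\<And>f. f \<in> test_functions \<Omega> \<Longrightarrow> integrable (lebesgue_on \<Omega>) (\<lambda>x. f x * h x)"
    and 0: "\<And>f. f \<in> test_functions \<Omega> \<Longrightarrow> (\<integral>x. f x * h x \<partial>lebesgue_on \<Omega>) = 0"
  shows "AE x in lebesgue_on \<Omega>. h x = 0"
proof -
  have S: "\<Omega> \<in> sets lebesgue" "\<Omega> \<inter> space lebesgue \<in> sets lebesgue" using \<Omega> by auto
  have ball: "AE x in lebesgue_on \<Omega>. x \<in> ball c r \<longrightarrow> h x = 0" if r: "0 < r" "cball c r \<subseteq> \<Omega>" for c r
  proof -
    define \<psi> where "\<psi> = ball_bump c r"
    have \<psi>: "\<psi> \<in> test_functions \<Omega>" unfolding \<psi>_def using r by (rule ball_bump_test)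
    have \<psi>0: "\<psi> x = 0" if "x \<notin> cball c r" for x using that ball_bump_eq_0_iff[of r c x] r by (auto simp: \<psi>_def)
    define g where "g = (\<lambda>x. if x \<in> \<Omega> then sgn (h x) else 0)"
    have "(\<lambda>x. sgn (h x)) \<in> borel_measurable (lebesgue_on \<Omega>)" using h by measurable
    then have gm: "g \<in> borel_measurable lebesgue"
      using borel_measurable_if_I[OF _ S(1)] unfolding g_def by auto
    have gb: "\<bar>g x\<bar> \<le> 1" for x by (auto simp: g_def sgn_real_def)
    obtain P where P: "\<And>n. real_polynomial_function (P n)"
      "\<And>n x. x \<in> cball c r \<Longrightarrow> \<bar>P n x\<bar> \<le> 1 + 1"
      "AE x in lebesgue. x \<in> cball c r \<longrightarrow> (\<lambda>n. P n x) \<longlonglongrightarrow> g x"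
      by (rule bounded_polynomial_approximation[OF gm gb compact_cball]) blast
    have t: "(\<lambda>x. P n x * \<psi> x) \<in> test_functions \<Omega>" for n
      by (intro test_functions_mult_smooth \<psi> C_k_real_polynomial_function P)
    have \<psi>m: "\<psi> \<in> borel_measurable (lebesgue_on \<Omega>)"
      by (intro borel_measurable_continuous_lebesgue_on test_function_continuous[OF \<psi>])
    have "(\<lambda>n. \<integral>x. P n x * \<psi> x * h x \<partial>lebesgue_on \<Omega>) \<longlonglongrightarrow> (\<integral>x. \<psi> x * \<bar>h x\<bar> \<partial>lebesgue_on \<Omega>)"
    proof (rule integral_dominated_convergence)
      show "integrable (lebesgue_on \<Omega>) (\<lambda>x. 2 * \<bar>\<psi> x * h x\<bar>)" using int[OF \<psi>] by simp
      show "(\<lambda>x. \<psi> x * \<bar>h x\<bar>) \<in> borel_measurable (lebesgue_on \<Omega>)" using \<psi>m h by measurable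
      show "(\<lambda>x. P n x * \<psi> x * h x) \<in> borel_measurable (lebesgue_on \<Omega>)" for n
        using int[OF t] by (rule borel_measurable_integrable)
      have "AE x in lebesgue_on \<Omega>. x \<in> cball c r \<longrightarrow> (\<lambda>n. P n x) \<longlonglongrightarrow> g x"
        using P(3) by (subst AE_restrict_space_iff[OF S(2)]) (auto elim!: eventually_mono)
      moreover have "AE x in lebesgue_on \<Omega>. x \<in> \<Omega>" using AE_space[of "lebesgue_on \<Omega>"] by simp
      ultimately show "AE x in lebesgue_on \<Omega>. (\<lambda>n. P n x * \<psi> x * h x) \<longlonglongrightarrow> \<psi> x * \<bar>h x\<bar>"
      proof eventually_elim
        case (elim x)
        show ?case
        proof (cases "x \<in> cball c r")
          case True
          then have "(\<lambda>n. P n x * \<psi> x * h x) \<longlonglongrightarrow> g x * \<psi> x * h x"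
            using elim by (intro tendsto_intros) auto
          moreover have "g x * \<psi> x * h x = \<psi> x * \<bar>h x\<bar>" using elim(2) by (simp add: g_def sgn_real_def)
          ultimately show ?thesis by simp
        qed (simp add: \<psi>0)
      qed
      show "AE x in lebesgue_on \<Omega>. norm (P n x * \<psi> x * h x) \<le> 2 * \<bar>\<psi> x * h x\<bar>" for n
      proof (rule AE_I2)
        fix x
        show "norm (P n x * \<psi> x * h x) \<le> 2 * \<bar>\<psi> x * h x\<bar>"
        proof (cases "x \<in> cball c r")
          case True
          then have "\<bar>P n x\<bar> * \<bar>\<psi> x * h x\<bar> \<le> 2 * \<bar>\<psi> x * h x\<bar>"
            using P(2)[of x n] by (intro mult_right_mono) auto
          then show ?thesis by (simp add: abs_mult mult.assoc)
        qed (simp add: \<psi>0)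
      qed
    qed
    then have "(\<integral>x. \<psi> x * \<bar>h x\<bar> \<partial>lebesgue_on \<Omega>) = 0" using 0[OF t] by (simp add: LIMSEQ_const_iff)
    moreover have "integrable (lebesgue_on \<Omega>) (\<lambda>x. \<psi> x * \<bar>h x\<bar>)"
    proof -
      have "(\<lambda>x. \<psi> x * \<bar>h x\<bar>) = (\<lambda>x. \<bar>\<psi> x * h x\<bar>)"
        by (auto simp: abs_mult \<psi>_def ball_bump_nonneg)
      then show ?thesis using int[OF \<psi>] by simp
    qed
    ultimately have "AE x in lebesgue_on \<Omega>. \<psi> x * \<bar>h x\<bar> = 0"
      by (subst (asm) integral_nonneg_eq_0_iff_AE) (auto simp: \<psi>_def ball_bump_nonneg)
    then show ?thesis using ball_bump_eq_0_iff[OF r(1), of c]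
      by (auto simp: \<psi>_def elim!: eventually_mono)
  qed
  obtain c :: "nat \<Rightarrow> 'a" and r :: "nat \<Rightarrow> real" where r: "\<And>n. 0 \<le> r n"
    "\<And>n. 0 < r n \<Longrightarrow> cball (c n) (r n) \<subseteq> \<Omega>" and cover: "\<Omega> = (\<Union>n. ball (c n) (r n))"
    by (rule open_countable_balls[OF \<Omega>]) blast
  have "AE x in lebesgue_on \<Omega>. x \<in> ball (c n) (r n) \<longrightarrow> h x = 0" for n
    using ball[of "r n" "c n"] r[of n] by (cases "r n = 0") auto
  then have "AE x in lebesgue_on \<Omega>. \<forall>n. x \<in> ball (c n) (r n) \<longrightarrow> h x = 0" by (subst AE_all_countable) blast
  moreover have "AE x in lebesgue_on \<Omega>. x \<in> \<Omega>" using AE_space[of "lebesgue_on \<Omega>"] by simp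
  ultimately show ?thesis by eventually_elim (use cover in blast)
qed

section \<open>The Sobolev embedding\<close>

text \<open>Jensen's inequality: integrate the tangent inequality at the mean value A, where the
  linear term has integral 0.\<close>

lemma (in finite_measure) powr_integral_le:
  assumes r: "1 \<le> r" and h: "integrable M h" "integrable M (\<lambda>x. h x powr r)" and nn: "AE x in M. 0 \<le> h x"
  shows "(\<integral>x. h x \<partial>M) powr r \<le> measure M (space M) powr (r - 1) * (\<integral>x. h x powr r \<partial>M)"
proof (cases "measure M (space M) = 0")
  case True
  then have "emeasure M (space M) = 0" by (simp add: emeasure_eq_measure)
  then have "AE x in M. h x = 0" by (intro AE_I[of _ _ "space M"]) auto
  then have "(\<integral>x. h x \<partial>M) = (\<integral>x. 0 \<partial>M)" using h by (intro integral_cong_AE) auto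
  then show ?thesis by simp
next
  case False
  define m where "m = measure M (space M)"
  have m: "m > 0" using False by (simp add: m_def zero_less_measure_iff)
  define A where "A = (\<integral>x. h x \<partial>M) / m"
  have h0: "(\<integral>x. h x \<partial>M) \<ge> 0" using nn by (rule integral_nonneg_AE)
  then have A: "A \<ge> 0" using m by (simp add: A_def)
  have "(\<integral>x. A powr r + r * A powr (r - 1) * (h x - A) \<partial>M) \<le> (\<integral>x. h x powr r \<partial>M)"
    using h r A by (intro integral_mono_AE, use nn in \<open>auto elim!: eventually_mono intro: powr_tangent\<close>)
  also have "(\<integral>x. A powr r + r * A powr (r - 1) * (h x - A) \<partial>M) =
      m * A powr r + r * A powr (r - 1) * ((\<integral>x. h x \<partial>M) - m * A)"
    using h by (simp add: m_def)
  also have "(\<integral>x. h x \<partial>M) - m * A = 0" using m by (simp add: A_def)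
  finally have *: "m * A powr r \<le> (\<integral>x. h x powr r \<partial>M)" by simp
  have "(\<integral>x. h x \<partial>M) powr r = m powr r * A powr r"
    using m h0 by (simp add: A_def powr_divide)
  also have "\<dots> = m powr (r - 1) * (m * A powr r)"
    using m powr_mult_base[of m "r - 1"] by (simp add: mult_ac)
  also have "\<dots> \<le> m powr (r - 1) * (\<integral>x. h x powr r \<partial>M)" using * by (rule mult_left_mono) simp
  finally show ?thesis by (simp add: m_def)
qed

text \<open>A density in place of a restricted space: the carrier stays the whole space and the
  sigma-algebra stays \<open>borel\<close>, so measurability and product arguments are independent
  of S.\<close>

definition restr :: "'a::euclidean_space set \<Rightarrow> 'a measure" where
  "restr S = density lborel (indicator S)"

abbreviation unit_cube :: "'a::euclidean_space set" where
  "unit_cube \<equiv> cbox 0 One"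

lemma sets_restr [measurable_cong, simp]: "sets (restr S) = sets borel"
  and space_restr [simp]: "space (restr S) = UNIV"
  by (simp_all add: restr_def)

lemma AE_restr: "S \<in> sets borel \<Longrightarrow> AE x in restr S. x \<in> S"
  unfolding restr_def by (subst AE_density) (auto simp: indicator_def)

lemma AE_restr_interval: "AE s in restr {0..\<eta>::real}. 0 < s \<and> s \<le> \<eta>"
proof -
  have "AE s in lborel. s \<noteq> (0::real)" by (rule AE_lborel_singleton)
  then show ?thesis unfolding restr_def
    by (subst AE_density) (auto elim!: eventually_mono split: split_indicator)
qed

lemma measure_restr: "S \<in> sets borel \<Longrightarrow> measure (restr S) UNIV = measure lborel S"
  by (simp add: restr_def measure_def emeasure_density)

lemma finite_measure_restr:
  assumes "compact S"
  shows "finite_measure (restr S)"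
proof
  have "S \<in> sets borel" using assms by (rule borel_compact)
  then have "emeasure (restr S) UNIV = emeasure lborel S"
    unfolding restr_def by (subst emeasure_density) auto
  then show "emeasure (restr S) (space (restr S)) \<noteq> \<infinity>"
    using emeasure_bounded_finite[OF compact_imp_bounded[OF assms]] by simp
qed

lemma integral_restr:
  fixes h :: "'a::euclidean_space \<Rightarrow> 'b::{banach, second_countable_topology}"
  assumes "S \<in> sets borel" "h \<in> borel_measurable borel"
  shows "(\<integral>x. h x \<partial>restr S) = (\<integral>x. indicator S x *\<^sub>R h x \<partial>lborel)"
proof -
  have "restr S = density lborel (\<lambda>x. ennreal (indicator S x))"
    by (simp add: restr_def ennreal_indicator)
  then show ?thesis using assms by (simp add: integral_density)
qed

lemma nn_integral_restr_le:
  assumes "S \<in> sets borel" "h \<in> borel_measurable borel"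
  shows "(\<integral>\<^sup>+x. h x \<partial>restr S) \<le> (\<integral>\<^sup>+x. h x \<partial>lborel)"
  unfolding restr_def using assms
  by (subst nn_integral_density) (auto intro!: nn_integral_mono split: split_indicator)

section \<open>Translations, dilations and averages over cubes\<close>

lemma nn_integral_translate:
  fixes g :: "'a::euclidean_space \<Rightarrow> ennreal"
  assumes [measurable]: "g \<in> borel_measurable borel"
  shows "(\<integral>\<^sup>+x. g (x + c) \<partial>lborel) = (\<integral>\<^sup>+x. g x \<partial>lborel)"
proof -
  have "(\<integral>\<^sup>+x. g x \<partial>lborel) = (\<integral>\<^sup>+x. g x \<partial>distr lborel borel ((+) c))"
    by (simp add: lborel_distr_plus)
  also have "\<dots> = (\<integral>\<^sup>+x. g (x + c) \<partial>lborel)"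
    by (subst nn_integral_distr) (auto simp: add.commute)
  finally show ?thesis ..
qed

lemma nn_integral_scale:
  fixes g :: "'a::euclidean_space \<Rightarrow> ennreal"
  assumes [measurable]: "g \<in> borel_measurable borel" and t: "0 < t"
  shows "(\<integral>\<^sup>+z. g (x + t *\<^sub>R z) \<partial>lborel) = ennreal (1 / t ^ DIM('a)) * (\<integral>\<^sup>+x. g x \<partial>lborel)"
proof -
  have "(\<integral>\<^sup>+x. g x \<partial>lborel) =
      (\<integral>\<^sup>+x. g x \<partial>density (distr lborel borel (\<lambda>z. x + t *\<^sub>R z)) (\<lambda>_. ennreal (\<bar>t\<bar> ^ DIM('a))))"
    using t by (subst lborel_affine[of t x]) auto
  also have "\<dots> = ennreal (t ^ DIM('a)) * (\<integral>\<^sup>+z. g (x + t *\<^sub>R z) \<partial>lborel)"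
    using t by (simp add: nn_integral_density nn_integral_distr nn_integral_cmult)
  finally have "ennreal (1 / t ^ DIM('a)) * (\<integral>\<^sup>+x. g x \<partial>lborel) =
      ennreal (1 / t ^ DIM('a) * t ^ DIM('a)) * (\<integral>\<^sup>+z. g (x + t *\<^sub>R z) \<partial>lborel)"
    using t by (simp add: ennreal_mult mult.assoc del: times_divide_eq_left)
  then show ?thesis using t by simp
qed

text \<open>For t > 0 this is the mean of f over the cube of side t whose lower corner is x. The
  unit cube has measure 1, so there is no normalizing factor.\<close>

definition cube_avg :: "real \<Rightarrow> ('a::euclidean_space \<Rightarrow> real) \<Rightarrow> 'a \<Rightarrow> real" where
  "cube_avg t f x = (\<integral>z. f (x + t *\<^sub>R z) \<partial>restr unit_cube)"

interpretation cube: finite_measure "restr (unit_cube :: 'a::euclidean_space set)"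
  by (rule finite_measure_restr) (rule compact_cbox)

lemma measure_unit_cube [simp]: "measure (restr (unit_cube :: 'a::euclidean_space set)) UNIV = 1"
  by (subst measure_restr) (auto simp: measure_lborel_cbox_eq)

lemma cube_integrable:
  fixes f :: "'a::euclidean_space \<Rightarrow> real"
  assumes [measurable]: "f \<in> borel_measurable borel" and "\<And>x. \<bar>f x\<bar> \<le> B"
  shows "integrable (restr unit_cube) (\<lambda>z. f (x + t *\<^sub>R z))"
  using assms by (intro cube.integrable_const_bound[where B = B]) auto

lemma cube_avg_measurable [measurable]:
  fixes f :: "'a::euclidean_space \<Rightarrow> real"
  assumes [measurable]: "f \<in> borel_measurable borel" "t \<in> borel_measurable N" "x \<in> N \<rightarrow>\<^sub>M borel"
  shows "(\<lambda>y. cube_avg (t y) f (x y)) \<in> borel_measurable N"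
  unfolding cube_avg_def by measurable

text \<open>Jensen gives the second claim; enlarging the cube to the whole space and rescaling gives
  the pointwise bound. The last claim interpolates: avg^r is avg^(r - p), estimated pointwise, times
  avg^p, whose integral is at most I by Fubini and translation invariance.\<close>

lemma cube_avg_bounds:
  fixes g :: "'a::euclidean_space \<Rightarrow> real"
  assumes g [measurable]: "g \<in> borel_measurable borel" and B: "\<And>x. 0 \<le> g x" "\<And>x. g x \<le> B"
    and p: "1 \<le> p" and int: "integrable lborel (\<lambda>x. g x powr p)" and t: "0 < t"
  defines "I \<equiv> \<integral>x. g x powr p \<partial>lborel"
  shows cube_avg_nonneg: "0 \<le> cube_avg t g x"
    and cube_avg_powr_le: "cube_avg t g x powr p \<le> cube_avg t (\<lambda>x. g x powr p) x"
    and cube_avg_powr_bound: "cube_avg t g x powr p \<le> I / t ^ DIM('a)"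
    and nn_integral_cube_avg_powr: "p \<le> r \<Longrightarrow> (\<integral>\<^sup>+x. cube_avg t g x powr r \<partial>lborel) \<le>
      ennreal ((I / t ^ DIM('a)) powr ((r - p) / p) * I)"
proof -
  have B': "\<bar>g x\<bar> \<le> B" "\<bar>g x powr p\<bar> \<le> B powr p" for x
    using B(1)[of x] B(2)[of x] p by (auto intro!: powr_mono2)
  have I: "I \<ge> 0" by (simp add: I_def)
  have nnI: "(\<integral>\<^sup>+x. ennreal (g x powr p) \<partial>lborel) = ennreal I"
    unfolding I_def by (rule nn_integral_eq_integral[OF int]) auto
  have gp: "(\<lambda>x. g x powr p) \<in> borel_measurable borel" by measurable
  have int1: "integrable (restr unit_cube) (\<lambda>z. g (x + t *\<^sub>R z))" for x
    by (rule cube_integrable[OF g B'(1)])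
  have int2: "integrable (restr unit_cube) (\<lambda>z. g (x + t *\<^sub>R z) powr p)" for x
    using cube_integrable[OF gp B'(2)] .
  show nonneg: "0 \<le> cube_avg t g x" for x
    unfolding cube_avg_def using B by (intro integral_nonneg_AE) auto
  show le: "cube_avg t g x powr p \<le> cube_avg t (\<lambda>x. g x powr p) x" for x
    using cube.powr_integral_le[OF p int1[of x] int2[of x]] B(1) by (simp add: cube_avg_def)
  have avg_eq: "ennreal (cube_avg t (\<lambda>x. g x powr p) x) = (\<integral>\<^sup>+z. g (x + t *\<^sub>R z) powr p \<partial>restr unit_cube)" for x
    unfolding cube_avg_def by (rule nn_integral_eq_integral[symmetric, OF int2]) auto
  show bound: "cube_avg t g x powr p \<le> I / t ^ DIM('a)" for x
  proof -
    have "ennreal (cube_avg t g x powr p) \<le> (\<integral>\<^sup>+z. g (x + t *\<^sub>R z) powr p \<partial>restr unit_cube)"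
      unfolding avg_eq[symmetric] using le[of x] by (rule ennreal_leI)
    also have "\<dots> \<le> (\<integral>\<^sup>+z. g (x + t *\<^sub>R z) powr p \<partial>lborel)" by (rule nn_integral_restr_le) auto
    also have "\<dots> = ennreal (1 / t ^ DIM('a)) * ennreal I"
      using nn_integral_scale[of "\<lambda>x. ennreal (g x powr p)" t x] t by (simp add: nnI)
    also have "\<dots> = ennreal (I / t ^ DIM('a))" using t I by (simp flip: ennreal_mult)
    finally show ?thesis using I t by (subst (asm) ennreal_le_iff) auto
  qed
  assume pr: "p \<le> r"
  define c where "c = (I / t ^ DIM('a)) powr ((r - p) / p)"
  have c: "c \<ge> 0" by (simp add: c_def)
  have r_le: "cube_avg t g x powr r \<le> c * cube_avg t (\<lambda>x. g x powr p) x" for x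
  proof -
    have "cube_avg t g x powr r = (cube_avg t g x powr p) powr ((r - p) / p) * cube_avg t g x powr p"
      using p by (simp add: powr_powr flip: powr_add)
    also have "\<dots> \<le> c * cube_avg t (\<lambda>x. g x powr p) x"
      unfolding c_def using pr p bound[of x] le[of x] by (intro mult_mono powr_mono2) auto
    finally show ?thesis .
  qed
  interpret P: pair_sigma_finite "restr unit_cube" "lborel :: 'a measure" ..
  have "(\<integral>\<^sup>+x. cube_avg t g x powr r \<partial>lborel) \<le>
      (\<integral>\<^sup>+x. ennreal c * (\<integral>\<^sup>+z. g (x + t *\<^sub>R z) powr p \<partial>restr unit_cube) \<partial>lborel)"
    unfolding avg_eq[symmetric] using r_le c
    by (intro nn_integral_mono) (auto simp: ennreal_mult'[symmetric] intro!: ennreal_leI)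
  also have "\<dots> = ennreal c * (\<integral>\<^sup>+x. (\<integral>\<^sup>+z. g (x + t *\<^sub>R z) powr p \<partial>restr unit_cube) \<partial>lborel)"
    by (rule nn_integral_cmult) measurable
  also have "(\<integral>\<^sup>+x. (\<integral>\<^sup>+z. g (x + t *\<^sub>R z) powr p \<partial>restr unit_cube) \<partial>lborel) =
      (\<integral>\<^sup>+z. (\<integral>\<^sup>+x. g (x + t *\<^sub>R z) powr p \<partial>lborel) \<partial>restr unit_cube)"
    by (rule P.Fubini') measurable
  also have "\<dots> = (\<integral>\<^sup>+z. ennreal I \<partial>restr (unit_cube :: 'a set))"
  proof (rule nn_integral_cong)
    fix z :: 'a
    have "(\<integral>\<^sup>+x. g (x + t *\<^sub>R z) powr p \<partial>lborel) = (\<integral>\<^sup>+x. ennreal (g x powr p) \<partial>lborel)"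
      using nn_integral_translate[of "\<lambda>x. ennreal (g x powr p)" "t *\<^sub>R z"] by simp
    then show "(\<integral>\<^sup>+x. g (x + t *\<^sub>R z) powr p \<partial>lborel) = ennreal I" by (simp add: nnI)
  qed
  also have "\<dots> = ennreal I" by (simp add: cube.emeasure_eq_measure)
  also have "ennreal c * ennreal I = ennreal (c * I)" using c I by (simp add: ennreal_mult)
  finally show "(\<integral>\<^sup>+x. cube_avg t g x powr r \<partial>lborel) \<le> ennreal ((I / t ^ DIM('a)) powr ((r - p) / p) * I)"
    by (simp add: c_def)
qed

text \<open>The fundamental theorem of calculus along s \<mapsto> x + s^m w, whose velocity has norm
  at most m s^(m - 1) R. The exponent m = 1 gives the segment.\<close>

lemma path_difference_bound:
  fixes f :: "'a::euclidean_space \<Rightarrow> real" and G :: "'a \<Rightarrow> 'a"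
  assumes D: "\<And>x. GDERIV f x :> G x" and G: "continuous_on UNIV G"
    and \<eta>: "0 \<le> \<eta>" and m: "0 < m" and w: "norm w \<le> R"
  shows "ennreal \<bar>f (x + \<eta> ^ m *\<^sub>R w) - f x\<bar> \<le>
    (\<integral>\<^sup>+s. (real m * s ^ (m - 1) * R) * norm (G (x + s ^ m *\<^sub>R w)) \<partial>restr {0..\<eta>})"
proof -
  define F where "F = (\<lambda>s. f (x + s ^ m *\<^sub>R w))"
  define F' where "F' = (\<lambda>s. ((real m * s ^ (m - 1)) *\<^sub>R w) \<bullet> G (x + s ^ m *\<^sub>R w))"
  have DF: "(F has_real_derivative F' s) (at s)" for s
  proof -
    have "((\<lambda>s. x + s ^ m *\<^sub>R w) has_derivative (\<lambda>h. (h * (real m * s ^ (m - 1))) *\<^sub>R w)) (at s)"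
      by (auto intro!: derivative_eq_intros simp: mult_ac)
    moreover have "(f has_derivative (\<lambda>h. h \<bullet> G (x + s ^ m *\<^sub>R w))) (at (x + s ^ m *\<^sub>R w))"
      using D by (simp add: gderiv_def)
    ultimately have "(F has_derivative (\<lambda>h. ((h * (real m * s ^ (m - 1))) *\<^sub>R w) \<bullet> G (x + s ^ m *\<^sub>R w))) (at s)"
      unfolding F_def by (rule has_derivative_compose)
    then show ?thesis
      by (rule has_derivative_imp_has_field_derivative) (simp add: F'_def mult_ac)
  qed
  have G': "continuous_on UNIV (\<lambda>s. G (x + s ^ m *\<^sub>R w))"
    by (rule continuous_on_compose2[OF G]) (auto intro!: continuous_intros)
  then have cF': "continuous_on UNIV F'" unfolding F'_def by (intro continuous_intros)
  have F'm [measurable]: "F' \<in> borel_measurable borel" using cF' by (rule borel_measurable_continuous_onI)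
  have "(\<lambda>s. G (x + s ^ m *\<^sub>R w)) \<in> borel_measurable borel" using G' by (rule borel_measurable_continuous_onI)
  then have Gm: "(\<lambda>s. norm (G (x + s ^ m *\<^sub>R w))) \<in> borel_measurable borel" by measurable
  have "(\<integral>s. F' s * indicator {0..\<eta>} s \<partial>lborel) = F \<eta> - F 0"
    using \<eta> DF cF' by (intro integral_FTC_Icc_real) (auto simp: continuous_on_eq_continuous_at)
  then have "f (x + \<eta> ^ m *\<^sub>R w) - f x = (\<integral>s. F' s \<partial>restr {0..\<eta>})"
    using m by (simp add: F_def integral_restr mult.commute zero_power)
  then have "ennreal \<bar>f (x + \<eta> ^ m *\<^sub>R w) - f x\<bar> \<le> (\<integral>\<^sup>+s. norm (F' s) \<partial>restr {0..\<eta>})"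
  \<comment> \<open>If F' were not integrable, its Bochner integral would be 0 by convention and the
    bound trivial.\<close>
  proof (simp only:, cases "integrable (restr {0..\<eta>}) F'")
    case True
    then show "ennreal \<bar>\<integral>s. F' s \<partial>restr {0..\<eta>}\<bar> \<le> (\<integral>\<^sup>+s. norm (F' s) \<partial>restr {0..\<eta>})"
      using integral_norm_bound_ennreal[OF True] by simp
  qed (simp add: not_integrable_integral_eq)
  also have "\<dots> \<le> (\<integral>\<^sup>+s. (real m * s ^ (m - 1) * R) * norm (G (x + s ^ m *\<^sub>R w)) \<partial>restr {0..\<eta>})"
  proof (rule nn_integral_mono_AE, use AE_restr_interval[of \<eta>] in eventually_elim)
    case (elim s)
    have "norm (F' s) \<le> norm ((real m * s ^ (m - 1)) *\<^sub>R w) * norm (G (x + s ^ m *\<^sub>R w))"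
      unfolding F'_def real_norm_def by (rule Cauchy_Schwarz_ineq2)
    also have "\<dots> \<le> (real m * s ^ (m - 1) * R) * norm (G (x + s ^ m *\<^sub>R w))"
      using w elim by (intro mult_right_mono) (auto simp: abs_mult intro!: mult_left_mono)
    finally show ?case by (rule ennreal_leI)
  qed
  finally show ?thesis .
qed

lemma norm_unit_cube: "z \<in> unit_cube \<Longrightarrow> norm (z :: 'a::euclidean_space) \<le> real DIM('a)"
proof -
  assume z: "z \<in> unit_cube"
  have "norm z \<le> (\<Sum>b\<in>Basis. \<bar>z \<bullet> b\<bar>)" by (rule norm_le_l1)
  also have "\<dots> \<le> (\<Sum>b\<in>(Basis :: 'a set). 1)"
    using z by (intro sum_mono) (auto simp: mem_box)
  finally show ?thesis by simp
qed


lemma cube_avg_abs_le: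
  fixes f :: "'a::euclidean_space \<Rightarrow> real"
  assumes [measurable]: "f \<in> borel_measurable borel" and B: "\<And>x. \<bar>f x\<bar> \<le> B"
  shows "\<bar>cube_avg t f x\<bar> \<le> cube_avg t (\<lambda>x. \<bar>f x\<bar>) x" "cube_avg t (\<lambda>x. \<bar>f x\<bar>) x \<le> B"
proof -
  show "\<bar>cube_avg t f x\<bar> \<le> cube_avg t (\<lambda>x. \<bar>f x\<bar>) x"
    unfolding cube_avg_def by (rule integral_abs_bound)
  have "cube_avg t (\<lambda>x. \<bar>f x\<bar>) x \<le> (\<integral>z. B \<partial>restr (unit_cube :: 'a set))"
    unfolding cube_avg_def using B order_trans[OF abs_ge_zero B[of undefined]]
    by (intro integral_mono cube_integrable[where B = B]) auto
  then show "cube_avg t (\<lambda>x. \<bar>f x\<bar>) x \<le> B" by simp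
qed

lemma cube_avg_diff:
  fixes f g :: "'a::euclidean_space \<Rightarrow> real"
  assumes "f \<in> borel_measurable borel" "\<And>x. \<bar>f x\<bar> \<le> B" "g \<in> borel_measurable borel" "\<And>x. \<bar>g x\<bar> \<le> B'"
  shows "cube_avg t (\<lambda>x. f x - g x) x = cube_avg t f x - cube_avg t g x"
  unfolding cube_avg_def using cube_integrable[OF assms(1,2)] cube_integrable[OF assms(3,4)]
  by (intro Bochner_Integration.integral_diff)

lemma test_function_bounded:
  fixes f :: "'a::euclidean_space \<Rightarrow> real"
  assumes "f \<in> test_functions \<Omega>"
  obtains B where "\<And>x. \<bar>f x\<bar> \<le> B" "\<And>x. norm (gradient f x) \<le> B"
proof -
  obtain K where K: "compact K" "\<And>x. x \<notin> K \<Longrightarrow> f x = 0" using assms by (rule test_functionE) blast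
  have G0: "gradient f x = 0" if "x \<notin> K" for x using test_function_gradient_eq_0[OF assms K that] .
  have "compact (f ` K)" "compact (gradient f ` K)"
    using test_function_continuous[OF assms] test_function_GDERIV(2)[OF assms] K(1)
    by (auto intro!: compact_continuous_image intro: continuous_on_subset)
  then obtain B1 B2 where "\<forall>x\<in>K. \<bar>f x\<bar> \<le> B1" "\<forall>x\<in>K. norm (gradient f x) \<le> B2"
    by (auto dest!: compact_imp_bounded simp: bounded_iff)
  then have "\<bar>f x\<bar> \<le> max 0 (max B1 B2)" "norm (gradient f x) \<le> max 0 (max B1 B2)" for x
    using K(2)[of x] G0[of x] by (cases "x \<in> K"; fastforce)+
  then show thesis by (rule that)
qed

lemma test_function_integrable_powr:
  fixes f :: "'a::euclidean_space \<Rightarrow> real"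
  assumes f: "f \<in> test_functions \<Omega>" and p: "0 < p"
  shows "integrable lborel (\<lambda>x. \<bar>f x\<bar> powr p)" "integrable lborel (\<lambda>x. norm (gradient f x) powr p)"
proof -
  obtain K where K: "compact K" "\<And>x. x \<notin> K \<Longrightarrow> f x = 0" using f by (rule test_functionE) blast
  have G0: "gradient f x = 0" if "x \<notin> K" for x using test_function_gradient_eq_0[OF f K that] .
  have "continuous_on UNIV (\<lambda>x. \<bar>f x\<bar> powr p)"
    using continuous_on_norm_powr[OF p test_function_continuous[OF f]] by simp
  then show "integrable lborel (\<lambda>x. \<bar>f x\<bar> powr p)"
    by (rule integrable_continuous_compact_support[OF _ K(1)]) (use K in auto)
  have "continuous_on UNIV (\<lambda>x. norm (gradient f x) powr p)"
    by (rule continuous_on_norm_powr[OF p test_function_GDERIV(2)[OF f]])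
  then show "integrable lborel (\<lambda>x. norm (gradient f x) powr p)"
    by (rule integrable_continuous_compact_support[OF _ K(1)]) (use G0 in auto)
qed

text \<open>The curve \<open>s \<mapsto> x + s\<^sup>m z\<close> is used instead of a segment: for large \<open>m\<close> the speed
  \<open>m s\<^bsup>m-1\<^esup>\<close> absorbs the factor by which averaging over a cube of side \<open>s\<^sup>m\<close> improves
  the exponent from \<open>p\<close> to \<open>r\<close>. This is possible exactly below the critical exponent.\<close>

lemma cube_avg_error:
  fixes f :: "'a::euclidean_space \<Rightarrow> real"
  assumes f: "f \<in> test_functions \<Omega>" and p: "1 \<le> p" "p \<le> r" and \<eta>: "0 < \<eta>" "\<eta> \<le> 1"
    and m: "0 < m" "real m * (real DIM('a) * ((r - p) / p)) \<le> real (m - 1) * r"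
  defines "I \<equiv> \<integral>x. norm (gradient f x) powr p \<partial>lborel"
  shows "(\<integral>\<^sup>+x. \<bar>f x - cube_avg (\<eta> ^ m) f x\<bar> powr r \<partial>lborel) \<le>
    ennreal ((\<eta> * (real m * real DIM('a))) powr r * I powr (r / p))"
proof -
  define g where "g = (\<lambda>x. norm (gradient f x))"
  define D where "D = real DIM('a)"
  define K where "K = real m * D"
  define k where "k = (\<lambda>s. real m * s ^ (m - 1) * D)"
  define e where "e = (r - p) / p"
  have e: "e \<ge> 0" using p by (simp add: e_def)
  have D: "D > 0" by (simp add: D_def)
  have K: "K \<ge> 0" using D by (simp add: K_def)
  have k_eq: "k s = K * s ^ (m - 1)" for s by (simp add: k_def K_def mult_ac)
  have k: "0 \<le> k s" "k s \<le> K" if "0 < s" "s \<le> \<eta>" for s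
    using that K \<eta> mult_left_mono[of "s ^ (m - 1)" 1 K] by (auto simp: k_eq power_le_one)
  have I: "I \<ge> 0" by (simp add: I_def)
  obtain B where B: "\<And>x. \<bar>f x\<bar> \<le> B" "\<And>x. norm (gradient f x) \<le> B"
    using f by (rule test_function_bounded) blast
  have B0: "B \<ge> 0" using B(1)[of undefined] by linarith
  have fm [measurable]: "f \<in> borel_measurable borel"
    by (intro borel_measurable_continuous_onI test_function_continuous[OF f])
  have "gradient f \<in> borel_measurable borel"
    by (intro borel_measurable_continuous_onI test_function_GDERIV(2)[OF f])
  then have gm [measurable]: "g \<in> borel_measurable borel" unfolding g_def by measurable
  have km [measurable]: "k \<in> borel_measurable borel" unfolding k_def by measurable
  have gB: "\<And>x. 0 \<le> g x" "\<And>x. g x \<le> B" "\<And>x. \<bar>g x\<bar> \<le> B" using B by (auto simp: g_def)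
  have gi: "integrable lborel (\<lambda>x. g x powr p)"
    unfolding g_def using test_function_integrable_powr(2)[OF f] p by auto
  note avg = cube_avg_bounds[OF gm gB(1,2) p(1) gi]
  have I': "I = (\<integral>x. g x powr p \<partial>lborel)" by (simp add: I_def g_def)
  have avgB: "cube_avg t g x \<le> B" for t x
    using cube_avg_abs_le[OF gm gB(3), of t x] by linarith
  interpret V: finite_measure "restr {0..\<eta>}" by (rule finite_measure_restr) simp
  have Vm: "measure (restr {0..\<eta>}) UNIV = \<eta>" using \<eta> by (simp add: measure_restr)
  define h where "h = (\<lambda>x s. k s * cube_avg (s ^ m) g x)"
  have hm [measurable]: "h x \<in> borel_measurable borel" for x unfolding h_def by measurable
  have h: "0 \<le> h x s" "h x s \<le> K * B" if "0 < s" "s \<le> \<eta>" for x s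
    using that k[OF that] avg(1)[of "s ^ m" x] avgB[of "s ^ m" x] K
    by (auto simp: h_def intro!: mult_mono)
  have hP: "AE s in restr {0..\<eta>}. 0 \<le> h x s" for x
    using AE_restr_interval[of \<eta>] by eventually_elim (use h in auto)
  have hB: "AE s in restr {0..\<eta>}. norm (h x s) \<le> K * B" for x
    using AE_restr_interval[of \<eta>] by eventually_elim (use h in auto)
  have hR: "AE s in restr {0..\<eta>}. norm (h x s powr r) \<le> (K * B) powr r" for x
    using AE_restr_interval[of \<eta>] by eventually_elim (use h p in \<open>auto intro!: powr_mono2\<close>)
  have h1: "integrable (restr {0..\<eta>}) (h x)" for x
    by (rule V.integrable_const_bound[OF hB]) simp
  have h2: "integrable (restr {0..\<eta>}) (\<lambda>s. h x s powr r)" for x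
    by (rule V.integrable_const_bound[OF hR]) simp
  have h0: "(\<integral>s. h x s \<partial>restr {0..\<eta>}) \<ge> 0" for x
    using hP by (rule integral_nonneg_AE)
  interpret UV: pair_sigma_finite "restr (unit_cube :: 'a set)" "restr {0..\<eta>}" ..
  \<comment> \<open>The path bound is averaged over the end direction z in the unit cube. After
    Fubini the inner integral at time s is the average of |grad f| over a cube of side s^m.\<close>
  have 1: "\<bar>f x - cube_avg (\<eta> ^ m) f x\<bar> \<le> (\<integral>s. h x s \<partial>restr {0..\<eta>})" for x
  proof -
    have fi: "integrable (restr unit_cube) (\<lambda>z. f (x + \<eta> ^ m *\<^sub>R z) - f x)"
      by (intro Bochner_Integration.integrable_diff cube_integrable[OF fm B(1)]) simp
    have "f x - cube_avg (\<eta> ^ m) f x = - (\<integral>z. f (x + \<eta> ^ m *\<^sub>R z) - f x \<partial>restr unit_cube)"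
      using cube_integrable[OF fm B(1), of x "\<eta> ^ m"] by (simp add: cube_avg_def)
    then have "ennreal \<bar>f x - cube_avg (\<eta> ^ m) f x\<bar> \<le>
        (\<integral>\<^sup>+z. \<bar>f (x + \<eta> ^ m *\<^sub>R z) - f x\<bar> \<partial>restr unit_cube)"
      using integral_norm_bound_ennreal[OF fi] by simp
    also have "\<dots> \<le> (\<integral>\<^sup>+z. (\<integral>\<^sup>+s. k s * g (x + s ^ m *\<^sub>R z) \<partial>restr {0..\<eta>}) \<partial>restr unit_cube)"
    proof (rule nn_integral_mono_AE)
      have "AE z in restr (unit_cube :: 'a set). z \<in> unit_cube" by (rule AE_restr) simp
      then show "AE z in restr (unit_cube :: 'a set). ennreal \<bar>f (x + \<eta> ^ m *\<^sub>R z) - f x\<bar> \<le>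
          (\<integral>\<^sup>+s. k s * g (x + s ^ m *\<^sub>R z) \<partial>restr {0..\<eta>})"
      proof eventually_elim
        case (elim z)
        show ?case unfolding k_def g_def D_def
          by (rule path_difference_bound[OF test_function_GDERIV[OF f] less_imp_le[OF \<eta>(1)] m(1)
                norm_unit_cube[OF elim]])
      qed
    qed
    also have "\<dots> = (\<integral>\<^sup>+s. (\<integral>\<^sup>+z. k s * g (x + s ^ m *\<^sub>R z) \<partial>restr unit_cube) \<partial>restr {0..\<eta>})"
      by (rule UV.Fubini'[symmetric]) measurable
    also have "\<dots> = (\<integral>\<^sup>+s. h x s \<partial>restr {0..\<eta>})"
    proof (rule nn_integral_cong_AE, use AE_restr_interval[of \<eta>] in eventually_elim)
      case (elim s)
      have "(\<integral>\<^sup>+z. k s * g (x + s ^ m *\<^sub>R z) \<partial>restr unit_cube) =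
          ennreal (\<integral>z. k s * g (x + s ^ m *\<^sub>R z) \<partial>restr unit_cube)"
        using elim k(1)[of s] gB
        by (intro nn_integral_eq_integral integrable_mult_right cube_integrable[OF gm gB(3)]) auto
      then show ?case by (simp add: h_def cube_avg_def)
    qed
    also have "\<dots> = ennreal (\<integral>s. h x s \<partial>restr {0..\<eta>})"
      by (rule nn_integral_eq_integral[OF h1 hP])
    finally show ?thesis using h0[of x] by (simp add: ennreal_le_iff)
  qed
  \<comment> \<open>Jensen on the interval [0, \<eta>] of length \<eta> produces the factor
    \<eta>^(r - 1); the missing power of \<eta> comes from the final integration over s.\<close>
  have 2: "ennreal (\<bar>f x - cube_avg (\<eta> ^ m) f x\<bar> powr r) \<le>
      ennreal (\<eta> powr (r - 1)) * (\<integral>\<^sup>+s. h x s powr r \<partial>restr {0..\<eta>})" for x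
  proof -
    have "\<bar>f x - cube_avg (\<eta> ^ m) f x\<bar> powr r \<le> (\<integral>s. h x s \<partial>restr {0..\<eta>}) powr r"
      using 1[of x] p by (intro powr_mono2) auto
    also have "\<dots> \<le> \<eta> powr (r - 1) * (\<integral>s. h x s powr r \<partial>restr {0..\<eta>})"
      using V.powr_integral_le[OF _ h1[of x] h2[of x] hP] p by (simp add: Vm)
    finally show ?thesis
      using nn_integral_eq_integral[OF h2[of x]] by (simp add: ennreal_mult'[symmetric] ennreal_leI)
  qed
  interpret LV: pair_sigma_finite "lborel :: 'a measure" "restr {0..\<eta>}" ..
  have "(\<integral>\<^sup>+x. \<bar>f x - cube_avg (\<eta> ^ m) f x\<bar> powr r \<partial>lborel) \<le>
      (\<integral>\<^sup>+x. ennreal (\<eta> powr (r - 1)) * (\<integral>\<^sup>+s. h x s powr r \<partial>restr {0..\<eta>}) \<partial>lborel)"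
    by (intro nn_integral_mono 2)
  also have "\<dots> = ennreal (\<eta> powr (r - 1)) * (\<integral>\<^sup>+x. (\<integral>\<^sup>+s. h x s powr r \<partial>restr {0..\<eta>}) \<partial>lborel)"
    unfolding h_def by (rule nn_integral_cmult) measurable
  also have "(\<integral>\<^sup>+x. (\<integral>\<^sup>+s. h x s powr r \<partial>restr {0..\<eta>}) \<partial>lborel) =
      (\<integral>\<^sup>+s. (\<integral>\<^sup>+x. h x s powr r \<partial>lborel) \<partial>restr {0..\<eta>})"
    unfolding h_def by (rule LV.Fubini'[symmetric]) measurable
  also have "\<dots> \<le> (\<integral>\<^sup>+s. ennreal (K powr r * I powr (r / p)) \<partial>restr {0..\<eta>})"
  proof (rule nn_integral_mono_AE, use AE_restr_interval[of \<eta>] in eventually_elim)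
    case (elim s)
    have s: "0 < s" "s \<le> 1" using elim \<eta> by auto
    have sm: "s ^ m > 0" using s by simp
    have "(\<integral>\<^sup>+x. h x s powr r \<partial>lborel) =
        (\<integral>\<^sup>+x. ennreal (k s powr r) * ennreal (cube_avg (s ^ m) g x powr r) \<partial>lborel)"
      using k(1)[of s] elim avg(1)[OF sm] by (intro nn_integral_cong) (auto simp: h_def powr_mult ennreal_mult)
    also have "\<dots> = ennreal (k s powr r) * (\<integral>\<^sup>+x. cube_avg (s ^ m) g x powr r \<partial>lborel)"
      by (rule nn_integral_cmult) measurable
    also have "\<dots> \<le> ennreal (k s powr r) * ennreal ((I / (s ^ m) ^ DIM('a)) powr e * I)"
      using avg(4)[OF sm p(2)] by (intro mult_left_mono) (auto simp: I' e_def)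
    also have "\<dots> = ennreal (k s powr r * ((I / (s ^ m) ^ DIM('a)) powr e * I))"
      using I by (simp add: ennreal_mult)
    also have "\<dots> \<le> ennreal (K powr r * I powr (r / p))"
    proof (rule ennreal_leI)
      have sDe: "((s ^ m) ^ DIM('a)) powr e = s powr (real m * (D * e))"
        using s by (simp add: D_def powr_powr powr_power mult.assoc flip: powr_realpow power_mult)
      have smr: "(s ^ (m - 1)) powr r = s powr (real (m - 1) * r)"
        using s by (simp add: powr_powr flip: powr_realpow)
      \<comment> \<open>The speed of the curve contributes s^((m - 1) r), while the averages cost
        s^(-m DIM e). The assumption on m compares the two exponents, and s <= 1 makes the quotient
        at most 1.\<close>
      have "s powr (real (m - 1) * r) \<le> s powr (real m * (D * e))"
        using s m(2) by (intro powr_mono') (auto simp: D_def e_def)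
      then have ratio: "(s ^ (m - 1)) powr r / ((s ^ m) ^ DIM('a)) powr e \<le> 1"
        unfolding sDe smr using s by simp
      have Ie: "I powr e * I = I powr (r / p)"
      proof (cases "I = 0")
        case False
        have "e + 1 = r / p" using p by (simp add: e_def field_simps)
        moreover have "I powr e * I = I powr (e + 1)" using False I by (simp add: powr_add)
        ultimately show ?thesis by simp
      qed simp
      have "k s powr r * ((I / (s ^ m) ^ DIM('a)) powr e * I) =
          K powr r * I powr (r / p) * ((s ^ (m - 1)) powr r / ((s ^ m) ^ DIM('a)) powr e)"
        using k_eq[of s] elim s K I by (simp add: powr_mult powr_divide flip: Ie)
      also have "\<dots> \<le> K powr r * I powr (r / p) * 1"
        by (intro mult_left_mono ratio) auto
      finally show "k s powr r * ((I / (s ^ m) ^ DIM('a)) powr e * I) \<le> K powr r * I powr (r / p)"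
        by simp
    qed
    finally show ?case .
  qed
  also have "\<dots> = ennreal (K powr r * I powr (r / p) * \<eta>)"
    using \<eta> by (simp add: V.emeasure_eq_measure Vm ennreal_mult)
  also have "ennreal (\<eta> powr (r - 1)) * ennreal (K powr r * I powr (r / p) * \<eta>) =
      ennreal (\<eta> powr (r - 1) * (K powr r * I powr (r / p) * \<eta>))"
    using \<eta> by (simp add: ennreal_mult)
  also have "\<eta> powr (r - 1) * (K powr r * I powr (r / p) * \<eta>) = (\<eta> * K) powr r * I powr (r / p)"
    using \<eta> K powr_mult_base[of \<eta> "r - 1"] by (simp add: powr_mult mult_ac)
  finally show ?thesis by (simp add: K_def D_def mult_left_mono)
qed

text \<open>For fixed t the bounds depend only on the L^p sizes of f and its gradient, which gives
  the equiboundedness and equicontinuity required by Arzela-Ascoli. The Lipschitz bound integrates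
  the gradient along the segment from y to x and averages over the cube at each of its
  points.\<close>

lemma cube_avg_test_function:
  fixes f :: "'a::euclidean_space \<Rightarrow> real"
  assumes f: "f \<in> test_functions \<Omega>" and p: "1 \<le> p" and t: "0 < t"
  shows cube_avg_test_bound: "\<bar>cube_avg t f x\<bar> \<le> ((\<integral>x. \<bar>f x\<bar> powr p \<partial>lborel) / t ^ DIM('a)) powr (1 / p)"
    and cube_avg_test_Lipschitz: "\<bar>cube_avg t f x - cube_avg t f y\<bar> \<le>
      norm (x - y) * ((\<integral>x. norm (gradient f x) powr p \<partial>lborel) / t ^ DIM('a)) powr (1 / p)"
    and nn_integral_cube_avg_test: "p \<le> r \<Longrightarrow> (\<integral>\<^sup>+x. \<bar>cube_avg t f x\<bar> powr r \<partial>lborel) \<le>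
      ennreal (((\<integral>x. \<bar>f x\<bar> powr p \<partial>lborel) / t ^ DIM('a)) powr ((r - p) / p) * (\<integral>x. \<bar>f x\<bar> powr p \<partial>lborel))"
proof -
  obtain B where B: "\<And>x. \<bar>f x\<bar> \<le> B" "\<And>x. norm (gradient f x) \<le> B"
    using f by (rule test_function_bounded) blast
  have fm [measurable]: "f \<in> borel_measurable borel"
    by (intro borel_measurable_continuous_onI test_function_continuous[OF f])
  define g where "g = (\<lambda>x. norm (gradient f x))"
  have "gradient f \<in> borel_measurable borel"
    by (intro borel_measurable_continuous_onI test_function_GDERIV(2)[OF f])
  then have gm [measurable]: "g \<in> borel_measurable borel" unfolding g_def by measurable
  have gB: "\<And>x. 0 \<le> g x" "\<And>x. g x \<le> B" "\<And>x. \<bar>g x\<bar> \<le> B" using B by (auto simp: g_def)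
  have am: "(\<lambda>x. \<bar>f x\<bar>) \<in> borel_measurable borel" by measurable
  have p0: "p > 0" using p by simp
  have root: "s \<le> c powr (1 / p)" if "s powr p \<le> c" "0 \<le> s" for s c :: real
  proof -
    have "(s powr p) powr (1 / p) \<le> c powr (1 / p)" using that p by (intro powr_mono2) auto
    then show ?thesis using that p by (simp add: powr_powr)
  qed
  note avf = cube_avg_bounds[OF am abs_ge_zero B(1) p test_function_integrable_powr(1)[OF f p0] t]
  have gi: "integrable lborel (\<lambda>x. g x powr p)"
    unfolding g_def by (rule test_function_integrable_powr(2)[OF f p0])
  note avg = cube_avg_bounds[OF gm gB(1,2) p gi t]
  have le: "\<bar>cube_avg t f x\<bar> \<le> cube_avg t (\<lambda>x. \<bar>f x\<bar>) x" for x
    by (rule cube_avg_abs_le[OF fm B(1)])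
  show "\<bar>cube_avg t f x\<bar> \<le> ((\<integral>x. \<bar>f x\<bar> powr p \<partial>lborel) / t ^ DIM('a)) powr (1 / p)"
    using le[of x] root[OF avf(3)[of x] avf(1)] by (rule order_trans)
  show "(\<integral>\<^sup>+x. \<bar>cube_avg t f x\<bar> powr r \<partial>lborel) \<le>
      ennreal (((\<integral>x. \<bar>f x\<bar> powr p \<partial>lborel) / t ^ DIM('a)) powr ((r - p) / p) * (\<integral>x. \<bar>f x\<bar> powr p \<partial>lborel))"
    if pr: "p \<le> r"
  proof (rule order_trans[OF _ avf(4)[OF pr]])
    show "(\<integral>\<^sup>+x. \<bar>cube_avg t f x\<bar> powr r \<partial>lborel) \<le> (\<integral>\<^sup>+x. cube_avg t (\<lambda>x. \<bar>f x\<bar>) x powr r \<partial>lborel)"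
      using le pr p by (intro nn_integral_mono ennreal_leI powr_mono2) auto
  qed
  define L where "L = ((\<integral>x. g x powr p \<partial>lborel) / t ^ DIM('a)) powr (1 / p)"
  have gL: "cube_avg t g x \<le> L" for x
    unfolding L_def using root[OF avg(3)[of x] avg(1)] .
  interpret V: finite_measure "restr {0..1::real}" by (rule finite_measure_restr) simp
  have Vm: "measure (restr {0..1::real}) UNIV = 1" by (simp add: measure_restr)
  interpret UV: pair_sigma_finite "restr (unit_cube :: 'a set)" "restr {0..1::real}" ..
  have "ennreal \<bar>cube_avg t f x - cube_avg t f y\<bar> \<le> ennreal (norm (x - y) * L)"
  proof -
    define w where "w = x - y"
    have fi: "integrable (restr unit_cube) (\<lambda>z. f (x + t *\<^sub>R z) - f (y + t *\<^sub>R z))"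
      by (intro Bochner_Integration.integrable_diff cube_integrable[OF fm B(1)])
    have "cube_avg t f x - cube_avg t f y = (\<integral>z. f (x + t *\<^sub>R z) - f (y + t *\<^sub>R z) \<partial>restr unit_cube)"
      unfolding cube_avg_def
      by (rule Bochner_Integration.integral_diff[symmetric]; rule cube_integrable[OF fm B(1)])
    then have "ennreal \<bar>cube_avg t f x - cube_avg t f y\<bar> \<le>
        (\<integral>\<^sup>+z. \<bar>f (x + t *\<^sub>R z) - f (y + t *\<^sub>R z)\<bar> \<partial>restr unit_cube)"
      using integral_norm_bound_ennreal[OF fi] by simp
    also have "\<dots> \<le> (\<integral>\<^sup>+z. (\<integral>\<^sup>+s. norm w * g ((y + s *\<^sub>R w) + t *\<^sub>R z) \<partial>restr {0..1}) \<partial>restr unit_cube)"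
    proof (rule nn_integral_mono)
      fix z :: 'a
      \<comment> \<open>With m = 1 and upper limit 1 the curve is the segment from y + t z to x + t
        z.\<close>
      have 1: "y + t *\<^sub>R z + 1 ^ 1 *\<^sub>R w = x + t *\<^sub>R z" by (simp add: w_def)
      have 2: "y + t *\<^sub>R z + s ^ 1 *\<^sub>R w = (y + s *\<^sub>R w) + t *\<^sub>R z" for s by simp
      show "ennreal \<bar>f (x + t *\<^sub>R z) - f (y + t *\<^sub>R z)\<bar> \<le>
          (\<integral>\<^sup>+s. norm w * g ((y + s *\<^sub>R w) + t *\<^sub>R z) \<partial>restr {0..1})"
        using path_difference_bound[OF test_function_GDERIV[OF f], of 1 1 w "norm w" "y + t *\<^sub>R z"]
        unfolding 1 2 by (simp add: g_def w_def)
    qed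
    also have "\<dots> = (\<integral>\<^sup>+s. (\<integral>\<^sup>+z. norm w * g ((y + s *\<^sub>R w) + t *\<^sub>R z) \<partial>restr unit_cube) \<partial>restr {0..1})"
      by (rule UV.Fubini'[symmetric]) measurable
    also have "\<dots> \<le> (\<integral>\<^sup>+s. ennreal (norm w * L) \<partial>restr {0..1::real})"
    proof (rule nn_integral_mono)
      fix s :: real
      have "(\<integral>\<^sup>+z. norm w * g ((y + s *\<^sub>R w) + t *\<^sub>R z) \<partial>restr unit_cube) =
          ennreal (\<integral>z. norm w * g ((y + s *\<^sub>R w) + t *\<^sub>R z) \<partial>restr unit_cube)"
        using gB by (intro nn_integral_eq_integral integrable_mult_right cube_integrable[OF gm gB(3)]) auto
      also have "\<dots> \<le> ennreal (norm w * L)"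
        using gL[of "y + s *\<^sub>R w"] by (auto simp: cube_avg_def intro!: ennreal_leI mult_left_mono)
      finally show "(\<integral>\<^sup>+z. norm w * g ((y + s *\<^sub>R w) + t *\<^sub>R z) \<partial>restr unit_cube) \<le> ennreal (norm w * L)" .
    qed
    also have "\<dots> = ennreal (norm (x - y) * L)" by (simp add: V.emeasure_eq_measure Vm w_def)
    finally show ?thesis .
  qed
  then show "\<bar>cube_avg t f x - cube_avg t f y\<bar> \<le>
      norm (x - y) * ((\<integral>x. norm (gradient f x) powr p \<partial>lborel) / t ^ DIM('a)) powr (1 / p)"
    by (simp add: L_def g_def ennreal_le_iff)
qed


section \<open>Sobolev inequality and Rellich compactness for test functions\<close>

lemma subcritical_exponent:
  fixes p r N :: real
  assumes "1 \<le> p" "p \<le> r" "0 < r - N * (r - p) / p"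
  obtains m :: nat where "0 < m" "real m * (N * ((r - p) / p)) \<le> real (m - 1) * r"
proof -
  \<comment> \<open>In terms of the margin d the required inequality reads m d >= r, so any integer
    above r / d will do.\<close>
  define d where "d = r - N * (r - p) / p"
  obtain k :: nat where k: "r / d < real k" using reals_Archimedean2 by blast
  have d: "d > 0" using assms by (simp add: d_def)
  have "r / d > 0" using assms d by auto
  then have "0 < k" using k by (cases k) auto
  moreover have "r \<le> real k * d" using k d by (simp add: field_simps less_imp_le)
  then have "real k * (N * ((r - p) / p)) \<le> real k * r - r"
    by (simp add: d_def right_diff_distrib)
  moreover have "real (k - 1) * r = real k * r - r" using \<open>0 < k\<close> by (simp add: of_nat_diff left_diff_distrib)
  ultimately show thesis using that[of k] by simp
qed

lemma nn_integral_powr_split: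
  fixes f g :: "'a \<Rightarrow> real"
  assumes r: "0 \<le> r" and [measurable]: "f \<in> borel_measurable M" "g \<in> borel_measurable M"
  shows "(\<integral>\<^sup>+x. \<bar>f x\<bar> powr r \<partial>M) \<le>
    ennreal (2 powr r) * ((\<integral>\<^sup>+x. \<bar>f x - g x\<bar> powr r \<partial>M) + (\<integral>\<^sup>+x. \<bar>g x\<bar> powr r \<partial>M))"
proof -
  have *: "\<bar>f x\<bar> powr r \<le> 2 powr r * (\<bar>f x - g x\<bar> powr r + \<bar>g x\<bar> powr r)" for x
    using norm_add_powr_le[OF r, of "f x - g x" "g x"] by simp
  have "(\<integral>\<^sup>+x. \<bar>f x\<bar> powr r \<partial>M) \<le>
      (\<integral>\<^sup>+x. ennreal (2 powr r) * (ennreal (\<bar>f x - g x\<bar> powr r) + ennreal (\<bar>g x\<bar> powr r)) \<partial>M)"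
    using * by (intro nn_integral_mono) (auto simp flip: ennreal_plus ennreal_mult intro!: ennreal_leI)
  also have "\<dots> = ennreal (2 powr r) * (\<integral>\<^sup>+x. ennreal (\<bar>f x - g x\<bar> powr r) + ennreal (\<bar>g x\<bar> powr r) \<partial>M)"
    by (rule nn_integral_cmult) measurable
  also have "(\<integral>\<^sup>+x. ennreal (\<bar>f x - g x\<bar> powr r) + ennreal (\<bar>g x\<bar> powr r) \<partial>M) =
      (\<integral>\<^sup>+x. \<bar>f x - g x\<bar> powr r \<partial>M) + (\<integral>\<^sup>+x. \<bar>g x\<bar> powr r \<partial>M)"
    by (rule nn_integral_add) auto
  finally show ?thesis .
qed

text \<open>Split f into its average over unit cubes and the remainder.
  \<open>cube_avg_error\<close> with \<eta> = 1 controls the remainder by the gradient, and the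
  average is controlled by the L^p size of f.\<close>

lemma Sobolev_test_functions:
  assumes p: "1 \<le> p" "p \<le> r" and N: "0 < r - real DIM('a) * (r - p) / p"
  obtains C where "0 \<le> C" "\<And>\<Omega> f. f \<in> test_functions (\<Omega> :: 'a::euclidean_space set) \<Longrightarrow>
    (\<integral>x. \<bar>f x\<bar> powr r \<partial>lborel) \<le>
      C * ((\<integral>x. \<bar>f x\<bar> powr p \<partial>lborel) powr (r / p) + (\<integral>x. norm (gradient f x) powr p \<partial>lborel) powr (r / p))"
proof -
  obtain m where m: "0 < m" "real m * (real DIM('a) * ((r - p) / p)) \<le> real (m - 1) * r"
    using subcritical_exponent[OF p N] by blast
  define K where "K = (real m * real DIM('a)) powr r"
  define C where "C = 2 powr r * (K + 1)"
  have K: "K \<ge> 0" by (simp add: K_def)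
  have "(\<integral>x. \<bar>f x\<bar> powr r \<partial>lborel) \<le>
      C * ((\<integral>x. \<bar>f x\<bar> powr p \<partial>lborel) powr (r / p) + (\<integral>x. norm (gradient f x) powr p \<partial>lborel) powr (r / p))"
    if f: "f \<in> test_functions \<Omega>" for f and \<Omega> :: "'a set"
  proof -
    define I where "I = (\<integral>x. \<bar>f x\<bar> powr p \<partial>lborel)"
    define J where "J = (\<integral>x. norm (gradient f x) powr p \<partial>lborel)"
    have I: "I \<ge> 0" and J: "J \<ge> 0" by (auto simp: I_def J_def)
    have fm [measurable]: "f \<in> borel_measurable borel"
      by (intro borel_measurable_continuous_onI test_function_continuous[OF f])
    have "(\<integral>\<^sup>+x. \<bar>f x\<bar> powr r \<partial>lborel) \<le> ennreal (2 powr r) *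
        ((\<integral>\<^sup>+x. \<bar>f x - cube_avg 1 f x\<bar> powr r \<partial>lborel) + (\<integral>\<^sup>+x. \<bar>cube_avg 1 f x\<bar> powr r \<partial>lborel))"
      using p by (intro nn_integral_powr_split) auto
    also have "\<dots> \<le> ennreal (2 powr r) * (ennreal (K * J powr (r / p)) + ennreal (I powr (r / p)))"
    proof (intro mult_left_mono add_mono)
      show "(\<integral>\<^sup>+x. \<bar>f x - cube_avg 1 f x\<bar> powr r \<partial>lborel) \<le> ennreal (K * J powr (r / p))"
        using cube_avg_error[OF f p _ _ m, of 1] by (simp add: K_def J_def)
      have "I powr ((r - p) / p) * I = I powr (r / p)"
      proof (cases "I = 0")
        case False
        have "(r - p) / p + 1 = r / p" using p by (simp add: field_simps)
        moreover have "I powr ((r - p) / p) * I = I powr ((r - p) / p + 1)" using False I by (simp add: powr_add)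
        ultimately show ?thesis by simp
      qed simp
      then show "(\<integral>\<^sup>+x. \<bar>cube_avg 1 f x\<bar> powr r \<partial>lborel) \<le> ennreal (I powr (r / p))"
        using nn_integral_cube_avg_test[OF f p(1) _ p(2), of 1] by (simp add: I_def)
    qed auto
    also have "\<dots> = ennreal (2 powr r * (K * J powr (r / p) + I powr (r / p)))"
      using K by (simp add: ennreal_mult)
    also have "\<dots> \<le> ennreal (C * (I powr (r / p) + J powr (r / p)))"
      using K by (intro ennreal_leI) (simp add: C_def mult.assoc algebra_simps)
    finally have *: "(\<integral>\<^sup>+x. \<bar>f x\<bar> powr r \<partial>lborel) \<le> ennreal (C * (I powr (r / p) + J powr (r / p)))" .
    have "integrable lborel (\<lambda>x. \<bar>f x\<bar> powr r)" using p by (intro test_function_integrable_powr[OF f]) auto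
    then show ?thesis using * K unfolding I_def[symmetric] J_def[symmetric]
      by (subst (asm) nn_integral_eq_integral) (auto simp: C_def ennreal_le_iff)
  qed
  then show thesis using K by (intro that[of C]) (auto simp: C_def)
qed

text \<open>The averages \<open>cube_avg t (F n)\<close> are equicontinuous for every fixed \<open>t\<close> and they
  approximate \<open>F n\<close> uniformly in \<open>n\<close> as \<open>t\<close> tends to \<open>0\<close>.\<close>

lemma Rellich_test_functions_subseq:
  fixes F :: "nat \<Rightarrow> 'a::euclidean_space \<Rightarrow> real"
  assumes p: "1 \<le> p" "p \<le> r" and N: "0 < r - real DIM('a) * (r - p) / p"
    and \<Omega>: "bounded \<Omega>" and F: "\<And>n. F n \<in> test_functions \<Omega>"
    and bd: "\<And>n. (\<integral>x. \<bar>F n x\<bar> powr p \<partial>lborel) \<le> B" "\<And>n. (\<integral>x. norm (gradient (F n) x) powr p \<partial>lborel) \<le> B"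
    and e: "0 < e"
  shows "\<exists>s :: nat \<Rightarrow> nat. strict_mono s \<and> (\<exists>k. \<forall>i\<ge>k. \<forall>j\<ge>k. (\<integral>x. \<bar>F (s i) x - F (s j) x\<bar> powr r \<partial>lborel) < e)"
proof -
  obtain m where m: "0 < m" "real m * (real DIM('a) * ((r - p) / p)) \<le> real (m - 1) * r"
    using subcritical_exponent[OF p N] by blast
  have r: "r > 0" using p by simp
  have B: "B \<ge> 0" using bd(1)[of 0] by (rule order_trans[rotated]) simp
  \<comment> \<open>Bound for the Dirichlet integral of a difference of two members of the
    sequence.\<close>
  define B' where "B' = 2 powr p * (B + B)"
  define K where "K = (real m * real DIM('a)) powr r * B' powr (r / p)"
  have K: "K \<ge> 0" by (simp add: K_def)
  obtain R where "\<forall>x\<in>\<Omega>. norm x \<le> R" using \<Omega> by (auto simp: bounded_iff)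
  then have R: "\<Omega> \<subseteq> cball 0 R" by auto
  define S where "S = cball (0 :: 'a) R"
  define v where "v = measure lborel S"
  have v: "v \<ge> 0" by (simp add: v_def)
  \<comment> \<open>Two errors of size \<kappa>, multiplied by the 2^r of the splitting inequality,
    add up to e / 2.\<close>
  define \<kappa> where "\<kappa> = e / (4 * 2 powr r)"
  have \<kappa>: "\<kappa> > 0" using e by (simp add: \<kappa>_def)
  \<comment> \<open>The side t = \<eta>^m is small enough that replacing a difference by its average
    costs at most \<kappa>, whichever two members are taken.\<close>
  define \<eta> where "\<eta> = min 1 ((\<kappa> / (K + 1)) powr (1 / r))"
  have \<eta>: "0 < \<eta>" "\<eta> \<le> 1" using \<kappa> K by (auto simp: \<eta>_def)
  have "\<eta> powr r \<le> ((\<kappa> / (K + 1)) powr (1 / r)) powr r"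
    using \<eta> r by (intro powr_mono2) (auto simp: \<eta>_def)
  also have "\<dots> = \<kappa> / (K + 1)" using r \<kappa> K by (simp add: powr_powr)
  finally have "\<eta> powr r * K \<le> \<kappa> / (K + 1) * K" using K by (rule mult_right_mono)
  also have "\<dots> \<le> \<kappa>" using \<kappa> K by (simp add: field_simps)
  finally have \<eta>K: "\<eta> powr r * K \<le> \<kappa>" .
  define t where "t = \<eta> ^ m"
  have t: "t > 0" using \<eta> by (simp add: t_def)
  \<comment> \<open>A function bounded by \<zeta> on S has r-th power integral over S at most
    \<kappa>.\<close>
  define \<zeta> where "\<zeta> = (\<kappa> / (v + 1)) powr (1 / r)"
  have \<zeta>: "\<zeta> > 0" using \<kappa> v by (simp add: \<zeta>_def)
  have "\<zeta> powr r = \<kappa> / (v + 1)" using r \<kappa> v by (simp add: \<zeta>_def powr_powr)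
  then have "\<zeta> powr r * v = \<kappa> / (v + 1) * v" by simp
  also have "\<dots> \<le> \<kappa>" using \<kappa> v by (simp add: field_simps)
  finally have \<zeta>v: "\<zeta> powr r * v \<le> \<kappa>" .
  define L where "L = (B / t ^ DIM('a)) powr (1 / p)"
  have L: "L \<ge> 0" by (simp add: L_def)
  have avg_bound: "\<bar>cube_avg t (F n) x\<bar> \<le> L" for n x
    by (rule order_trans[OF cube_avg_test_bound[OF F p(1) t]])
       (use bd(1)[of n] t p in \<open>auto simp: L_def intro!: powr_mono2 divide_right_mono\<close>)
  have avg_lip: "\<bar>cube_avg t (F n) x - cube_avg t (F n) y\<bar> \<le> norm (x - y) * L" for n x y
    by (rule order_trans[OF cube_avg_test_Lipschitz[OF F p(1) t]])
       (use bd(2)[of n] t p in \<open>auto simp: L_def intro!: mult_left_mono powr_mono2 divide_right_mono\<close>)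
  obtain g s where s: "strict_mono (s :: nat \<Rightarrow> nat)"
    "\<And>e. 0 < e \<Longrightarrow> \<exists>k. \<forall>n x. n \<ge> k \<and> x \<in> S \<longrightarrow> norm (cube_avg t (F (s n)) x - g x) < e"
  proof (rule Arzela_Ascoli[of S "\<lambda>n. cube_avg t (F n)" L])
    show "compact S" by (simp add: S_def)
    show "norm (cube_avg t (F n) x) \<le> L" for n x using avg_bound by simp
    show "\<exists>d. 0 < d \<and> (\<forall>n y. y \<in> S \<and> norm (x - y) < d \<longrightarrow>
        norm (cube_avg t (F n) x - cube_avg t (F n) y) < e')" if "x \<in> S" "0 < e'" for x e'
    proof (intro exI[of _ "e' / (L + 1)"] conjI allI impI)
      show "0 < e' / (L + 1)" using that L by simp
      fix n y assume y: "y \<in> S \<and> norm (x - y) < e' / (L + 1)"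
      have "\<bar>cube_avg t (F n) x - cube_avg t (F n) y\<bar> \<le> norm (x - y) * (L + 1)"
        using avg_lip[of n x y] by (simp add: distrib_left add_increasing2)
      also have "\<dots> < e'" using y L by (simp add: field_simps)
      finally show "norm (cube_avg t (F n) x - cube_avg t (F n) y) < e'" by simp
    qed
  qed blast
  obtain k where k: "\<And>n x. n \<ge> k \<Longrightarrow> x \<in> S \<Longrightarrow> norm (cube_avg t (F (s n)) x - g x) < \<zeta> / 2"
    using s(2)[of "\<zeta> / 2"] \<zeta> by auto
  have "(\<integral>x. \<bar>F (s i) x - F (s j) x\<bar> powr r \<partial>lborel) < e" if ij: "i \<ge> k" "j \<ge> k" for i j
  proof -
    define f where "f = (\<lambda>x. F (s i) x - F (s j) x)"
    have f: "f \<in> test_functions \<Omega>" unfolding f_def by (intro test_functions_diff F)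
    have fm [measurable]: "f \<in> borel_measurable borel"
      by (intro borel_measurable_continuous_onI test_function_continuous[OF f])
    obtain Bi where Bi: "\<And>x. \<bar>F (s i) x\<bar> \<le> Bi" using F[of "s i"] by (rule test_function_bounded) blast
    obtain Bj where Bj: "\<And>x. \<bar>F (s j) x\<bar> \<le> Bj" using F[of "s j"] by (rule test_function_bounded) blast
    have Fm: "F n \<in> borel_measurable borel" for n
      by (intro borel_measurable_continuous_onI test_function_continuous[OF F])
    have avg_f: "\<bar>cube_avg t f x\<bar> \<le> \<zeta>" if "x \<in> S" for x
      using k[OF ij(1) that] k[OF ij(2) that]
      unfolding f_def cube_avg_diff[OF Fm Bi Fm Bj] real_norm_def by linarith
    have J: "(\<integral>x. norm (gradient f x) powr p \<partial>lborel) \<le> B'"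
    proof -
      have p0: "0 < p" "0 \<le> p" using p by auto
      have *: "norm (gradient f x) powr p \<le>
          2 powr p * (norm (gradient (F (s i)) x) powr p + norm (gradient (F (s j)) x) powr p)" for x
        using norm_add_powr_le[OF p0(2), of "gradient (F (s i)) x" "- gradient (F (s j)) x"]
        by (simp add: f_def gradient_diff[OF F F])
      have "(\<integral>x. norm (gradient f x) powr p \<partial>lborel) \<le>
          (\<integral>x. 2 powr p * (norm (gradient (F (s i)) x) powr p + norm (gradient (F (s j)) x) powr p) \<partial>lborel)"
        by (intro integral_mono * test_function_integrable_powr[OF f p0(1)] integrable_mult_right
          Bochner_Integration.integrable_add test_function_integrable_powr[OF F p0(1)])
      also have "\<dots> = 2 powr p * ((\<integral>x. norm (gradient (F (s i)) x) powr p \<partial>lborel) +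
          (\<integral>x. norm (gradient (F (s j)) x) powr p \<partial>lborel))"
        using test_function_integrable_powr(2)[OF F p0(1)] by simp
      also have "\<dots> \<le> B'" unfolding B'_def by (intro mult_left_mono add_mono bd) auto
      finally show ?thesis .
    qed
    have err: "(\<integral>\<^sup>+x. \<bar>f x - cube_avg t f x\<bar> powr r \<partial>lborel) \<le> ennreal \<kappa>"
    proof -
      have "(\<integral>\<^sup>+x. \<bar>f x - cube_avg t f x\<bar> powr r \<partial>lborel) \<le>
          ennreal ((\<eta> * (real m * real DIM('a))) powr r * (\<integral>x. norm (gradient f x) powr p \<partial>lborel) powr (r / p))"
        unfolding t_def by (rule cube_avg_error[OF f p \<eta> m])
      also have "\<dots> \<le> ennreal ((\<eta> * (real m * real DIM('a))) powr r * B' powr (r / p))"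
        using p J by (intro ennreal_leI mult_left_mono powr_mono2) auto
      also have "\<dots> = ennreal (\<eta> powr r * K)" using \<eta> by (simp add: K_def powr_mult mult.assoc)
      also have "\<dots> \<le> ennreal \<kappa>" by (rule ennreal_leI[OF \<eta>K])
      finally show ?thesis .
    qed
    have f0: "f x = 0" if "x \<notin> S" for x
    proof -
      obtain K where K: "K \<subseteq> \<Omega>" "\<And>x. x \<notin> K \<Longrightarrow> f x = 0" using f by (rule test_functionE) blast
      then have "x \<notin> K" using that R unfolding S_def by blast
      then show ?thesis by (rule K(2))
    qed
    have Sm [measurable]: "S \<in> sets borel" by (simp add: S_def)
    \<comment> \<open>The average spreads outside the support of f. Cutting it off at S is harmless,
      because f vanishes there, and leaves a function on a set of finite measure.\<close>
    define h where "h = (\<lambda>x. indicator S x * cube_avg t f x)"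
    have hm [measurable]: "h \<in> borel_measurable borel" unfolding h_def by measurable
    have "(\<integral>\<^sup>+x. \<bar>f x\<bar> powr r \<partial>lborel) \<le> ennreal (2 powr r) *
        ((\<integral>\<^sup>+x. \<bar>f x - h x\<bar> powr r \<partial>lborel) + (\<integral>\<^sup>+x. \<bar>h x\<bar> powr r \<partial>lborel))"
      using r by (intro nn_integral_powr_split) auto
    also have "\<dots> \<le> ennreal (2 powr r) * (ennreal \<kappa> + ennreal \<kappa>)"
    proof (intro mult_left_mono add_mono)
      have "(\<integral>\<^sup>+x. \<bar>f x - h x\<bar> powr r \<partial>lborel) \<le> (\<integral>\<^sup>+x. \<bar>f x - cube_avg t f x\<bar> powr r \<partial>lborel)"
        using f0 by (intro nn_integral_mono ennreal_leI) (auto simp: h_def indicator_def)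
      then show "(\<integral>\<^sup>+x. \<bar>f x - h x\<bar> powr r \<partial>lborel) \<le> ennreal \<kappa>" using err by (rule order_trans)
      have "(\<integral>\<^sup>+x. \<bar>h x\<bar> powr r \<partial>lborel) \<le> (\<integral>\<^sup>+x. ennreal (\<zeta> powr r) * indicator S x \<partial>lborel)"
        using avg_f r by (intro nn_integral_mono)
          (auto simp: h_def indicator_def intro!: ennreal_leI powr_mono2)
      also have "\<dots> = ennreal (\<zeta> powr r) * emeasure lborel S"
        by (rule nn_integral_cmult_indicator) simp
      also have "emeasure lborel S = ennreal v" unfolding v_def
        by (rule emeasure_eq_ennreal_measure) (use emeasure_bounded_finite[of S] in \<open>auto simp: S_def less_top\<close>)
      also have "ennreal (\<zeta> powr r) * ennreal v = ennreal (\<zeta> powr r * v)" using v by (simp add: ennreal_mult)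
      also have "\<dots> \<le> ennreal \<kappa>" by (rule ennreal_leI[OF \<zeta>v])
      finally show "(\<integral>\<^sup>+x. \<bar>h x\<bar> powr r \<partial>lborel) \<le> ennreal \<kappa>" .
    qed auto
    also have "ennreal \<kappa> + ennreal \<kappa> = ennreal (\<kappa> + \<kappa>)"
      using \<kappa> by (intro ennreal_plus[symmetric]) auto
    also have "ennreal (2 powr r) * \<dots> = ennreal (2 powr r * (\<kappa> + \<kappa>))"
      by (rule ennreal_mult'[symmetric]) simp
    also have "2 powr r * (\<kappa> + \<kappa>) = e / 2" by (simp add: \<kappa>_def)
    finally have "(\<integral>\<^sup>+x. \<bar>f x\<bar> powr r \<partial>lborel) \<le> ennreal (e / 2)" .
    then have "(\<integral>x. \<bar>f x\<bar> powr r \<partial>lborel) \<le> e / 2"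
      using e test_function_integrable_powr(1)[OF f r]
      by (subst (asm) nn_integral_eq_integral) (auto simp: ennreal_le_iff)
    then show ?thesis using e by (simp add: f_def)
  qed
  then show ?thesis using s(1) by blast
qed

text \<open>For a single tolerance a subsequence is already available, and the property survives
  passing to further subsequences. Diagonalization over the tolerances 1 / (n + 1) gives one
  sequence for all of them.\<close>

lemma Rellich_test_functions:
  fixes F :: "nat \<Rightarrow> 'a::euclidean_space \<Rightarrow> real"
  assumes p: "1 \<le> p" "p \<le> r" and N: "0 < r - real DIM('a) * (r - p) / p"
    and \<Omega>: "bounded \<Omega>" and F: "\<And>n. F n \<in> test_functions \<Omega>"
    and bd: "\<And>n. (\<integral>x. \<bar>F n x\<bar> powr p \<partial>lborel) \<le> B" "\<And>n. (\<integral>x. norm (gradient (F n) x) powr p \<partial>lborel) \<le> B"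
  obtains s :: "nat \<Rightarrow> nat" where "strict_mono s"
    "\<And>e. 0 < e \<Longrightarrow> \<exists>k. \<forall>i\<ge>k. \<forall>j\<ge>k. (\<integral>x. \<bar>F (s i) x - F (s j) x\<bar> powr r \<partial>lborel) < e"
proof -
  define P where "P = (\<lambda>n (s :: nat \<Rightarrow> nat). \<exists>k. \<forall>i\<ge>k. \<forall>j\<ge>k.
    (\<integral>x. \<bar>F (s i) x - F (s j) x\<bar> powr r \<partial>lborel) < 1 / (real n + 1))"
  interpret subseqs P
  proof
    fix n and s :: "nat \<Rightarrow> nat"
    show "\<exists>r'. strict_mono r' \<and> P n (s \<circ> r')"
      using Rellich_test_functions_subseq[OF p N \<Omega>, of "\<lambda>n. F (s n)" B "1 / (real n + 1)"] F bd
      by (simp add: P_def)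
  qed
  have stable: "P n (s \<circ> u)" if u: "strict_mono u" and Pn: "P n s" for n s and u :: "nat \<Rightarrow> nat"
  proof -
    obtain k where k: "\<forall>i\<ge>k. \<forall>j\<ge>k. (\<integral>x. \<bar>F (s i) x - F (s j) x\<bar> powr r \<partial>lborel) < 1 / (real n + 1)"
      using Pn unfolding P_def by blast
    have "u i \<ge> k" if "i \<ge> k" for i
      using strict_mono_imp_increasing[OF u, of i] that by simp
    then show ?thesis using k unfolding P_def o_def by blast
  qed
  show thesis
  proof (rule that[OF subseq_diagseq])
    fix e :: real assume "0 < e"
    then obtain n :: nat where n: "1 / (real n + 1) < e"
      using reals_Archimedean[of e] by (auto simp: inverse_eq_divide add.commute)
    \<comment> \<open>The property of stage n is asserted for the diagonal sequence from index
      \<open>Suc n\<close> on; the shift is undone below.\<close>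
    have "P n (diagseq \<circ> ((+) (Suc n)))" using stable by (rule diagseq_holds)
    then obtain k where k: "\<And>i j. i \<ge> k \<Longrightarrow> j \<ge> k \<Longrightarrow>
        (\<integral>x. \<bar>F (diagseq (Suc n + i)) x - F (diagseq (Suc n + j)) x\<bar> powr r \<partial>lborel) < 1 / (real n + 1)"
      unfolding P_def o_def by blast
    show "\<exists>k. \<forall>i\<ge>k. \<forall>j\<ge>k. (\<integral>x. \<bar>F (diagseq i) x - F (diagseq j) x\<bar> powr r \<partial>lborel) < e"
    proof (intro exI[of _ "Suc n + k"] allI impI)
      fix i j assume "Suc n + k \<le> i" "Suc n + k \<le> j"
      then have "k \<le> i - Suc n" "k \<le> j - Suc n" "Suc n + (i - Suc n) = i" "Suc n + (j - Suc n) = j" by auto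
      then show "(\<integral>x. \<bar>F (diagseq i) x - F (diagseq j) x\<bar> powr r \<partial>lborel) < e"
        using k[of "i - Suc n" "j - Suc n"] n by simp
    qed
  qed
qed

section \<open>Sobolev functions\<close>

text \<open>The r-th power of the L^r distance, without the root. It appears additively in the
  energy and in the convexity estimates, at the price of a factor 2^r in the triangle
  inequality.\<close>

definition pdist :: "'a measure \<Rightarrow> real \<Rightarrow> ('a \<Rightarrow> 'b::real_normed_vector) \<Rightarrow> ('a \<Rightarrow> 'b) \<Rightarrow> real" where
  "pdist M r f g = (\<integral>x. norm (f x - g x) powr r \<partial>M)"

lemma pdist_nonneg [simp]: "0 \<le> pdist M r f g"
  by (simp add: pdist_def)

lemma pdist_commute: "pdist M r f g = pdist M r g f"
  by (simp add: pdist_def norm_minus_commute)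

lemma pdist_triangle:
  fixes f g h :: "'a \<Rightarrow> 'b::{banach, second_countable_topology}"
  assumes r: "0 \<le> r" and L: "f \<in> Lp_space M r" "g \<in> Lp_space M r" "h \<in> Lp_space M r"
  shows "pdist M r f h \<le> 2 powr r * (pdist M r f g + pdist M r g h)"
proof -
  have d: "integrable M (\<lambda>x. norm (f x - h x) powr r)" "integrable M (\<lambda>x. norm (f x - g x) powr r)"
    "integrable M (\<lambda>x. norm (g x - h x) powr r)"
    by (intro Lp_space_integrable Lp_space_diff r L)+
  have "pdist M r f h \<le> (\<integral>x. 2 powr r * (norm (f x - g x) powr r + norm (g x - h x) powr r) \<partial>M)"
    unfolding pdist_def
  proof (intro integral_mono d integrable_mult_right Bochner_Integration.integrable_add)
    show "norm (f x - h x) powr r \<le> 2 powr r * (norm (f x - g x) powr r + norm (g x - h x) powr r)" for x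
      using norm_add_powr_le[OF r, of "f x - g x" "g x - h x"] by simp
  qed
  also have "\<dots> = 2 powr r * (pdist M r f g + pdist M r g h)" using d by (simp add: pdist_def)
  finally show ?thesis .
qed

lemma pdist_add_scaleR:
  fixes f g f' g' :: "'a \<Rightarrow> 'b::{banach, second_countable_topology}"
  assumes r: "0 \<le> r" and L: "f \<in> Lp_space M r" "g \<in> Lp_space M r" "f' \<in> Lp_space M r" "g' \<in> Lp_space M r"
  shows "pdist M r (\<lambda>x. f x + t *\<^sub>R g x) (\<lambda>x. f' x + t *\<^sub>R g' x) \<le>
    2 powr r * (pdist M r f f' + \<bar>t\<bar> powr r * pdist M r g g')"
proof -
  have d: "integrable M (\<lambda>x. norm ((f x + t *\<^sub>R g x) - (f' x + t *\<^sub>R g' x)) powr r)"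
    "integrable M (\<lambda>x. norm (f x - f' x) powr r)" "integrable M (\<lambda>x. norm (g x - g' x) powr r)"
    by (intro Lp_space_integrable Lp_space_diff Lp_space_add Lp_space_scaleR r L)+
  have "pdist M r (\<lambda>x. f x + t *\<^sub>R g x) (\<lambda>x. f' x + t *\<^sub>R g' x) \<le>
      (\<integral>x. 2 powr r * (norm (f x - f' x) powr r + \<bar>t\<bar> powr r * norm (g x - g' x) powr r) \<partial>M)"
    unfolding pdist_def
  proof (intro integral_mono d integrable_mult_right Bochner_Integration.integrable_add)
    show "norm ((f x + t *\<^sub>R g x) - (f' x + t *\<^sub>R g' x)) powr r \<le>
        2 powr r * (norm (f x - f' x) powr r + \<bar>t\<bar> powr r * norm (g x - g' x) powr r)" for x
    proof -
      have eq: "(f x + t *\<^sub>R g x) - (f' x + t *\<^sub>R g' x) = (f x - f' x) + t *\<^sub>R (g x - g' x)"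
        by (simp add: scaleR_diff_right)
      show ?thesis unfolding eq
        using norm_add_powr_le[OF r, of "f x - f' x" "t *\<^sub>R (g x - g' x)"] by (simp add: powr_mult)
    qed
  qed
  also have "\<dots> = 2 powr r * (pdist M r f f' + \<bar>t\<bar> powr r * pdist M r g g')" using d by (simp add: pdist_def)
  finally show ?thesis .
qed

text \<open>Convexity gives the factor 1 / 2, where the quasi-triangle inequality would give a
  factor 2^r. Midpoints of two functions within d of h therefore stay within d of h.\<close>

lemma pdist_midpoint:
  fixes f g h :: "'a \<Rightarrow> 'b::euclidean_space"
  assumes r: "1 < r" and L: "f \<in> Lp_space M r" "g \<in> Lp_space M r" "h \<in> Lp_space M r"
  shows "pdist M r (\<lambda>x. (1/2) *\<^sub>R (f x + g x)) h \<le> (pdist M r f h + pdist M r g h) / 2"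
proof -
  have r0: "0 \<le> r" using r by simp
  have d: "integrable M (\<lambda>x. norm ((1/2) *\<^sub>R (f x + g x) - h x) powr r)"
    "integrable M (\<lambda>x. norm (f x - h x) powr r)" "integrable M (\<lambda>x. norm (g x - h x) powr r)"
    by (intro Lp_space_integrable Lp_space_diff Lp_space_add Lp_space_scaleR r0 L)+
  have "pdist M r (\<lambda>x. (1/2) *\<^sub>R (f x + g x)) h \<le>
      (\<integral>x. (norm (f x - h x) powr r + norm (g x - h x) powr r) / 2 \<partial>M)"
    unfolding pdist_def
  proof (intro integral_mono d integrable_divide Bochner_Integration.integrable_add)
    show "norm ((1/2) *\<^sub>R (f x + g x) - h x) powr r \<le>
        (norm (f x - h x) powr r + norm (g x - h x) powr r) / 2" for x
    proof -
      have "(1/2) *\<^sub>R h x + (1/2) *\<^sub>R h x = h x" by (simp flip: scaleR_left_distrib)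
      then have "(1/2) *\<^sub>R ((f x - h x) + (g x - h x)) = (1/2) *\<^sub>R (f x + g x) - h x"
        by (simp add: scaleR_diff_right scaleR_add_right algebra_simps)
      then show ?thesis using norm_midpoint_powr_le[OF r, of "f x - h x" "g x - h x"] by metis
    qed
  qed
  also have "\<dots> = (pdist M r f h + pdist M r g h) / 2" using d by (simp add: pdist_def)
  finally show ?thesis .
qed

lemma pdist_eq_0_imp_AE:
  fixes f g :: "'a \<Rightarrow> 'b::{banach, second_countable_topology}"
  assumes "0 \<le> r" "f \<in> Lp_space M r" "g \<in> Lp_space M r" "pdist M r f g = 0"
  shows "AE x in M. f x = g x"
proof -
  have "integrable M (\<lambda>x. norm (f x - g x) powr r)"
    by (intro Lp_space_integrable Lp_space_diff assms)
  then have "AE x in M. norm (f x - g x) powr r = 0"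
    using assms(4) unfolding pdist_def by (subst (asm) integral_nonneg_eq_0_iff_AE) auto
  then show ?thesis by eventually_elim simp
qed

lemma pdist_limit_unique:
  fixes f g :: "'a \<Rightarrow> 'b::{banach, second_countable_topology}"
  assumes r: "0 \<le> r" and L: "\<And>n. F n \<in> Lp_space M r" "f \<in> Lp_space M r" "g \<in> Lp_space M r"
    and lim: "(\<lambda>n. pdist M r (F n) f) \<longlonglongrightarrow> 0" "(\<lambda>n. pdist M r (F n) g) \<longlonglongrightarrow> 0"
  shows "AE x in M. f x = g x"
proof (rule pdist_eq_0_imp_AE[OF r L(2,3)])
  have "(\<lambda>n. 2 powr r * (pdist M r (F n) f + pdist M r (F n) g)) \<longlonglongrightarrow> 2 powr r * (0 + 0)"
    by (intro tendsto_intros lim)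
  moreover have "pdist M r f g \<le> 2 powr r * (pdist M r (F n) f + pdist M r (F n) g)" for n
    using pdist_triangle[OF r L(2) L(1)[of n] L(3)] by (simp add: pdist_commute)
  ultimately have "pdist M r f g \<le> 2 powr r * (0 + 0)" by - (rule LIMSEQ_le_const, assumption, blast)
  then show "pdist M r f g = 0" using pdist_nonneg[of M r f g] by simp
qed

lemma pdist_Cauchy:
  fixes f :: "'a \<Rightarrow> 'b::{banach, second_countable_topology}"
  assumes r: "0 \<le> r" and L: "\<And>n. F n \<in> Lp_space M r" "f \<in> Lp_space M r"
    and lim: "(\<lambda>n. pdist M r (F n) f) \<longlonglongrightarrow> 0" and e: "0 < e"
  obtains N where "\<And>m n. m \<ge> N \<Longrightarrow> n \<ge> N \<Longrightarrow> pdist M r (F m) (F n) < e"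
proof -
  define d where "d = e / (2 * 2 powr r)"
  have d: "d > 0" using e by (simp add: d_def)
  have "\<forall>\<^sub>F n in sequentially. pdist M r (F n) f < d" using lim d by (rule order_tendstoD)
  then obtain N where N: "\<And>n. n \<ge> N \<Longrightarrow> pdist M r (F n) f < d" by (auto simp: eventually_sequentially)
  show thesis
  proof (rule that[of N])
    fix m n assume mn: "m \<ge> N" "n \<ge> N"
    have "pdist M r (F m) (F n) \<le> 2 powr r * (pdist M r (F m) f + pdist M r (F n) f)"
      using pdist_triangle[OF r L(1)[of m] L(2) L(1)[of n]] by (simp add: pdist_commute)
    also have "\<dots> < 2 powr r * (d + d)" using N[OF mn(1)] N[OF mn(2)]
      by (intro mult_strict_left_mono add_strict_mono) auto
    also have "\<dots> = e" by (simp add: d_def)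
    finally show "pdist M r (F m) (F n) < e" .
  qed
qed

lemma pdist_small_imp_tendsto:
  assumes "\<And>e. 0 < e \<Longrightarrow> \<exists>d>0. \<forall>n. X n < d \<longrightarrow> \<bar>Y n - y\<bar> < e" "X \<longlonglongrightarrow> (0::real)"
  shows "Y \<longlonglongrightarrow> (y::real)"
proof (rule tendstoI)
  fix e :: real assume "0 < e"
  then obtain d where d: "d > 0" "\<forall>n. X n < d \<longrightarrow> \<bar>Y n - y\<bar> < e" using assms(1) by blast
  have "\<forall>\<^sub>F n in sequentially. X n < d" using assms(2) d(1) by (rule order_tendstoD)
  then show "\<forall>\<^sub>F n in sequentially. dist (Y n) y < e"
    by eventually_elim (use d(2) in \<open>simp add: dist_real_def\<close>)
qed

lemma Lp_powr_integral_tendsto: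
  fixes f :: "'a \<Rightarrow> 'b::{banach, second_countable_topology}"
  assumes r: "0 < r" and F: "\<And>n. F n \<in> Lp_space M r" and f: "f \<in> Lp_space M r"
    and c: "c \<in> borel_measurable M" "AE x in M. \<bar>c x\<bar> \<le> (K::real)"
    and lim: "(\<lambda>n. pdist M r (F n) f) \<longlonglongrightarrow> 0"
  shows "(\<lambda>n. \<integral>x. c x * norm (F n x) powr r \<partial>M) \<longlonglongrightarrow> (\<integral>x. c x * norm (f x) powr r \<partial>M)"
proof (rule pdist_small_imp_tendsto[OF _ lim])
  fix e :: real assume "0 < e"
  from Lp_powr_integral_continuous[OF r f c this] obtain d where "0 < d"
    "\<And>g. g \<in> Lp_space M r \<Longrightarrow> (\<integral>x. norm (g x - f x) powr r \<partial>M) < d \<Longrightarrow>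
      \<bar>(\<integral>x. c x * norm (g x) powr r \<partial>M) - (\<integral>x. c x * norm (f x) powr r \<partial>M)\<bar> < e" by blast
  then show "\<exists>d>0. \<forall>n. pdist M r (F n) f < d \<longrightarrow>
      \<bar>(\<integral>x. c x * norm (F n x) powr r \<partial>M) - (\<integral>x. c x * norm (f x) powr r \<partial>M)\<bar> < e"
    using F unfolding pdist_def by blast
qed

lemma (in finite_measure) pdist_tendsto_mono:
  fixes f :: "'a \<Rightarrow> 'b::{banach, second_countable_topology}"
  assumes q: "0 < q" "q \<le> \<gamma>" and L: "\<And>n. F n \<in> Lp_space M \<gamma>" "f \<in> Lp_space M \<gamma>"
    and lim: "(\<lambda>n. pdist M \<gamma> (F n) f) \<longlonglongrightarrow> 0"
  shows "(\<lambda>n. pdist M q (F n) f) \<longlonglongrightarrow> 0"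
proof (rule pdist_small_imp_tendsto[OF _ lim])
  fix e :: real assume "0 < e"
  from Lp_small_exponent[OF q this] obtain d where d: "0 < d" "\<And>f :: 'a \<Rightarrow> 'b.
    f \<in> Lp_space M \<gamma> \<Longrightarrow> (\<integral>x. norm (f x) powr \<gamma> \<partial>M) < d \<Longrightarrow> (\<integral>x. norm (f x) powr q \<partial>M) < e" by blast
  have "(\<lambda>x. F n x - f x) \<in> Lp_space M \<gamma>" for n using q L by (intro Lp_space_diff) auto
  then show "\<exists>d>0. \<forall>n. pdist M \<gamma> (F n) f < d \<longrightarrow> \<bar>pdist M q (F n) f - 0\<bar> < e"
    using d unfolding pdist_def by auto
qed

lemma test_functions_partial_derivative:
  assumes f: "f \<in> test_functions \<Omega>" and b: "b \<in> Basis"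
  shows "(\<lambda>x. gradient f x \<bullet> b) \<in> test_functions \<Omega>"
proof -
  obtain K where K: "compact K" "K \<subseteq> \<Omega>" "\<And>x. x \<notin> K \<Longrightarrow> f x = 0" using f by (rule test_functionE) blast
  show ?thesis
  proof (rule test_functionI[OF _ K(1,2)])
    fix k
    have "C_k (Suc k) f" using f unfolding test_functions_def by blast
    then obtain G where G: "\<And>x. GDERIV f x :> G x" "\<And>b. b \<in> Basis \<Longrightarrow> C_k k (\<lambda>x. G x \<bullet> b)"
      by (rule C_k_SucE) blast
    have "gradient f = G" using gradient_eq[OF G(1)] by auto
    then show "C_k k (\<lambda>x. gradient f x \<bullet> b)" using G(2)[OF b] by simp
  qed (simp add: test_function_gradient_eq_0[OF f K(1,3)])
qed

section \<open>Weak gradients and Sobolev functions on a bounded open set\<close>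

locale bounded_open =
  fixes \<Omega> :: "'a::euclidean_space set"
  assumes open_\<Omega>: "open \<Omega>" and bounded_\<Omega>: "bounded \<Omega>"

sublocale bounded_open \<subseteq> finite_measure "lebesgue_on \<Omega>"
  using open_\<Omega> bounded_\<Omega> by (rule finite_measure_lebesgue_on_bounded)

context bounded_open
begin

abbreviation "L \<equiv> lebesgue_on \<Omega>"

lemma sets_\<Omega>: "\<Omega> \<in> sets lebesgue"
  using open_\<Omega> by auto

text \<open>Multiplied by the cutoffs \<tau> n, the function becomes integrable over \<Omega>, and
  these products converge to it everywhere in \<Omega>.\<close>

lemma locally_integrable_measurable:
  fixes h :: "'a \<Rightarrow> 'b::euclidean_space"
  assumes h: "locally_integrable \<Omega> h"
  shows "h \<in> borel_measurable L"
proof -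
  obtain \<tau> :: "nat \<Rightarrow> 'a \<Rightarrow> real" where \<tau>: "\<And>n. \<tau> n \<in> test_functions \<Omega>"
    "\<And>x. x \<in> \<Omega> \<Longrightarrow> (\<lambda>n. \<tau> n x) \<longlonglongrightarrow> 1"
    by (rule test_function_exhaustion[OF open_\<Omega>]) blast
  have "(\<lambda>x. \<tau> n x *\<^sub>R h x) \<in> borel_measurable L" for n
    using locally_integrable_mult_test[OF open_\<Omega> h \<tau>(1)] by (rule borel_measurable_integrable)
  moreover have "(\<lambda>n. \<tau> n x *\<^sub>R h x) \<longlonglongrightarrow> h x" if "x \<in> space L" for x
    using tendsto_scaleR[OF \<tau>(2)[of x] tendsto_const[of "h x"]] that by simp
  ultimately show ?thesis by (rule borel_measurable_LIMSEQ_metric)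
qed

lemma integrable_imp_locally_integrable:
  fixes h :: "'a \<Rightarrow> 'b::euclidean_space"
  assumes h: "integrable L h"
  shows "locally_integrable \<Omega> h"
  unfolding locally_integrable_def
proof (intro allI impI)
  fix K assume K: "compact K \<and> K \<subseteq> \<Omega>"
  then have SK: "K \<in> sets lebesgue" by (intro fmeasurableD lmeasurable_compact) auto
  have "integrable lebesgue (\<lambda>x. indicator \<Omega> x *\<^sub>R h x)"
    using h sets_\<Omega> by (simp add: integrable_restrict_space)
  then have "integrable lebesgue (\<lambda>x. indicator K x *\<^sub>R indicator \<Omega> x *\<^sub>R h x)"
    by (rule integrable_mult_indicator[OF SK])
  also have "(\<lambda>x. indicator K x *\<^sub>R indicator \<Omega> x *\<^sub>R h x) = (\<lambda>x. indicator K x *\<^sub>R h x)"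
    using K by (auto simp: fun_eq_iff indicator_def)
  finally show "integrable (lebesgue_on K) h" using SK by (simp add: integrable_restrict_space)
qed

lemma Lp_locally_integrable:
  fixes h :: "'a \<Rightarrow> 'b::euclidean_space"
  assumes "h \<in> Lp_space L r" "1 \<le> r"
  shows "locally_integrable \<Omega> h" "integrable L h"
proof -
  have "h \<in> Lp_space L 1" using assms by (intro Lp_space_mono[OF assms(1)]) auto
  then show "integrable L h" by (auto simp: Lp_space_def integrable_norm_iff)
  then show "locally_integrable \<Omega> h" by (rule integrable_imp_locally_integrable)
qed

lemma locally_integrable_add_scaleR:
  fixes f g :: "'a \<Rightarrow> 'b::euclidean_space"
  assumes "locally_integrable \<Omega> f" "locally_integrable \<Omega> g"
  shows "locally_integrable \<Omega> (\<lambda>x. f x + t *\<^sub>R g x)"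
  using assms by (auto simp: locally_integrable_def)

lemma integrable_mult_gradient:
  assumes u: "locally_integrable \<Omega> u" and f: "f \<in> test_functions \<Omega>"
  shows "integrable L (\<lambda>x. u x *\<^sub>R gradient f x)"
proof -
  have "integrable L (\<lambda>x. \<Sum>b\<in>Basis. ((gradient f x \<bullet> b) *\<^sub>R u x) *\<^sub>R b)"
    by (intro Bochner_Integration.integrable_sum integrable_scaleR_left
      locally_integrable_mult_test[OF open_\<Omega> u] test_functions_partial_derivative f)
  also have "(\<lambda>x. \<Sum>b\<in>Basis. ((gradient f x \<bullet> b) *\<^sub>R u x) *\<^sub>R b) = (\<lambda>x. u x *\<^sub>R gradient f x)"
  proof
    fix x
    have "(\<Sum>b\<in>Basis. ((gradient f x \<bullet> b) *\<^sub>R u x) *\<^sub>R b) = u x *\<^sub>R (\<Sum>b\<in>Basis. (gradient f x \<bullet> b) *\<^sub>R b)"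
      by (simp add: scaleR_sum_right mult.commute)
    then show "(\<Sum>b\<in>Basis. ((gradient f x \<bullet> b) *\<^sub>R u x) *\<^sub>R b) = u x *\<^sub>R gradient f x"
      by (simp only: euclidean_representation)
  qed
  finally show ?thesis .
qed

text \<open>Each coordinate of the difference integrates to 0 against every test function, so the
  fundamental lemma applies coordinate by coordinate.\<close>

lemma is_weak_gradient_unique:
  assumes "is_weak_gradient \<Omega> u G" "is_weak_gradient \<Omega> u G'"
  shows "AE x in L. G x = G' x"
proof -
  have li: "locally_integrable \<Omega> G" "locally_integrable \<Omega> G'" using assms by (auto simp: is_weak_gradient_def)
  note m = locally_integrable_measurable[OF li(1)] locally_integrable_measurable[OF li(2)]
  have "AE x in L. (G x - G' x) \<bullet> b = 0" for b
  proof (rule fundamental_lemma_variations[OF open_\<Omega>])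
    show "(\<lambda>x. (G x - G' x) \<bullet> b) \<in> borel_measurable L" using m by measurable
    fix f assume f: "f \<in> test_functions \<Omega>"
    note i = locally_integrable_mult_test[OF open_\<Omega> li(1) f] locally_integrable_mult_test[OF open_\<Omega> li(2) f]
    have eq: "f x * ((G x - G' x) \<bullet> b) = (f x *\<^sub>R G x - f x *\<^sub>R G' x) \<bullet> b" for x
      by (simp add: inner_diff_left algebra_simps)
    show "integrable L (\<lambda>x. f x * ((G x - G' x) \<bullet> b))" unfolding eq using i by auto
    have "(\<integral>x. f x *\<^sub>R G x \<partial>L) = (\<integral>x. f x *\<^sub>R G' x \<partial>L)"
      using assms f unfolding is_weak_gradient_def by (metis neg_equal_iff_equal)
    then have "(\<integral>x. f x *\<^sub>R G x - f x *\<^sub>R G' x \<partial>L) = 0" using i by simp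
    moreover have "(\<integral>x. (f x *\<^sub>R G x - f x *\<^sub>R G' x) \<bullet> b \<partial>L) = (\<integral>x. f x *\<^sub>R G x - f x *\<^sub>R G' x \<partial>L) \<bullet> b"
      by (rule integral_inner_left) (use i in auto)
    ultimately show "(\<integral>x. f x * ((G x - G' x) \<bullet> b) \<partial>L) = 0" unfolding eq by simp
  qed
  then have "AE x in L. \<forall>b\<in>Basis. (G x - G' x) \<bullet> b = 0" by (intro AE_finite_allI) auto
  then show ?thesis
  proof eventually_elim
    case (elim x)
    then have "G x - G' x = 0" by (simp add: euclidean_all_zero_iff)
    then show ?case by simp
  qed
qed

lemma is_weak_gradient_add_scaleR:
  assumes "is_weak_gradient \<Omega> u G" "is_weak_gradient \<Omega> v H"
  shows "is_weak_gradient \<Omega> (\<lambda>x. u x + t * v x) (\<lambda>x. G x + t *\<^sub>R H x)"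
proof -
  have li: "locally_integrable \<Omega> u" "locally_integrable \<Omega> G" "locally_integrable \<Omega> v" "locally_integrable \<Omega> H"
    using assms by (auto simp: is_weak_gradient_def)
  have "(\<integral>x. (u x + t * v x) *\<^sub>R gradient f x \<partial>L) = - (\<integral>x. f x *\<^sub>R (G x + t *\<^sub>R H x) \<partial>L)"
    if f: "f \<in> test_functions \<Omega>" for f
  proof -
    note i = integrable_mult_gradient[OF li(1) f] integrable_mult_gradient[OF li(3) f]
      locally_integrable_mult_test[OF open_\<Omega> li(2) f] locally_integrable_mult_test[OF open_\<Omega> li(4) f]
    have "(\<integral>x. (u x + t * v x) *\<^sub>R gradient f x \<partial>L) =
        (\<integral>x. u x *\<^sub>R gradient f x + t *\<^sub>R (v x *\<^sub>R gradient f x) \<partial>L)"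
      by (simp add: scaleR_add_left)
    also have "\<dots> = (\<integral>x. u x *\<^sub>R gradient f x \<partial>L) + t *\<^sub>R (\<integral>x. v x *\<^sub>R gradient f x \<partial>L)"
      using i(1,2) by (simp only: Bochner_Integration.integral_add integrable_scaleR_right
        Bochner_Integration.integral_scaleR_right)
    also have "\<dots> = - ((\<integral>x. f x *\<^sub>R G x \<partial>L) + t *\<^sub>R (\<integral>x. f x *\<^sub>R H x \<partial>L))"
      using assms f by (simp add: is_weak_gradient_def)
    also have "(\<integral>x. f x *\<^sub>R G x \<partial>L) + t *\<^sub>R (\<integral>x. f x *\<^sub>R H x \<partial>L) =
        (\<integral>x. f x *\<^sub>R G x + t *\<^sub>R (f x *\<^sub>R H x) \<partial>L)"
      using i(3,4) by (simp only: Bochner_Integration.integral_add integrable_scaleR_right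
        Bochner_Integration.integral_scaleR_right)
    also have "\<dots> = (\<integral>x. f x *\<^sub>R (G x + t *\<^sub>R H x) \<partial>L)"
      by (simp add: scaleR_add_right mult.commute)
    finally show ?thesis .
  qed
  then show ?thesis
    using locally_integrable_add_scaleR[OF li(1,3), of t] locally_integrable_add_scaleR[OF li(2,4), of t]
    by (simp add: is_weak_gradient_def)
qed

lemma test_function_integral_L:
  assumes f: "f \<in> test_functions \<Omega>" and r: "0 < r"
  shows "integrable L (\<lambda>x. norm (f x) powr r)" "(\<integral>x. norm (f x) powr r \<partial>L) = (\<integral>x. \<bar>f x\<bar> powr r \<partial>lborel)"
    and "integrable L (\<lambda>x. norm (gradient f x) powr r)"
      "(\<integral>x. norm (gradient f x) powr r \<partial>L) = (\<integral>x. norm (gradient f x) powr r \<partial>lborel)"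
proof -
  obtain K where K: "compact K" "K \<subseteq> \<Omega>" "\<And>x. x \<notin> K \<Longrightarrow> f x = 0" using f by (rule test_functionE) blast
  have 0: "\<bar>f x\<bar> powr r = 0" "norm (gradient f x) powr r = 0" if "x \<notin> \<Omega>" for x
  proof -
    have "x \<notin> K" using that K(2) by blast
    then show "\<bar>f x\<bar> powr r = 0" "norm (gradient f x) powr r = 0"
      using K(3) test_function_gradient_eq_0[OF f K(1,3)] by auto
  qed
  note i = test_function_integrable_powr[OF f r]
  have m: "(\<lambda>x. \<bar>f x\<bar> powr r) \<in> borel_measurable borel" "(\<lambda>x. norm (gradient f x) powr r) \<in> borel_measurable borel"
    using i by (auto dest: borel_measurable_integrable)
  note l1 = lebesgue_on_lborel[OF open_\<Omega> m(1) 0(1)] and l2 = lebesgue_on_lborel[OF open_\<Omega> m(2) 0(2)]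
  show "integrable L (\<lambda>x. norm (f x) powr r)" "(\<integral>x. norm (f x) powr r \<partial>L) = (\<integral>x. \<bar>f x\<bar> powr r \<partial>lborel)"
    "integrable L (\<lambda>x. norm (gradient f x) powr r)"
      "(\<integral>x. norm (gradient f x) powr r \<partial>L) = (\<integral>x. norm (gradient f x) powr r \<partial>lborel)"
    using l1 l2 i by simp_all
qed

lemma test_function_Lp:
  assumes f: "f \<in> test_functions \<Omega>" and r: "0 < r"
  shows "f \<in> Lp_space L r" "gradient f \<in> Lp_space L r"
  using test_function_integral_L[OF f r] test_function_continuous[OF f] test_function_GDERIV(2)[OF f]
  by (auto simp: Lp_space_def intro: borel_measurable_continuous_lebesgue_on)

text \<open>A member of W_0^{1,p} together with one representative of its weak gradient. Naming G
  frees linear combinations and limits from the arbitrary choice inside \<open>weak_grad\<close>,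
  and the approximating sequence F records membership in the closure of the test functions.\<close>

definition sobolev_pair :: "real \<Rightarrow> ('a \<Rightarrow> real) \<Rightarrow> ('a \<Rightarrow> 'a) \<Rightarrow> bool" where
  "sobolev_pair p u G \<longleftrightarrow> u \<in> Lp_space L p \<and> G \<in> Lp_space L p \<and> is_weak_gradient \<Omega> u G \<and>
     (\<exists>F. (\<forall>n. F n \<in> test_functions \<Omega>) \<and> (\<lambda>n. pdist L p (F n) u) \<longlonglongrightarrow> 0 \<and>
       (\<lambda>n. pdist L p (gradient (F n)) G) \<longlonglongrightarrow> 0)"

lemma weak_grad_AE_eq:
  assumes "is_weak_gradient \<Omega> u G"
  shows "is_weak_gradient \<Omega> u (weak_grad \<Omega> u)" "AE x in L. weak_grad \<Omega> u x = G x"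
proof -
  show "is_weak_gradient \<Omega> u (weak_grad \<Omega> u)" 
    unfolding weak_grad_def using someI[of "is_weak_gradient \<Omega> u", OF assms] .
  then show "AE x in L. weak_grad \<Omega> u x = G x" using assms by (rule is_weak_gradient_unique)
qed

lemma weak_grad_integral:
  assumes "is_weak_gradient \<Omega> u G"
  shows "(\<integral>x. norm (weak_grad \<Omega> u x) powr p \<partial>L) = (\<integral>x. norm (G x) powr p \<partial>L)"
proof -
  have "weak_grad \<Omega> u \<in> borel_measurable L" "G \<in> borel_measurable L"
    using assms weak_grad_AE_eq(1)[OF assms]
    by (auto simp: is_weak_gradient_def intro: locally_integrable_measurable)
  then show ?thesis using weak_grad_AE_eq(2)[OF assms]
    by (intro integral_cong_AE) (auto elim!: eventually_mono)
qed

lemma W1p_norm_diff: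
  assumes u: "is_weak_gradient \<Omega> u G" and f: "f \<in> test_functions \<Omega>"
  shows "W1p_norm \<Omega> p (\<lambda>x. u x - f x) = (pdist L p f u + pdist L p (gradient f) G) powr (1 / p)"
proof -
  have "is_weak_gradient \<Omega> (\<lambda>x. u x - f x) (\<lambda>x. G x - gradient f x)"
    using is_weak_gradient_add_scaleR[OF u test_function_weak_gradient[OF open_\<Omega> f], of "-1"] by simp
  then have "(\<integral>x. norm (weak_grad \<Omega> (\<lambda>x. u x - f x) x) powr p \<partial>L) = pdist L p G (gradient f)"
    unfolding pdist_def by (rule weak_grad_integral)
  then show ?thesis unfolding W1p_norm_def by (simp add: pdist_def norm_minus_commute abs_minus_commute)
qed

lemma W1p0_imp_sobolev_pair:
  assumes u: "u \<in> W1p0 \<Omega> p" and p: "1 < p"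
  shows "sobolev_pair p u (weak_grad \<Omega> u)"
proof -
  obtain G where G: "u \<in> Lp_space L p" "G \<in> Lp_space L p" "is_weak_gradient \<Omega> u G"
    using u by (auto simp: W1p0_def W1p_def)
  let ?G = "weak_grad \<Omega> u"
  have wG: "is_weak_gradient \<Omega> u ?G" using weak_grad_AE_eq[OF G(3)] by simp
  have "AE x in L. G x = ?G x" using weak_grad_AE_eq(2)[OF G(3)] by eventually_elim simp
  moreover have "?G \<in> borel_measurable L"
    using wG unfolding is_weak_gradient_def by (intro locally_integrable_measurable) simp
  ultimately have LG: "?G \<in> Lp_space L p" using p by (intro Lp_space_cong_AE[OF G(2)]) simp_all
  have "\<exists>f\<in>test_functions \<Omega>. W1p_norm \<Omega> p (\<lambda>x. u x - f x) < 1 / (real n + 1)" for n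
    using u by (auto simp: W1p0_def)
  then obtain F where F: "\<And>n. F n \<in> test_functions \<Omega>"
    "\<And>n. W1p_norm \<Omega> p (\<lambda>x. u x - F n x) < 1 / (real n + 1)" by metis
  define X where "X = (\<lambda>n. pdist L p (F n) u + pdist L p (gradient (F n)) ?G)"
  have X: "X n \<le> (1 / (real n + 1)) powr p" for n
  proof -
    have "X n powr (1 / p) \<le> 1 / (real n + 1)"
      using F(2)[of n] unfolding W1p_norm_diff[OF wG F(1)] X_def by simp
    then have "(X n powr (1 / p)) powr p \<le> (1 / (real n + 1)) powr p" using p by (intro powr_mono2) auto
    moreover have "X n \<ge> 0" by (simp add: X_def)
    ultimately show ?thesis using p by (simp add: powr_powr)
  qed
  have "(\<lambda>n. (1 / (real n + 1)) powr p) \<longlonglongrightarrow> 0 powr p"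
  proof (rule tendsto_powr')
    show "(\<lambda>n. 1 / (real n + 1)) \<longlonglongrightarrow> 0" using LIMSEQ_inverse_real_of_nat
      by (simp add: inverse_eq_divide add.commute)
  qed (use p in auto)
  then have lim: "(\<lambda>n. (1 / (real n + 1)) powr p) \<longlonglongrightarrow> 0" using p by simp
  have "pdist L p (F n) u \<le> (1 / (real n + 1)) powr p" for n
    by (rule order_trans[OF _ X]) (simp add: X_def)
  then have "(\<lambda>n. pdist L p (F n) u) \<longlonglongrightarrow> 0"
    by (intro tendsto_sandwich[OF _ _ tendsto_const lim]) auto
  moreover have "pdist L p (gradient (F n)) ?G \<le> (1 / (real n + 1)) powr p" for n
    by (rule order_trans[OF _ X]) (simp add: X_def)
  then have "(\<lambda>n. pdist L p (gradient (F n)) ?G) \<longlonglongrightarrow> 0"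
    by (intro tendsto_sandwich[OF _ _ tendsto_const lim]) auto
  ultimately show ?thesis using G(1) LG wG F(1) unfolding sobolev_pair_def by blast
qed

lemma sobolev_pair_imp_W1p0:
  assumes "sobolev_pair p u G" and p: "1 < p"
  shows "u \<in> W1p0 \<Omega> p"
proof -
  obtain F where *: "u \<in> Lp_space L p" "G \<in> Lp_space L p" "is_weak_gradient \<Omega> u G"
    "\<And>n. F n \<in> test_functions \<Omega>" "(\<lambda>n. pdist L p (F n) u) \<longlonglongrightarrow> 0"
    "(\<lambda>n. pdist L p (gradient (F n)) G) \<longlonglongrightarrow> 0"
    using assms(1) by (auto simp: sobolev_pair_def)
  have "\<exists>f\<in>test_functions \<Omega>. W1p_norm \<Omega> p (\<lambda>x. u x - f x) < e" if e: "e > 0" for e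
  proof -
    have "(\<lambda>n. (pdist L p (F n) u + pdist L p (gradient (F n)) G) powr (1 / p)) \<longlonglongrightarrow> (0 + 0) powr (1 / p)"
      using p by (intro tendsto_powr' tendsto_add * tendsto_const) auto
    then have "(\<lambda>n. W1p_norm \<Omega> p (\<lambda>x. u x - F n x)) \<longlonglongrightarrow> 0"
      using p by (simp add: W1p_norm_diff[OF *(3,4)])
    then have "\<forall>\<^sub>F n in sequentially. W1p_norm \<Omega> p (\<lambda>x. u x - F n x) < e" using e by (rule order_tendstoD)
    then show ?thesis using *(4) by (auto simp: eventually_sequentially)
  qed
  then show ?thesis using * by (auto simp: W1p0_def W1p_def)
qed

lemma sobolev_pair_add_scaleR:
  assumes u: "sobolev_pair p u G" and v: "sobolev_pair p v H" and p: "1 < p"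
  shows "sobolev_pair p (\<lambda>x. u x + t * v x) (\<lambda>x. G x + t *\<^sub>R H x)"
proof -
  obtain F where *: "u \<in> Lp_space L p" "G \<in> Lp_space L p" "is_weak_gradient \<Omega> u G"
    "\<And>n. F n \<in> test_functions \<Omega>" "(\<lambda>n. pdist L p (F n) u) \<longlonglongrightarrow> 0"
    "(\<lambda>n. pdist L p (gradient (F n)) G) \<longlonglongrightarrow> 0"
    using u by (auto simp: sobolev_pair_def)
  obtain E where **: "v \<in> Lp_space L p" "H \<in> Lp_space L p" "is_weak_gradient \<Omega> v H"
    "\<And>n. E n \<in> test_functions \<Omega>" "(\<lambda>n. pdist L p (E n) v) \<longlonglongrightarrow> 0"
    "(\<lambda>n. pdist L p (gradient (E n)) H) \<longlonglongrightarrow> 0"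
    using v by (auto simp: sobolev_pair_def)
  have p0: "0 \<le> p" "0 < p" using p by auto
  define D where "D = (\<lambda>n x. F n x + t * E n x)"
  have D: "D n \<in> test_functions \<Omega>" for n
    unfolding D_def by (intro test_functions_add test_functions_cmult * **)
  have gD: "gradient (D n) = (\<lambda>x. gradient (F n) x + t *\<^sub>R gradient (E n) x)" for n
    unfolding D_def using gradient_add[OF *(4) test_functions_cmult[OF **(4)]] gradient_cmult[OF **(4)] by auto
  have z: "(\<lambda>n. 2 powr p * (X n + \<bar>t\<bar> powr p * Y n)) \<longlonglongrightarrow> 0" if "X \<longlonglongrightarrow> 0" "Y \<longlonglongrightarrow> 0" for X Y :: "nat \<Rightarrow> real"
  proof -
    have "(\<lambda>n. 2 powr p * (X n + \<bar>t\<bar> powr p * Y n)) \<longlonglongrightarrow> 2 powr p * (0 + \<bar>t\<bar> powr p * 0)"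
      by (intro tendsto_intros that)
    then show ?thesis by simp
  qed
  have "(\<lambda>n. pdist L p (D n) (\<lambda>x. u x + t * v x)) \<longlonglongrightarrow> 0"
    using pdist_add_scaleR[OF p0(1) test_function_Lp(1)[OF *(4) p0(2)] test_function_Lp(1)[OF **(4) p0(2)] *(1) **(1)]
    by (intro tendsto_sandwich[OF _ _ tendsto_const z[OF *(5) **(5)]]) (auto simp: D_def)
  moreover have "(\<lambda>n. pdist L p (gradient (D n)) (\<lambda>x. G x + t *\<^sub>R H x)) \<longlonglongrightarrow> 0"
    using pdist_add_scaleR[OF p0(1) test_function_Lp(2)[OF *(4) p0(2)] test_function_Lp(2)[OF **(4) p0(2)] *(2) **(2)]
    by (intro tendsto_sandwich[OF _ _ tendsto_const z[OF *(6) **(6)]]) (auto simp: gD)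
  moreover have "(\<lambda>x. u x + t * v x) \<in> Lp_space L p" "(\<lambda>x. G x + t *\<^sub>R H x) \<in> Lp_space L p"
    by (intro Lp_space_add Lp_space_cmult Lp_space_scaleR * ** p0)+
  moreover have "is_weak_gradient \<Omega> (\<lambda>x. u x + t * v x) (\<lambda>x. G x + t *\<^sub>R H x)"
    by (rule is_weak_gradient_add_scaleR[OF *(3) **(3)])
  ultimately show ?thesis using D unfolding sobolev_pair_def by blast
qed

lemma sobolev_pair_test_function:
  assumes f: "f \<in> test_functions \<Omega>" and p: "0 < p"
  shows "sobolev_pair p f (gradient f)"
  unfolding sobolev_pair_def
  using test_function_Lp[OF f p] test_function_weak_gradient[OF open_\<Omega> f] f p
  by (auto intro!: exI[of _ "\<lambda>_. f"] simp: pdist_def)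

text \<open>The Sobolev inequality for differences makes the approximating sequence Cauchy in L^r.
  Its limit there is also its limit in L^p, since the measure is finite, and so agrees with u almost
  everywhere.\<close>

lemma sobolev_pair_embedding:
  assumes u: "sobolev_pair p u G" and p: "1 < p" "p \<le> r" and N: "0 < r - real DIM('a) * (r - p) / p"
  shows "u \<in> Lp_space L r"
    and "\<exists>F. (\<forall>n. F n \<in> test_functions \<Omega>) \<and> (\<lambda>n. pdist L r (F n) u) \<longlonglongrightarrow> 0 \<and>
       (\<lambda>n. pdist L p (gradient (F n)) G) \<longlonglongrightarrow> 0"
proof -
  obtain F where *: "u \<in> Lp_space L p" "G \<in> Lp_space L p"
    "\<And>n. F n \<in> test_functions \<Omega>" "(\<lambda>n. pdist L p (F n) u) \<longlonglongrightarrow> 0"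
    "(\<lambda>n. pdist L p (gradient (F n)) G) \<longlonglongrightarrow> 0"
    using u by (auto simp: sobolev_pair_def)
  have p0: "0 \<le> p" "0 < p" "1 \<le> p" "0 < r" "0 \<le> r" using p by auto
  note FL = test_function_Lp[OF *(3)]
  obtain C where C: "0 \<le> C" "\<And>\<Omega> f. f \<in> test_functions (\<Omega> :: 'a set) \<Longrightarrow> (\<integral>x. \<bar>f x\<bar> powr r \<partial>lborel) \<le>
      C * ((\<integral>x. \<bar>f x\<bar> powr p \<partial>lborel) powr (r / p) + (\<integral>x. norm (gradient f x) powr p \<partial>lborel) powr (r / p))"
    by (rule Sobolev_test_functions[OF p0(3) p(2) N]) blast
  have S: "pdist L r (F m) (F n) \<le> C * (pdist L p (F m) (F n) powr (r / p) +
      pdist L p (gradient (F m)) (gradient (F n)) powr (r / p))" for m n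
  proof -
    have t: "(\<lambda>x. F m x - F n x) \<in> test_functions \<Omega>" by (intro test_functions_diff *)
    show ?thesis using C(2)[OF t, folded test_function_integral_L(2)[OF t p0(4)]
      test_function_integral_L(2)[OF t p0(2)] test_function_integral_L(4)[OF t p0(2)]]
      unfolding gradient_diff[OF *(3) *(3)] pdist_def .
  qed
  have "\<exists>N. \<forall>m\<ge>N. \<forall>n\<ge>N. (\<integral>x. norm (F m x - F n x) powr r \<partial>L) < e" if e: "e > 0" for e
  proof -
    \<comment> \<open>Chosen so that (C + 1) times 2 d^(r/p) equals e.\<close>
    define d where "d = (e / (2 * (C + 1))) powr (p / r)"
    have d: "d > 0" using e C by (simp add: d_def)
    have dr: "d powr (r / p) = e / (2 * (C + 1))" using p e C by (simp add: d_def powr_powr)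
    obtain N1 where N1: "\<And>m n. m \<ge> N1 \<Longrightarrow> n \<ge> N1 \<Longrightarrow> pdist L p (F m) (F n) < d"
      using pdist_Cauchy[OF p0(1) FL(1)[OF p0(2)] *(1,4) d] by blast
    obtain N2 where N2: "\<And>m n. m \<ge> N2 \<Longrightarrow> n \<ge> N2 \<Longrightarrow> pdist L p (gradient (F m)) (gradient (F n)) < d"
      using pdist_Cauchy[OF p0(1) FL(2)[OF p0(2)] *(2,5) d] by blast
    have "pdist L r (F m) (F n) < e" if mn: "m \<ge> max N1 N2" "n \<ge> max N1 N2" for m n
    proof -
      have "pdist L r (F m) (F n) \<le> C * (d powr (r / p) + d powr (r / p))"
        using N1[of m n] N2[of m n] mn C(1) p
        by (intro order_trans[OF S] mult_left_mono add_mono powr_mono2) auto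
      also have "\<dots> < (C + 1) * (d powr (r / p) + d powr (r / p))"
        using d by (intro mult_strict_right_mono) auto
      also have "\<dots> = e"
      proof -
        have "x * (e / (2 * x) + e / (2 * x)) = e" if "x > 0" for x using that by (simp add: field_simps)
        from this[of "C + 1"] show ?thesis unfolding dr using C(1) by linarith
      qed
      finally show ?thesis .
    qed
    then show ?thesis unfolding pdist_def by blast
  qed
  from Lp_complete[OF p0(4) FL(1)[OF p0(4)] this]
  obtain v where v: "v \<in> Lp_space L r" "(\<lambda>n. pdist L r (F n) v) \<longlonglongrightarrow> 0" unfolding pdist_def by blast
  have "(\<lambda>n. pdist L p (F n) v) \<longlonglongrightarrow> 0"
    by (rule pdist_tendsto_mono[OF p0(2) p(2) FL(1)[OF p0(4)] v])
  then have ae: "AE x in L. v x = u x"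
    by (rule pdist_limit_unique[where F = F, OF p0(1) FL(1)[OF p0(2)]
      Lp_space_mono[OF v(1) p0(2) p(2)] *(1) _ *(4)])
  have um: "u \<in> borel_measurable L" using *(1) by (rule Lp_space_measurable)
  show ur: "u \<in> Lp_space L r" by (rule Lp_space_cong_AE[OF v(1) p0(5) um ae])
  have "pdist L r (F n) u = pdist L r (F n) v" for n unfolding pdist_def
    using Lp_space_measurable[OF FL(1)[OF p0(2), of n]] Lp_space_measurable[OF v(1)] um ae
    by (intro integral_cong_AE) (auto elim!: eventually_mono)
  then show "\<exists>F. (\<forall>n. F n \<in> test_functions \<Omega>) \<and> (\<lambda>n. pdist L r (F n) u) \<longlonglongrightarrow> 0 \<and>
       (\<lambda>n. pdist L p (gradient (F n)) G) \<longlonglongrightarrow> 0"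
    using v(2) *(3,5) by (intro exI[of _ F]) auto
qed

end

section \<open>The energy functional\<close>

lemma integral_tendsto_pdist:
  fixes f :: "'a \<Rightarrow> 'b::{banach, second_countable_topology}" and h :: "'a \<Rightarrow> 'c::{banach, second_countable_topology}"
  assumes F: "\<And>n. F n \<in> Lp_space M 1" "f \<in> Lp_space M 1" "(\<lambda>n. pdist M 1 (F n) f) \<longlonglongrightarrow> 0"
    and h: "\<And>n. integrable M (H n)" "integrable M h" "\<And>n x. norm (H n x - h x) \<le> B * norm (F n x - f x)"
  shows "(\<lambda>n. \<integral>x. H n x \<partial>M) \<longlonglongrightarrow> (\<integral>x. h x \<partial>M)"
proof (rule LIM_zero_cancel, rule Lim_null_comparison)
  show "\<forall>\<^sub>F n in sequentially. norm ((\<integral>x. H n x \<partial>M) - (\<integral>x. h x \<partial>M)) \<le> B * pdist M 1 (F n) f"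
  proof (intro always_eventually allI)
    fix n
    have "(\<lambda>x. F n x - f x) \<in> Lp_space M 1" using F by (intro Lp_space_diff) auto
    from Lp_space_integrable[OF this] have i: "integrable M (\<lambda>x. norm (F n x - f x))" by simp
    have "norm ((\<integral>x. H n x \<partial>M) - (\<integral>x. h x \<partial>M)) = norm (\<integral>x. H n x - h x \<partial>M)" using h by simp
    also have "\<dots> \<le> (\<integral>x. norm (H n x - h x) \<partial>M)" by (rule integral_norm_bound)
    also have "\<dots> \<le> (\<integral>x. B * norm (F n x - f x) \<partial>M)" using i h by (intro integral_mono) auto
    also have "\<dots> = B * pdist M 1 (F n) f" by (simp add: pdist_def)
    finally show "norm ((\<integral>x. H n x \<partial>M) - (\<integral>x. h x \<partial>M)) \<le> B * pdist M 1 (F n) f" .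
  qed
  show "(\<lambda>n. B * pdist M 1 (F n) f) \<longlonglongrightarrow> 0" using tendsto_mult_right_zero[OF F(3)] .
qed

lemma pdist_uniformly_convex:
  fixes p \<eta> :: real
  assumes p: "1 < p" and \<eta>: "0 < \<eta>"
  obtains C where "0 \<le> C" "\<And>M (f :: 'a \<Rightarrow> 'b::euclidean_space) g. f \<in> Lp_space M p \<Longrightarrow> g \<in> Lp_space M p \<Longrightarrow>
    pdist M p f g \<le> \<eta> * ((\<integral>x. norm (f x) powr p \<partial>M) + (\<integral>x. norm (g x) powr p \<partial>M)) +
    C * (((\<integral>x. norm (f x) powr p \<partial>M) + (\<integral>x. norm (g x) powr p \<partial>M)) / 2 -
      (\<integral>x. norm ((1/2) *\<^sub>R (f x + g x)) powr p \<partial>M))"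
proof -
  obtain C where C: "0 \<le> C" "\<And>x y :: 'b. norm (x - y) powr p \<le> \<eta> * (norm x powr p + norm y powr p) +
    C * ((norm x powr p + norm y powr p) / 2 - norm ((1/2) *\<^sub>R (x + y)) powr p)"
    by (rule norm_powr_uniformly_convex[OF p \<eta>, where 'a = 'b]) blast
  have "pdist M p f g \<le> \<eta> * ((\<integral>x. norm (f x) powr p \<partial>M) + (\<integral>x. norm (g x) powr p \<partial>M)) +
    C * (((\<integral>x. norm (f x) powr p \<partial>M) + (\<integral>x. norm (g x) powr p \<partial>M)) / 2 -
      (\<integral>x. norm ((1/2) *\<^sub>R (f x + g x)) powr p \<partial>M))"
    if L: "f \<in> Lp_space M p" "g \<in> Lp_space M p" for M :: "'a measure" and f g :: "'a \<Rightarrow> 'b"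
  proof -
    have p0: "0 \<le> p" using p by simp
    have i: "integrable M (\<lambda>x. norm (f x - g x) powr p)" "integrable M (\<lambda>x. norm (f x) powr p)"
      "integrable M (\<lambda>x. norm (g x) powr p)" "integrable M (\<lambda>x. norm ((1/2) *\<^sub>R (f x + g x)) powr p)"
      by (intro Lp_space_integrable Lp_space_diff Lp_space_scaleR Lp_space_add L p0)+
    have "pdist M p f g \<le> (\<integral>x. \<eta> * (norm (f x) powr p + norm (g x) powr p) +
        C * ((norm (f x) powr p + norm (g x) powr p) / 2 - norm ((1/2) *\<^sub>R (f x + g x)) powr p) \<partial>M)"
      unfolding pdist_def
      by (intro integral_mono C(2) Bochner_Integration.integrable_add Bochner_Integration.integrable_diff
          integrable_mult_right integrable_divide i)
    also have "\<dots> = \<eta> * ((\<integral>x. norm (f x) powr p \<partial>M) + (\<integral>x. norm (g x) powr p \<partial>M)) +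
      C * (((\<integral>x. norm (f x) powr p \<partial>M) + (\<integral>x. norm (g x) powr p \<partial>M)) / 2 -
        (\<integral>x. norm ((1/2) *\<^sub>R (f x + g x)) powr p \<partial>M))"
      using i by (simp only: Bochner_Integration.integral_add Bochner_Integration.integral_diff
        Bochner_Integration.integrable_add Bochner_Integration.integrable_diff integrable_mult_right
        integrable_divide integral_mult_right_zero integral_divide_zero)
    finally show ?thesis .
  qed
  with C(1) show thesis by (rule that)
qed

text \<open>\<open>subcritical\<close> is \<gamma> < p^* with the denominator cleared, which covers
  both cases in the definition of the critical exponent.\<close>

locale subcritical_problem = bounded_open \<Omega> for \<Omega> :: "'a::euclidean_space set" +
  fixes p q \<gamma> K \<sigma>\<^sub>a \<sigma>\<^sub>b :: real and a b :: "'a \<Rightarrow> real"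
  assumes p: "1 < p" "p < q" "q < \<gamma>" and subcritical: "0 < \<gamma> - real DIM('a) * (\<gamma> - p) / p"
    and a: "a \<in> borel_measurable (lebesgue_on \<Omega>)" "AE x in lebesgue_on \<Omega>. \<bar>a x\<bar> \<le> K"
      "0 < \<sigma>\<^sub>a" "AE x in lebesgue_on \<Omega>. \<sigma>\<^sub>a \<le> a x"
    and b: "b \<in> borel_measurable (lebesgue_on \<Omega>)" "AE x in lebesgue_on \<Omega>. \<bar>b x\<bar> \<le> K"
      "0 < \<sigma>\<^sub>b" "AE x in lebesgue_on \<Omega>. \<sigma>\<^sub>b \<le> b x"
begin

lemma exponents_pos: "0 < p" "0 < q" "0 < \<gamma>" "1 \<le> p" "p \<le> \<gamma>" "q \<le> \<gamma>" "1 < q" "1 < \<gamma>" "0 \<le> \<gamma>" "0 \<le> p"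
  using p by auto

definition potential :: "('a \<Rightarrow> real) \<Rightarrow> real" where
  "potential v = 1 / \<gamma> * (\<integral>x. b x * norm (v x) powr \<gamma> \<partial>L) - 1 / q * (\<integral>x. a x * norm (v x) powr q \<partial>L)"

definition pair_energy :: "real \<Rightarrow> ('a \<Rightarrow> real) \<Rightarrow> ('a \<Rightarrow> 'a) \<Rightarrow> real" where
  "pair_energy \<epsilon> u G = \<epsilon> / p * (\<integral>x. norm (G x) powr p \<partial>L) + potential u"

lemma energy_eq_pair_energy:
  assumes "is_weak_gradient \<Omega> u G"
  shows "energy \<Omega> p q \<gamma> a b \<epsilon> u = pair_energy \<epsilon> u G"
  unfolding energy_def pair_energy_def potential_def weak_grad_integral[OF assms] by simp

lemma integrable_a: "v \<in> Lp_space L \<gamma> \<Longrightarrow> integrable L (\<lambda>x. a x * norm (v x) powr q)"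
  and integrable_b: "v \<in> Lp_space L \<gamma> \<Longrightarrow> integrable L (\<lambda>x. b x * norm (v x) powr \<gamma>)"
  for v :: "'a \<Rightarrow> real"
  using integrable_bounded_mult_powr[OF _ a(1,2)] integrable_bounded_mult_powr[OF _ b(1,2)]
    Lp_space_mono[OF _ exponents_pos(2,6)] by blast+

lemma potential_continuous:
  assumes u: "u \<in> Lp_space L \<gamma>" and e: "0 < e"
  obtains d where "0 < d" "\<And>v. v \<in> Lp_space L \<gamma> \<Longrightarrow> pdist L \<gamma> v u < d \<Longrightarrow> \<bar>potential v - potential u\<bar> < e"
proof -
  note P = exponents_pos
  have uq: "u \<in> Lp_space L q" using Lp_space_mono[OF u P(2,6)] .
  have e1: "e * \<gamma> / 2 > 0" and e2: "e * q / 2 > 0" using e P by auto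
  obtain d1 where d1: "0 < d1" "\<And>v. v \<in> Lp_space L \<gamma> \<Longrightarrow> (\<integral>x. norm (v x - u x) powr \<gamma> \<partial>L) < d1 \<Longrightarrow>
    \<bar>(\<integral>x. b x * norm (v x) powr \<gamma> \<partial>L) - (\<integral>x. b x * norm (u x) powr \<gamma> \<partial>L)\<bar> < e * \<gamma> / 2"
    using Lp_powr_integral_continuous[OF P(3) u b(1,2) e1] by blast
  obtain d2 where d2: "0 < d2" "\<And>v. v \<in> Lp_space L q \<Longrightarrow> (\<integral>x. norm (v x - u x) powr q \<partial>L) < d2 \<Longrightarrow>
    \<bar>(\<integral>x. a x * norm (v x) powr q \<partial>L) - (\<integral>x. a x * norm (u x) powr q \<partial>L)\<bar> < e * q / 2"
    using Lp_powr_integral_continuous[OF P(2) uq a(1,2) e2] by blast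
  obtain d3 where d3: "0 < d3" "\<And>f :: 'a \<Rightarrow> real. f \<in> Lp_space L \<gamma> \<Longrightarrow>
      (\<integral>x. norm (f x) powr \<gamma> \<partial>L) < d3 \<Longrightarrow> (\<integral>x. norm (f x) powr q \<partial>L) < d2"
    using Lp_small_exponent[OF P(2,6) d2(1)] by blast
  show thesis
  proof (rule that[of "min d1 d3"])
    fix v assume v: "v \<in> Lp_space L \<gamma>" "pdist L \<gamma> v u < min d1 d3"
    have vu: "(\<lambda>x. v x - u x) \<in> Lp_space L \<gamma>" using P v u by (intro Lp_space_diff) auto
    have "\<bar>(\<integral>x. b x * norm (v x) powr \<gamma> \<partial>L) - (\<integral>x. b x * norm (u x) powr \<gamma> \<partial>L)\<bar> < e * \<gamma> / 2"
      using v by (intro d1(2)) (auto simp: pdist_def)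
    then have X: "1 / \<gamma> * \<bar>(\<integral>x. b x * norm (v x) powr \<gamma> \<partial>L) - (\<integral>x. b x * norm (u x) powr \<gamma> \<partial>L)\<bar> < e / 2"
      using P(3) by (simp add: field_simps)
    have "(\<integral>x. norm (v x - u x) powr q \<partial>L) < d2"
      using v by (intro d3(2) vu) (auto simp: pdist_def)
    then have "\<bar>(\<integral>x. a x * norm (v x) powr q \<partial>L) - (\<integral>x. a x * norm (u x) powr q \<partial>L)\<bar> < e * q / 2"
      using Lp_space_mono[OF v(1) P(2,6)] by (intro d2(2))
    then have Y: "1 / q * \<bar>(\<integral>x. a x * norm (v x) powr q \<partial>L) - (\<integral>x. a x * norm (u x) powr q \<partial>L)\<bar> < e / 2"
      using P(2) by (simp add: field_simps)
    have eq: "potential v - potential u =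
        1 / \<gamma> * ((\<integral>x. b x * norm (v x) powr \<gamma> \<partial>L) - (\<integral>x. b x * norm (u x) powr \<gamma> \<partial>L)) -
        1 / q * ((\<integral>x. a x * norm (v x) powr q \<partial>L) - (\<integral>x. a x * norm (u x) powr q \<partial>L))"
      by (simp add: potential_def right_diff_distrib)
    have XY: "\<bar>1 / \<gamma> * X - 1 / q * Y\<bar> < e" if "1 / \<gamma> * \<bar>X\<bar> < e / 2" "1 / q * \<bar>Y\<bar> < e / 2" for X Y
    proof -
      have "\<bar>1 / \<gamma> * X\<bar> = 1 / \<gamma> * \<bar>X\<bar>" "\<bar>1 / q * Y\<bar> = 1 / q * \<bar>Y\<bar>" using P by (simp_all add: abs_mult)
      then show ?thesis using abs_triangle_ineq4[of "1 / \<gamma> * X" "1 / q * Y"] that by linarith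
    qed
    show "\<bar>potential v - potential u\<bar> < e" unfolding eq by (rule XY[OF X Y])
  qed (use d1 d3 in auto)
qed

lemma potential_tendsto:
  assumes "u \<in> Lp_space L \<gamma>" "\<And>n. F n \<in> Lp_space L \<gamma>" "(\<lambda>n. pdist L \<gamma> (F n) u) \<longlonglongrightarrow> 0"
  shows "(\<lambda>n. potential (F n)) \<longlonglongrightarrow> potential u"
proof (rule pdist_small_imp_tendsto[OF _ assms(3)])
  fix e :: real assume "0 < e"
  from potential_continuous[OF assms(1) this] obtain d where "0 < d"
    "\<And>v. v \<in> Lp_space L \<gamma> \<Longrightarrow> pdist L \<gamma> v u < d \<Longrightarrow> \<bar>potential v - potential u\<bar> < e" by blast
  then show "\<exists>d>0. \<forall>n. pdist L \<gamma> (F n) u < d \<longrightarrow> \<bar>potential (F n) - potential u\<bar> < e"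
    using assms(2) by blast
qed

text \<open>Half of the \<gamma>-term absorbs the q-term up to a constant, because q < \<gamma>, b
  is bounded below and a is bounded above.\<close>

lemma potential_coercive:
  obtains k C where "0 < k" "\<And>v. v \<in> Lp_space L \<gamma> \<Longrightarrow> k * (\<integral>x. norm (v x) powr \<gamma> \<partial>L) - C \<le> potential v"
proof -
  note P = exponents_pos
  define A where "A = max 1 K"
  have A: "A \<ge> 1" by (simp add: A_def)
  \<comment> \<open>This c satisfies A c / q = k, half of the coefficient
    \<open>\<sigma>\<^sub>b / \<gamma>\<close> available from the lower bound on b. The \<eta> below
    is then the value for which \<open>powr_le_eta_powr\<close> has coefficient exactly c.\<close>
  define c where "c = \<sigma>\<^sub>b * q / (2 * \<gamma> * A)"
  have c: "c > 0" using b(3) P A by (simp add: c_def)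
  define \<eta> where "\<eta> = c powr (q / (q - \<gamma>))"
  have \<eta>: "\<eta> > 0" using c by (simp add: \<eta>_def)
  have "\<eta> powr ((q - \<gamma>) / q) = c" using c P p by (simp add: \<eta>_def powr_powr)
  then have pt: "s powr q \<le> \<eta> + c * s powr \<gamma>" if "0 \<le> s" for s
    using powr_le_eta_powr[OF P(2,6) \<eta> that] by simp
  define k where "k = \<sigma>\<^sub>b / (2 * \<gamma>)"
  define V where "V = measure L (space L)"
  have k: "k > 0" using b(3) P by (simp add: k_def)
  have "k * (\<integral>x. norm (v x) powr \<gamma> \<partial>L) - A / q * \<eta> * V \<le> potential v" if v: "v \<in> Lp_space L \<gamma>" for v
  proof -
    have i: "integrable L (\<lambda>x. norm (v x) powr \<gamma>)" using v by (rule Lp_space_integrable)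
    have "(\<integral>x. k * norm (v x) powr \<gamma> - A / q * \<eta> \<partial>L) \<le>
        (\<integral>x. 1 / \<gamma> * (b x * norm (v x) powr \<gamma>) - 1 / q * (a x * norm (v x) powr q) \<partial>L)"
    proof (rule integral_mono_AE)
      show "AE x in L. k * norm (v x) powr \<gamma> - A / q * \<eta> \<le>
          1 / \<gamma> * (b x * norm (v x) powr \<gamma>) - 1 / q * (a x * norm (v x) powr q)"
        using a(2) b(4)
      proof eventually_elim
        case (elim x)
        have "a x \<le> A" using elim by (auto simp: A_def)
        then have "a x * norm (v x) powr q \<le> A * norm (v x) powr q" by (rule mult_right_mono) simp
        also have "\<dots> \<le> A * (\<eta> + c * norm (v x) powr \<gamma>)"
          using A by (intro mult_left_mono pt) auto
        finally have "a x * norm (v x) powr q \<le> A * (\<eta> + c * norm (v x) powr \<gamma>)" .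
        then have "1 / q * (a x * norm (v x) powr q) \<le> 1 / q * (A * (\<eta> + c * norm (v x) powr \<gamma>))"
          using P by (intro mult_left_mono) auto
        also have "\<dots> = A / q * \<eta> + k * norm (v x) powr \<gamma>"
        proof -
          have "1 / q * (A * c) = k" using P A by (simp add: c_def k_def)
          then show ?thesis by (simp add: distrib_left flip: mult.assoc)
        qed
        finally have 1: "1 / q * (a x * norm (v x) powr q) \<le> A / q * \<eta> + k * norm (v x) powr \<gamma>" .
        have "1 / \<gamma> * (\<sigma>\<^sub>b * norm (v x) powr \<gamma>) \<le> 1 / \<gamma> * (b x * norm (v x) powr \<gamma>)"
          using elim P by (intro mult_left_mono mult_right_mono) auto
        moreover have "1 / \<gamma> * (\<sigma>\<^sub>b * norm (v x) powr \<gamma>) = 2 * (k * norm (v x) powr \<gamma>)" by (simp add: k_def)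
        ultimately show ?case using 1 by linarith
      qed
    qed (use i integrable_a[OF v] integrable_b[OF v] in auto)
    then show ?thesis using i integrable_a[OF v] integrable_b[OF v]
      by (simp add: potential_def V_def mult_ac)
  qed
  with k show thesis by (rule that)
qed

lemma sobolev_pair_Lp: "sobolev_pair p u G \<Longrightarrow> u \<in> Lp_space L \<gamma>"
  using sobolev_pair_embedding(1) p subcritical by auto

text \<open>Test functions are dense in energy, so a bound for all of them holds on the whole of
  W_0^{1,p}.\<close>

lemma pair_energy_approx:
  assumes u: "sobolev_pair p u G"
  obtains F where "\<And>n. F n \<in> test_functions \<Omega>" "(\<lambda>n. pair_energy \<epsilon> (F n) (gradient (F n))) \<longlonglongrightarrow> pair_energy \<epsilon> u G"
proof -
  note P = exponents_pos
  obtain F where F: "\<And>n. F n \<in> test_functions \<Omega>" "(\<lambda>n. pdist L \<gamma> (F n) u) \<longlonglongrightarrow> 0"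
    "(\<lambda>n. pdist L p (gradient (F n)) G) \<longlonglongrightarrow> 0"
    using sobolev_pair_embedding(2)[OF u p(1) P(5) subcritical] by blast
  have G: "G \<in> Lp_space L p" using u by (simp add: sobolev_pair_def)
  have "(\<lambda>n. \<integral>x. 1 * norm (gradient (F n) x) powr p \<partial>L) \<longlonglongrightarrow> (\<integral>x. 1 * norm (G x) powr p \<partial>L)"
    by (rule Lp_powr_integral_tendsto[OF P(1) test_function_Lp(2)[OF F(1) P(1)] G _ _ F(3), where K = 1]) auto
  moreover have "(\<lambda>n. potential (F n)) \<longlonglongrightarrow> potential u"
    by (rule potential_tendsto[OF sobolev_pair_Lp[OF u] test_function_Lp(1)[OF F(1) P(3)] F(2)])
  ultimately have "(\<lambda>n. pair_energy \<epsilon> (F n) (gradient (F n))) \<longlonglongrightarrow> pair_energy \<epsilon> u G"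
    unfolding pair_energy_def by (intro tendsto_intros) simp_all
  with F(1) show thesis by (rule that)
qed

text \<open>Both convergences are weakened to L^1, where they can be paired with a bounded test
  function and its bounded gradient. The integration by parts formula then passes to the
  limit.\<close>

lemma sobolev_pair_limit:
  assumes F: "\<And>n. F n \<in> test_functions \<Omega>" and u: "u \<in> Lp_space L \<gamma>" "(\<lambda>n. pdist L \<gamma> (F n) u) \<longlonglongrightarrow> 0"
    and G: "G \<in> Lp_space L p" "(\<lambda>n. pdist L p (gradient (F n)) G) \<longlonglongrightarrow> 0"
  shows "sobolev_pair p u G"
proof -
  note P = exponents_pos
  have z1: "(0::real) < 1" "1 \<le> \<gamma>" "1 \<le> p" using P by auto
  have up: "u \<in> Lp_space L p" using Lp_space_mono[OF u(1) P(1,5)] .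
  have u1: "u \<in> Lp_space L 1" using Lp_space_mono[OF u(1) z1(1,2)] .
  have G1: "G \<in> Lp_space L 1" using Lp_space_mono[OF G(1) z1(1,3)] .
  have limp: "(\<lambda>n. pdist L p (F n) u) \<longlonglongrightarrow> 0"
    by (rule pdist_tendsto_mono[OF P(1,5) test_function_Lp(1)[OF F P(3)] u])
  have lim1: "(\<lambda>n. pdist L 1 (F n) u) \<longlonglongrightarrow> 0"
    by (rule pdist_tendsto_mono[OF z1(1,2) test_function_Lp(1)[OF F P(3)] u])
  have limG1: "(\<lambda>n. pdist L 1 (gradient (F n)) G) \<longlonglongrightarrow> 0"
    by (rule pdist_tendsto_mono[OF z1(1,3) test_function_Lp(2)[OF F P(1)] G])
  have li: "locally_integrable \<Omega> u" "locally_integrable \<Omega> G"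
    using Lp_locally_integrable(1)[OF u1] Lp_locally_integrable(1)[OF G1] by auto
  have "(\<integral>x. u x *\<^sub>R gradient g x \<partial>L) = - (\<integral>x. g x *\<^sub>R G x \<partial>L)" if g: "g \<in> test_functions \<Omega>" for g
  proof -
    obtain B where B: "\<And>x. \<bar>g x\<bar> \<le> B" "\<And>x. norm (gradient g x) \<le> B"
      using g by (rule test_function_bounded) blast
    have wF: "is_weak_gradient \<Omega> (F n) (gradient (F n))" for n
      by (rule test_function_weak_gradient[OF open_\<Omega> F])
    then have liF: "locally_integrable \<Omega> (F n)" "locally_integrable \<Omega> (gradient (F n))" for n
      by (auto simp: is_weak_gradient_def)
    have "(\<lambda>n. \<integral>x. F n x *\<^sub>R gradient g x \<partial>L) \<longlonglongrightarrow> (\<integral>x. u x *\<^sub>R gradient g x \<partial>L)"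
    proof (rule integral_tendsto_pdist[OF test_function_Lp(1)[OF F z1(1)] u1 lim1, where B = B])
      show "norm (F n x *\<^sub>R gradient g x - u x *\<^sub>R gradient g x) \<le> B * norm (F n x - u x)" for n x
        using mult_left_mono[OF B(2)[of x], of "\<bar>F n x - u x\<bar>"]
        by (simp flip: scaleR_diff_left add: mult.commute)
    qed (intro integrable_mult_gradient liF li g)+
    moreover have "(\<lambda>n. \<integral>x. g x *\<^sub>R gradient (F n) x \<partial>L) \<longlonglongrightarrow> (\<integral>x. g x *\<^sub>R G x \<partial>L)"
    proof (rule integral_tendsto_pdist[OF test_function_Lp(2)[OF F z1(1)] G1 limG1, where B = B])
      show "norm (g x *\<^sub>R gradient (F n) x - g x *\<^sub>R G x) \<le> B * norm (gradient (F n) x - G x)" for n x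
        using mult_right_mono[OF B(1)[of x], of "norm (gradient (F n) x - G x)"]
        by (simp flip: scaleR_diff_right)
    qed (intro locally_integrable_mult_test[OF open_\<Omega>] liF li g)+
    then have "(\<lambda>n. - (\<integral>x. g x *\<^sub>R gradient (F n) x \<partial>L)) \<longlonglongrightarrow> - (\<integral>x. g x *\<^sub>R G x \<partial>L)"
      by (rule tendsto_minus)
    moreover have "(\<integral>x. F n x *\<^sub>R gradient g x \<partial>L) = - (\<integral>x. g x *\<^sub>R gradient (F n) x \<partial>L)" for n
      using wF g by (simp add: is_weak_gradient_def)
    ultimately show ?thesis using LIMSEQ_unique by simp
  qed
  then have "is_weak_gradient \<Omega> u G" using li by (simp add: is_weak_gradient_def)
  then show ?thesis using up G F limp unfolding sobolev_pair_def by blast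
qed

text \<open>No weak compactness is needed: midpoints of a minimizing sequence are almost minimizing as
  well, so uniform convexity makes the gradients a Cauchy sequence.\<close>

lemma energy_minimizer_exists:
  assumes \<epsilon>: "0 < \<epsilon>"
  obtains u G where "sobolev_pair p u G" "\<And>w H. sobolev_pair p w H \<Longrightarrow> pair_energy \<epsilon> u G \<le> pair_energy \<epsilon> w H"
proof -
  note P = exponents_pos
  define J where "J = (\<lambda>f. pair_energy \<epsilon> f (gradient f))"
  define D where "D = (\<lambda>f. \<integral>x. norm (gradient f x) powr p \<partial>L)"
  have J: "J f = \<epsilon> / p * D f + potential f" for f by (simp add: J_def D_def pair_energy_def)
  have D0: "D f \<ge> 0" for f by (simp add: D_def)
  have \<epsilon>p: "\<epsilon> / p > 0" using \<epsilon> P by simp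
  obtain k C where k: "0 < k" "\<And>v. v \<in> Lp_space L \<gamma> \<Longrightarrow> k * (\<integral>x. norm (v x) powr \<gamma> \<partial>L) - C \<le> potential v"
    using potential_coercive by blast
  have low: "\<epsilon> / p * D f + k * (\<integral>x. norm (f x) powr \<gamma> \<partial>L) - C \<le> J f" if "f \<in> test_functions \<Omega>" for f
    using k(2)[OF test_function_Lp(1)[OF that P(3)]] by (simp add: J)
  \<comment> \<open>The minimizing sequence is taken among test functions, for which the Rellich
    lemma is available; density in energy extends the comparison to all pairs at the end.\<close>
  define I where "I = (INF f\<in>test_functions \<Omega>. J f)"
  have bdd: "bdd_below (J ` test_functions \<Omega>)"
  proof (rule bdd_belowI2)
    fix f assume f: "f \<in> test_functions \<Omega>"
    have "0 \<le> \<epsilon> / p * D f" by (rule mult_nonneg_nonneg[OF less_imp_le[OF \<epsilon>p] D0])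
    moreover have "0 \<le> k * (\<integral>x. norm (f x) powr \<gamma> \<partial>L)" using k(1) by simp
    ultimately show "- C \<le> J f" using low[OF f] by linarith
  qed
  have I_le: "I \<le> J f" if "f \<in> test_functions \<Omega>" for f
    unfolding I_def using bdd that by (rule cINF_lower)
  have "\<exists>f\<in>test_functions \<Omega>. J f < I + 1 / (real n + 1)" for n
  proof -
    have "I < I + 1 / (real n + 1)" by simp
    then show ?thesis unfolding I_def using bdd test_functions_0 by (subst (asm) cINF_less_iff) auto
  qed
  then obtain f where f: "\<And>n. f n \<in> test_functions \<Omega>" "\<And>n. J (f n) < I + 1 / (real n + 1)" by metis
  define V where "V = measure L (space L)"
  \<comment> \<open>One bound for both integrals that the Rellich lemma asks for. The first entry
    comes from s^p <= 1 + s^\<gamma>, where the 1 integrates to V; the second bounds the Dirichlet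
    integral.\<close>
  define B where "B = max (V + (I + 1 + C) / k) ((I + 1 + C) / (\<epsilon> / p))"
  have bounds: "\<epsilon> / p * D (f n) + k * (\<integral>x. norm (f n x) powr \<gamma> \<partial>L) \<le> I + 1 + C" for n
  proof -
    have "1 / (real n + 1) \<le> 1" by simp
    then show ?thesis using low[OF f(1)[of n]] f(2)[of n] by linarith
  qed
  have DB: "D (f n) \<le> B" for n
  proof -
    have "0 \<le> k * (\<integral>x. norm (f n x) powr \<gamma> \<partial>L)" using k(1) by simp
    then have "\<epsilon> / p * D (f n) \<le> I + 1 + C" using bounds[of n] by linarith
    then have "D (f n) \<le> (I + 1 + C) / (\<epsilon> / p)"
      unfolding pos_le_divide_eq[OF \<epsilon>p] by (simp only: mult.commute)
    then show ?thesis by (simp add: B_def)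
  qed
  have LB: "(\<integral>x. norm (f n x) powr p \<partial>L) \<le> B" for n
  proof -
    have "0 \<le> \<epsilon> / p * D (f n)" by (rule mult_nonneg_nonneg[OF less_imp_le[OF \<epsilon>p] D0])
    then have "k * (\<integral>x. norm (f n x) powr \<gamma> \<partial>L) \<le> I + 1 + C" using bounds[of n] by linarith
    then have 1: "(\<integral>x. norm (f n x) powr \<gamma> \<partial>L) \<le> (I + 1 + C) / k" using k(1) by (simp add: pos_le_divide_eq mult.commute)
    have "(\<integral>x. norm (f n x) powr p \<partial>L) \<le> (\<integral>x. 1 + norm (f n x) powr \<gamma> \<partial>L)"
    proof (rule integral_mono)
      show "norm (f n x) powr p \<le> 1 + norm (f n x) powr \<gamma>" for x
        using powr_le_eta_powr[OF P(1,5), of 1 "norm (f n x)"] by simp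
    qed (use test_function_integral_L(1)[OF f(1) P(1)] test_function_integral_L(1)[OF f(1) P(3)] in auto)
    also have "\<dots> = V + (\<integral>x. norm (f n x) powr \<gamma> \<partial>L)"
      using test_function_integral_L(1)[OF f(1) P(3)] by (simp add: V_def)
    finally show ?thesis using 1 by (simp add: B_def)
  qed
  have B0: "B \<ge> 0" using DB[of 0] D0[of "f 0"] by linarith
  obtain s :: "nat \<Rightarrow> nat" where s: "strict_mono s"
    "\<And>e. 0 < e \<Longrightarrow> \<exists>k. \<forall>i\<ge>k. \<forall>j\<ge>k. (\<integral>x. \<bar>f (s i) x - f (s j) x\<bar> powr \<gamma> \<partial>lborel) < e"
  proof (rule Rellich_test_functions[where F = f, OF P(4,5) subcritical bounded_\<Omega> f(1)])
    show "(\<integral>x. \<bar>f n x\<bar> powr p \<partial>lborel) \<le> B" for n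
      using LB[of n] test_function_integral_L(2)[OF f(1) P(1)] by simp
    show "(\<integral>x. norm (gradient (f n) x) powr p \<partial>lborel) \<le> B" for n
      using DB[of n] test_function_integral_L(4)[OF f(1) P(1)] by (simp add: D_def)
  qed blast
  define F where "F = (\<lambda>n. f (s n))"
  have F: "F n \<in> test_functions \<Omega>" for n by (simp add: F_def f)
  note FL = test_function_Lp(1)[OF F P(3)] test_function_Lp(2)[OF F P(1)]
  have cau: "\<exists>N. \<forall>m\<ge>N. \<forall>n\<ge>N. (\<integral>x. norm (F m x - F n x) powr \<gamma> \<partial>L) < e" if "e > 0" for e
    using s(2)[OF that] test_function_integral_L(2)[OF test_functions_diff[OF F F] P(3)] by (simp add: F_def)
  obtain u where u: "u \<in> Lp_space L \<gamma>" "(\<lambda>n. pdist L \<gamma> (F n) u) \<longlonglongrightarrow> 0"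
    using Lp_complete[OF P(3) FL(1) cau] unfolding pdist_def by blast
  have JF: "(\<lambda>n. J (F n)) \<longlonglongrightarrow> I"
  proof (rule tendsto_sandwich)
    show "\<forall>\<^sub>F n in sequentially. I \<le> J (F n)" using I_le[OF F] by simp
    show "\<forall>\<^sub>F n in sequentially. J (F n) \<le> I + 1 / (real n + 1)"
    proof (intro always_eventually allI)
      fix n
      have "1 / (real (s n) + 1) \<le> 1 / (real n + 1)"
        using strict_mono_imp_increasing[OF s(1), of n] by (simp add: frac_le)
      then show "J (F n) \<le> I + 1 / (real n + 1)" using f(2)[of "s n"] by (simp add: F_def)
    qed
    have "(\<lambda>n. 1 / (real n + 1)) \<longlonglongrightarrow> 0" using LIMSEQ_inverse_real_of_nat
      by (simp add: inverse_eq_divide add.commute)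
    from tendsto_add[OF tendsto_const[of I] this] show "(\<lambda>n. I + 1 / (real n + 1)) \<longlonglongrightarrow> I" by simp
  qed simp
  have TF: "(\<lambda>n. potential (F n)) \<longlonglongrightarrow> potential u" by (rule potential_tendsto[OF u(1) FL(1) u(2)])
  \<comment> \<open>The Dirichlet part has a known limit l before any limit of the gradients is
    known: the total energies tend to I and the potentials converge by strong compactness.\<close>
  define l where "l = I - potential u"
  have "(\<lambda>n. J (F n) - potential (F n)) \<longlonglongrightarrow> l" unfolding l_def by (rule tendsto_diff[OF JF TF])
  then have DF: "(\<lambda>n. \<epsilon> / p * D (F n)) \<longlonglongrightarrow> l" by (simp add: J)
  have Dcau: "\<exists>N. \<forall>m\<ge>N. \<forall>n\<ge>N. (\<integral>x. norm (gradient (F m) x - gradient (F n) x) powr p \<partial>L) < e"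
    if e: "e > 0" for e
  proof -
    \<comment> \<open>The sum S of two Dirichlet integrals is at most 2 B, so \<eta> S is at most e
      / 2.\<close>
    define \<eta> where "\<eta> = e / (4 * (B + 1))"
    have \<eta>: "\<eta> > 0" using e B0 by (simp add: \<eta>_def)
    obtain C' where C': "0 \<le> C'" "\<And>f g :: 'a \<Rightarrow> 'a. f \<in> Lp_space L p \<Longrightarrow> g \<in> Lp_space L p \<Longrightarrow>
      pdist L p f g \<le> \<eta> * ((\<integral>x. norm (f x) powr p \<partial>L) + (\<integral>x. norm (g x) powr p \<partial>L)) +
      C' * (((\<integral>x. norm (f x) powr p \<partial>L) + (\<integral>x. norm (g x) powr p \<partial>L)) / 2 -
        (\<integral>x. norm ((1/2) *\<^sub>R (f x + g x)) powr p \<partial>L))"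
      by (rule pdist_uniformly_convex[OF p(1) \<eta>, where 'a = 'a and 'b = 'a]) blast
    \<comment> \<open>An energy tolerance e' bounds the convexity gap by 2 e' / (\<epsilon> / p) = e
      / (2 (C' + 1)), which costs less than e / 2 after multiplication by C'.\<close>
    define e' where "e' = e * (\<epsilon> / p) / (4 * (C' + 1))"
    have e': "e' > 0" unfolding e'_def using e C'(1) by (intro divide_pos_pos mult_pos_pos \<epsilon>p) auto
    have "\<forall>\<^sub>F n in sequentially. \<epsilon> / p * D (F n) < l + e'" using DF e' by (intro order_tendstoD) auto
    then obtain N1 where N1: "\<And>n. n \<ge> N1 \<Longrightarrow> \<epsilon> / p * D (F n) < l + e'" by (auto simp: eventually_sequentially)
    obtain d where d: "0 < d" "\<And>v. v \<in> Lp_space L \<gamma> \<Longrightarrow> pdist L \<gamma> v u < d \<Longrightarrow> \<bar>potential v - potential u\<bar> < e'"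
      using potential_continuous[OF u(1) e'] by blast
    have "\<forall>\<^sub>F n in sequentially. pdist L \<gamma> (F n) u < d" using u(2) d(1) by (rule order_tendstoD)
    then obtain N2 where N2: "\<And>n. n \<ge> N2 \<Longrightarrow> pdist L \<gamma> (F n) u < d" by (auto simp: eventually_sequentially)
    have "pdist L p (gradient (F m)) (gradient (F n)) < e" if mn: "m \<ge> max N1 N2" "n \<ge> max N1 N2" for m n
    proof -
      define g where "g = (\<lambda>x. (1/2) * (F m x + F n x))"
      have g: "g \<in> test_functions \<Omega>" unfolding g_def by (intro test_functions_cmult test_functions_add F)
      have gg: "gradient g = (\<lambda>x. (1/2) *\<^sub>R (gradient (F m) x + gradient (F n) x))"
        unfolding g_def using gradient_cmult[OF test_functions_add[OF F F]] gradient_add[OF F F] by metis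
      have "pdist L \<gamma> g u \<le> (pdist L \<gamma> (F m) u + pdist L \<gamma> (F n) u) / 2"
        using pdist_midpoint[OF P(8) FL(1) FL(1) u(1), of m n] by (simp add: g_def)
      then have "pdist L \<gamma> g u < d" using N2[of m] N2[of n] mn by simp
      then have "\<bar>potential g - potential u\<bar> < e'" by (intro d(2) test_function_Lp(1)[OF g P(3)])
      \<comment> \<open>The midpoint is itself a test function with energy at least I and potential
        close to that of u. So its Dirichlet integral cannot fall far below the two end values,
        which is what makes the convexity gap small.\<close>
      then have Dg: "\<epsilon> / p * D g > l - e'" using I_le[OF g] unfolding J l_def by linarith
      define S where "S = D (F m) + D (F n)"
      have "\<epsilon> / p * S = \<epsilon> / p * D (F m) + \<epsilon> / p * D (F n)" by (simp add: S_def distrib_left)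
      moreover have "\<epsilon> / p * D (F m) < l + e'" "\<epsilon> / p * D (F n) < l + e'" using N1 mn by auto
      moreover have "\<epsilon> / p * (S / 2 - D g) = (\<epsilon> / p * S) / 2 - \<epsilon> / p * D g" by (simp add: right_diff_distrib)
      moreover have "Z < 2 * e'" if "X = X1 + X2" "X1 < l + e'" "X2 < l + e'" "Z = X / 2 - Y" "l - e' < Y"
        for X X1 X2 Y Z :: real using that by linarith
      ultimately have "\<epsilon> / p * (S / 2 - D g) < 2 * e'" using Dg by blast
      then have "S / 2 - D g < 2 * e' / (\<epsilon> / p)"
        unfolding pos_less_divide_eq[OF \<epsilon>p] by (simp only: mult.commute)
      also have "2 * e' / (\<epsilon> / p) = e / (2 * (C' + 1))"
      proof -
        have "2 * (e * X / (4 * Y)) / X = e / (2 * Y)" if "X > 0" for X Y :: real using that by simp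
        from this[OF \<epsilon>p] show ?thesis unfolding e'_def by blast
      qed
      finally have gap: "S / 2 - D g \<le> e / (2 * (C' + 1))" by simp
      have "C' * (S / 2 - D g) \<le> C' * (e / (2 * (C' + 1)))" using gap C'(1) by (rule mult_left_mono)
      also have "\<dots> < (C' + 1) * (e / (2 * (C' + 1)))" using e C'(1) by (intro mult_strict_right_mono) auto
      also have "\<dots> = e / 2"
      proof -
        have "x * (e / (2 * x)) = e / 2" if "x > 0" for x using that by simp
        from this[of "C' + 1"] show ?thesis using C'(1) by linarith
      qed
      finally have 1: "C' * (S / 2 - D g) < e / 2" .
      have "\<eta> * S \<le> \<eta> * (2 * (B + 1))"
        using DB[of "s m"] DB[of "s n"] \<eta> by (intro mult_left_mono) (auto simp: S_def F_def)
      also have "\<dots> = e / 2"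
      proof -
        have "e / (4 * x) * (2 * x) = e / 2" if "x > 0" for x using that by simp
        from this[of "B + 1"] show ?thesis unfolding \<eta>_def using B0 by linarith
      qed
      finally have 2: "\<eta> * S \<le> e / 2" .
      have "pdist L p (gradient (F m)) (gradient (F n)) \<le> \<eta> * S + C' * (S / 2 - D g)"
        using C'(2)[OF FL(2)[of m] FL(2)[of n]] unfolding S_def D_def gg .
      then show ?thesis using 1 2 by linarith
    qed
    then show ?thesis unfolding pdist_def by blast
  qed
  obtain G where G: "G \<in> Lp_space L p" "(\<lambda>n. pdist L p (gradient (F n)) G) \<longlonglongrightarrow> 0"
    using Lp_complete[OF P(1) FL(2) Dcau] unfolding pdist_def by blast
  have uG: "sobolev_pair p u G" by (rule sobolev_pair_limit[OF F u G])
  have "(\<lambda>n. \<integral>x. 1 * norm (gradient (F n) x) powr p \<partial>L) \<longlonglongrightarrow> (\<integral>x. 1 * norm (G x) powr p \<partial>L)"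
    by (rule Lp_powr_integral_tendsto[OF P(1) FL(2) G(1) _ _ G(2), where K = 1]) auto
  then have "(\<lambda>n. J (F n)) \<longlonglongrightarrow> pair_energy \<epsilon> u G"
    unfolding J pair_energy_def D_def by (intro tendsto_intros TF) simp
  then have eI: "pair_energy \<epsilon> u G = I" using JF LIMSEQ_unique by blast
  show thesis
  proof (rule that[OF uG])
    fix w H assume "sobolev_pair p w H"
    then obtain E where E: "\<And>n. E n \<in> test_functions \<Omega>" "(\<lambda>n. J (E n)) \<longlonglongrightarrow> pair_energy \<epsilon> w H"
      unfolding J_def using pair_energy_approx by blast
    show "pair_energy \<epsilon> u G \<le> pair_energy \<epsilon> w H" unfolding eI
      by (rule LIMSEQ_le_const[OF E(2)]) (use I_le E(1) in blast)
  qed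
qed

text \<open>Along every line u + t v the energy is differentiable at 0, being a combination of three
  power integrals, and has a minimum there. The pair (u + t v, G + t H) remains admissible, so the
  minimality applies for each t.\<close>

lemma minimizer_weak_solution:
  assumes u: "sobolev_pair p u G"
    and min: "\<And>w H. sobolev_pair p w H \<Longrightarrow> pair_energy \<epsilon> u G \<le> pair_energy \<epsilon> w H"
  shows "weak_solution \<Omega> p q \<gamma> a b \<epsilon> u"
  unfolding weak_solution_def
proof (intro conjI ballI)
  note P = exponents_pos
  show "u \<in> W1p0 \<Omega> p" by (rule sobolev_pair_imp_W1p0[OF u p(1)])
  fix v assume "v \<in> W1p0 \<Omega> p"
  then have v: "sobolev_pair p v (weak_grad \<Omega> v)" using p(1) by (rule W1p0_imp_sobolev_pair)
  define H where "H = weak_grad \<Omega> v"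
  define h where "h = (\<lambda>t. pair_energy \<epsilon> (\<lambda>x. u x + t * v x) (\<lambda>x. G x + t *\<^sub>R H x))"
  have line: "sobolev_pair p (\<lambda>x. u x + t * v x) (\<lambda>x. G x + t *\<^sub>R H x)" for t
    using sobolev_pair_add_scaleR[OF u v p(1)] by (simp add: H_def)
  then have en: "energy \<Omega> p q \<gamma> a b \<epsilon> (\<lambda>x. u x + t * v x) = h t" for t
    unfolding h_def by (intro energy_eq_pair_energy) (simp add: sobolev_pair_def)
  have L: "u \<in> Lp_space L \<gamma>" "v \<in> Lp_space L \<gamma>" "G \<in> Lp_space L p" "H \<in> Lp_space L p"
    using u v sobolev_pair_Lp by (auto simp: sobolev_pair_def H_def)
  have Lq: "u \<in> Lp_space L q" "v \<in> Lp_space L q" using Lp_space_mono[OF _ P(2,6)] L by auto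
  have one: "(\<lambda>x. 1) \<in> borel_measurable L" "AE x in L. \<bar>1\<bar> \<le> (1::real)" by auto
  obtain D1 where D1: "((\<lambda>t. \<integral>x. 1 * norm (G x + t *\<^sub>R H x) powr p \<partial>L) has_real_derivative D1) (at 0)"
    using Lp_powr_integral_line_derivative[OF p(1) L(3,4) one] by blast
  obtain D2 where D2: "((\<lambda>t. \<integral>x. b x * norm (u x + t *\<^sub>R v x) powr \<gamma> \<partial>L) has_real_derivative D2) (at 0)"
    using Lp_powr_integral_line_derivative[OF P(8) L(1,2) b(1,2)] by blast
  obtain D3 where D3: "((\<lambda>t. \<integral>x. a x * norm (u x + t *\<^sub>R v x) powr q \<partial>L) has_real_derivative D3) (at 0)"
    using Lp_powr_integral_line_derivative[OF P(7) Lq a(1,2)] by blast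
  have heq: "h = (\<lambda>t. \<epsilon> / p * (\<integral>x. 1 * norm (G x + t *\<^sub>R H x) powr p \<partial>L) +
      (1 / \<gamma> * (\<integral>x. b x * norm (u x + t *\<^sub>R v x) powr \<gamma> \<partial>L) - 1 / q * (\<integral>x. a x * norm (u x + t *\<^sub>R v x) powr q \<partial>L)))"
    by (simp add: h_def pair_energy_def potential_def)
  have D: "(h has_real_derivative \<epsilon> / p * D1 + (1 / \<gamma> * D2 - 1 / q * D3)) (at 0)"
    unfolding heq by (intro DERIV_add DERIV_diff DERIV_cmult D1 D2 D3)
  moreover have "\<forall>y. \<bar>0 - y\<bar> < 1 \<longrightarrow> h 0 \<le> h y" using min[OF line] by (simp add: h_def)
  ultimately have "\<epsilon> / p * D1 + (1 / \<gamma> * D2 - 1 / q * D3) = 0" by (intro DERIV_local_min[of h _ 0 1]) auto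
  then show "((\<lambda>t. energy \<Omega> p q \<gamma> a b \<epsilon> (\<lambda>x. u x + t * v x)) has_real_derivative 0) (at 0)"
    using D unfolding en by simp
qed

text \<open>Dropping the nonnegative Dirichlet term of u leaves an inequality between potentials in
  which \<epsilon> multiplies only a quantity of the fixed function f.\<close>

lemma ground_state_energy_le:
  assumes \<epsilon>: "0 < \<epsilon>" and u: "ground_state \<Omega> p q \<gamma> a b \<epsilon> u" and f: "f \<in> test_functions \<Omega>"
  shows "u \<in> Lp_space L \<gamma>"
    and "potential u \<le> \<epsilon> / p * (\<integral>x. norm (gradient f x) powr p \<partial>L) + potential f"
proof -
  have "u \<in> W1p0 \<Omega> p" using u by (simp add: ground_state_def weak_solution_def)
  then have s: "sobolev_pair p u (weak_grad \<Omega> u)" using p(1) by (rule W1p0_imp_sobolev_pair)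
  then show "u \<in> Lp_space L \<gamma>" by (rule sobolev_pair_Lp)
  obtain v G where v: "sobolev_pair p v G" "\<And>w H. sobolev_pair p w H \<Longrightarrow> pair_energy \<epsilon> v G \<le> pair_energy \<epsilon> w H"
    using energy_minimizer_exists[OF \<epsilon>] by blast
  have "weak_solution \<Omega> p q \<gamma> a b \<epsilon> v" using v by (rule minimizer_weak_solution)
  then have "energy \<Omega> p q \<gamma> a b \<epsilon> u \<le> energy \<Omega> p q \<gamma> a b \<epsilon> v" using u by (simp add: ground_state_def)
  also have "energy \<Omega> p q \<gamma> a b \<epsilon> v = pair_energy \<epsilon> v G"
    by (rule energy_eq_pair_energy) (use v(1) in \<open>simp add: sobolev_pair_def\<close>)
  also have "\<dots> \<le> pair_energy \<epsilon> f (gradient f)"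
    by (rule v(2)[OF sobolev_pair_test_function[OF f exponents_pos(1)]])
  also have "energy \<Omega> p q \<gamma> a b \<epsilon> u = pair_energy \<epsilon> u (weak_grad \<Omega> u)"
    by (rule energy_eq_pair_energy) (use s in \<open>simp add: sobolev_pair_def\<close>)
  finally have "pair_energy \<epsilon> u (weak_grad \<Omega> u) \<le> pair_energy \<epsilon> f (gradient f)" .
  moreover have "0 \<le> \<epsilon> / p * (\<integral>x. norm (weak_grad \<Omega> u x) powr p \<partial>L)"
    using \<epsilon> exponents_pos by simp
  ultimately show "potential u \<le> \<epsilon> / p * (\<integral>x. norm (gradient f x) powr p \<partial>L) + potential f"
    unfolding pair_energy_def by linarith
qed

end

section \<open>Concentration on the zero of the reaction term\<close>

text \<open>At z both powers have the same weight: \<alpha> z^q = \<beta> z^\<gamma> = w. With s = z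
  t every term acquires the factor w, and the claim is w times the hypothesis for t.\<close>

lemma powr_gap_scaled:
  fixes \<alpha> \<beta> q \<gamma> s \<delta> C :: real
  assumes q: "0 < q" "q < \<gamma>" and ab: "0 < \<alpha>" "0 < \<beta>" and s: "0 \<le> s"
    and C: "\<And>t. 0 \<le> t \<Longrightarrow> \<bar>t - 1\<bar> powr \<gamma> \<le> \<delta> + C * (t powr \<gamma> / \<gamma> - t powr q / q - (1 / \<gamma> - 1 / q))"
  defines "z \<equiv> (\<alpha> / \<beta>) powr (1 / (\<gamma> - q))"
  shows "\<beta> * \<bar>s - z\<bar> powr \<gamma> \<le> \<delta> * (\<beta> * z powr \<gamma>) +
    C * ((1 / \<gamma> * (\<beta> * s powr \<gamma>) - 1 / q * (\<alpha> * s powr q)) - (1 / \<gamma> * (\<beta> * z powr \<gamma>) - 1 / q * (\<alpha> * z powr q)))"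
proof -
  have z: "z > 0" using ab by (simp add: z_def)
  define w where "w = \<beta> * z powr \<gamma>"
  have w: "w > 0" using z ab by (simp add: w_def)
  have "z powr (\<gamma> - q) = \<alpha> / \<beta>" using ab q by (simp add: z_def powr_powr)
  moreover have "z powr \<gamma> = z powr (\<gamma> - q) * z powr q" by (simp flip: powr_add)
  ultimately have wa: "\<alpha> * z powr q = w" using ab by (simp add: w_def)
  define t where "t = s / z"
  have t: "t \<ge> 0" "s = z * t" using z s by (auto simp: t_def)
  have 1: "\<beta> * s powr \<gamma> = w * t powr \<gamma>" using z t by (simp add: w_def powr_mult)
  have 2: "\<alpha> * s powr q = w * t powr q" unfolding wa[symmetric] using z t by (simp add: powr_mult)
  have "\<bar>s - z\<bar> = z * \<bar>t - 1\<bar>" using z by (simp add: t(2) abs_mult flip: right_diff_distrib')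
    (metis abs_mult abs_of_pos mult.right_neutral right_diff_distrib)
  then have 3: "\<beta> * \<bar>s - z\<bar> powr \<gamma> = w * \<bar>t - 1\<bar> powr \<gamma>" using z by (simp add: w_def powr_mult)
  have "w * \<bar>t - 1\<bar> powr \<gamma> \<le> w * (\<delta> + C * (t powr \<gamma> / \<gamma> - t powr q / q - (1 / \<gamma> - 1 / q)))"
    using w by (intro mult_left_mono C t(1)) auto
  also have "\<dots> = \<delta> * w + C * ((1 / \<gamma> * (w * t powr \<gamma>) - 1 / q * (w * t powr q)) - (1 / \<gamma> * w - 1 / q * w))"
    by (simp add: algebra_simps)
  finally show ?thesis unfolding 1 2 3 wa w_def[symmetric] .
qed

lemma Lp_strong_from_pdist:
  assumes "\<forall>\<^sub>F i in F. f i \<in> Lp_space M r" "g \<in> Lp_space M r" "((\<lambda>i. pdist M r (f i) g) \<longlongrightarrow> 0) F" "0 < r"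
  shows "tendsto_strongly_Lp M r (\<lambda>i x. f i x - g x) (\<lambda>_. 0) F"
  unfolding tendsto_strongly_Lp_def
proof (intro conjI)
  show "\<forall>\<^sub>F i in F. (\<lambda>x. f i x - g x) \<in> Lp_space M r"
    using assms(1) by eventually_elim (use assms in \<open>auto intro!: Lp_space_diff\<close>)
  show "(\<lambda>_. 0) \<in> Lp_space M r" by (simp add: Lp_space_def)
  have "((\<lambda>i. pdist M r (f i) g powr (1 / r)) \<longlongrightarrow> 0 powr (1 / r)) F"
    using assms by (intro tendsto_powr' tendsto_const) auto
  then show "((\<lambda>i. Lp_norm M r (\<lambda>x. f i x - g x - 0)) \<longlongrightarrow> 0) F"
    using assms(4) by (simp add: Lp_norm_def pdist_def)
qed

text \<open>Young's inequality with a weight k separates the two factors: k makes the fixed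
  contribution of \<psi> small, and afterwards convergence in L^r makes the other one small.\<close>

lemma Lp_weak_from_pdist:
  assumes ev: "\<forall>\<^sub>F i in F. f i \<in> Lp_space M r" and g: "g \<in> Lp_space M r"
    and lim: "((\<lambda>i. pdist M r (f i) g) \<longlongrightarrow> 0) F" and r: "1 < r"
  shows "tendsto_weakly_Lp M r (\<lambda>i x. f i x - g x) (\<lambda>_. 0) F"
  unfolding tendsto_weakly_Lp_def
proof (intro conjI ballI)
  have ev': "\<forall>\<^sub>F i in F. (\<lambda>x. f i x - g x) \<in> Lp_space M r"
    using ev by eventually_elim (use g r in \<open>auto intro!: Lp_space_diff\<close>)
  then show "\<forall>\<^sub>F i in F. (\<lambda>x. f i x - g x) \<in> Lp_space M r" .
  show "(\<lambda>_. 0) \<in> Lp_space M r" by (simp add: Lp_space_def)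
  fix \<psi> :: "'b \<Rightarrow> real" assume \<psi>: "\<psi> \<in> Lp_space M (r / (r - 1))"
  define s where "s = r / (r - 1)"
  have s: "s > 0" using r by (simp add: s_def)
  define Y where "Y = (\<integral>x. norm (\<psi> x) powr s \<partial>M)"
  have Y: "Y \<ge> 0" by (simp add: Y_def)
  have "((\<lambda>i. \<integral>x. (f i x - g x) * \<psi> x \<partial>M) \<longlongrightarrow> 0) F"
  proof (rule tendstoI)
    fix e :: real assume e: "0 < e"
    \<comment> \<open>Solves k^s = e / (2 (Y + 1)), so that the contribution of \<psi> is at most e
      / 2.\<close>
    define k where "k = (e / (2 * (Y + 1))) powr (1 / s)"
    have k: "k > 0" using e Y by (simp add: k_def)
    have ks: "k powr s = e / (2 * (Y + 1))" using s e Y by (simp add: k_def powr_powr)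
    have "k powr s * Y \<le> e / (2 * (Y + 1)) * (Y + 1)" unfolding ks using e Y by (intro mult_left_mono) auto
    also have "\<dots> = e / 2"
    proof -
      have "e / (2 * x) * x = e / 2" if "x > 0" for x using that by simp
      from this[of "Y + 1"] show ?thesis using Y by linarith
    qed
    finally have kY: "k powr s * Y \<le> e / 2" .
    define d where "d = e / 2 / (1 / k) powr r"
    have d: "d > 0" using e k by (simp add: d_def)
    have "\<forall>\<^sub>F i in F. pdist M r (f i) g < d" using lim d by (rule order_tendstoD)
    then show "\<forall>\<^sub>F i in F. dist (\<integral>x. (f i x - g x) * \<psi> x \<partial>M) 0 < e" using ev'
    proof eventually_elim
      case (elim i)
      have int: "integrable M (\<lambda>x. (1 / k) powr r * norm (f i x - g x) powr r)"
        "integrable M (\<lambda>x. k powr s * norm (\<psi> x) powr s)"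
        using Lp_space_integrable[OF elim(2)] Lp_space_integrable[OF \<psi>] by (auto simp: s_def)
      have "\<bar>\<integral>x. (f i x - g x) * \<psi> x \<partial>M\<bar> \<le> (\<integral>x. \<bar>(f i x - g x) * \<psi> x\<bar> \<partial>M)" by (rule integral_abs_bound)
      also have "\<dots> \<le> (\<integral>x. (1 / k) powr r * norm (f i x - g x) powr r + k powr s * norm (\<psi> x) powr s \<partial>M)"
      proof (rule integral_mono')
        show "\<bar>(f i x - g x) * \<psi> x\<bar> \<le> (1 / k) powr r * norm (f i x - g x) powr r + k powr s * norm (\<psi> x) powr s" for x
          using Young_scaled[OF r k, of "\<bar>f i x - g x\<bar>" "\<bar>\<psi> x\<bar>"] by (simp add: abs_mult s_def)
      qed (use int in auto)
      also have "\<dots> = (1 / k) powr r * pdist M r (f i) g + k powr s * Y"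
        using int by (simp add: pdist_def Y_def)
      also have "(1 / k) powr r * pdist M r (f i) g < (1 / k) powr r * d"
        using elim(1) k by (intro mult_strict_left_mono) auto
      also have "(1 / k) powr r * d = e / 2" using k by (simp add: d_def)
      finally show ?case using kY by (simp add: dist_real_def)
    qed
  qed
  then show "((\<lambda>i. \<integral>x. (f i x - g x) * \<psi> x \<partial>M) \<longlongrightarrow> (\<integral>x. 0 * \<psi> x \<partial>M)) F" by simp
qed

lemma measure_from_pdist:
  assumes ev: "\<forall>\<^sub>F i in F. f i \<in> Lp_space M r" and g: "g \<in> Lp_space M r"
    and lim: "((\<lambda>i. pdist M r (f i) g) \<longlongrightarrow> 0) F" and r: "0 < r"
  shows "tendsto_in_measure M f g F"
  unfolding tendsto_in_measure_def
proof (intro allI impI)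
  fix \<delta> :: real assume \<delta>: "0 < \<delta>"
  show "((\<lambda>i. emeasure M {x \<in> space M. \<delta> \<le> \<bar>f i x - g x\<bar>}) \<longlongrightarrow> 0) F"
  proof (rule tendsto_sandwich[OF _ _ tendsto_const])
    show "\<forall>\<^sub>F i in F. emeasure M {x \<in> space M. \<delta> \<le> \<bar>f i x - g x\<bar>} \<le> ennreal (1 / \<delta> powr r * pdist M r (f i) g)"
      using ev
    proof eventually_elim
      case (elim i)
      have L: "(\<lambda>x. f i x - g x) \<in> Lp_space M r" using elim g r by (intro Lp_space_diff) auto
      note m = Lp_space_measurable[OF L]
      have "emeasure M {x \<in> space M. \<delta> \<le> \<bar>f i x - g x\<bar>} \<le> emeasure M {x \<in> space M. \<delta> powr r \<le> norm (f i x - g x) powr r}"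
      proof (rule emeasure_mono)
        show "{x \<in> space M. \<delta> \<le> \<bar>f i x - g x\<bar>} \<subseteq> {x \<in> space M. \<delta> powr r \<le> norm (f i x - g x) powr r}"
          using \<delta> r by (auto intro!: powr_mono2)
        show "{x \<in> space M. \<delta> powr r \<le> norm (f i x - g x) powr r} \<in> sets M" using m by measurable
      qed
      also have "\<dots> \<le> ennreal (1 / \<delta> powr r * pdist M r (f i) g)"
        using integral_Markov_inequality[OF Lp_space_integrable[OF L], of "\<delta> powr r"] \<delta> by (simp add: pdist_def)
      finally show ?case .
    qed
    have "((\<lambda>i. 1 / \<delta> powr r * pdist M r (f i) g) \<longlongrightarrow> 1 / \<delta> powr r * 0) F" by (intro tendsto_intros lim)
    then show "((\<lambda>i. ennreal (1 / \<delta> powr r * pdist M r (f i) g)) \<longlongrightarrow> 0) F"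
      using tendsto_ennrealI by fastforce
  qed simp
qed

lemma (in finite_measure) pdist_tendsto_mono_filter:
  assumes q: "0 < q" "q \<le> \<gamma>" and ev: "\<forall>\<^sub>F i in F. f i \<in> Lp_space M \<gamma>"
    and g: "(g :: 'a \<Rightarrow> real) \<in> Lp_space M \<gamma>" and lim: "((\<lambda>i. pdist M \<gamma> (f i) g) \<longlongrightarrow> 0) F"
  shows "((\<lambda>i. pdist M q (f i) g) \<longlongrightarrow> 0) F"
proof (rule tendstoI)
  fix e :: real assume "0 < e"
  from Lp_small_exponent[OF q this] obtain d where d: "0 < d" "\<And>f :: 'a \<Rightarrow> real.
    f \<in> Lp_space M \<gamma> \<Longrightarrow> (\<integral>x. norm (f x) powr \<gamma> \<partial>M) < d \<Longrightarrow> (\<integral>x. norm (f x) powr q \<partial>M) < e" by blast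
  have "\<forall>\<^sub>F i in F. pdist M \<gamma> (f i) g < d" using lim d(1) by (rule order_tendstoD)
  then show "\<forall>\<^sub>F i in F. dist (pdist M q (f i) g) 0 < e" using ev
  proof eventually_elim
    case (elim i)
    have "(\<lambda>x. f i x - g x) \<in> Lp_space M \<gamma>" using elim g q by (intro Lp_space_diff) auto
    then have "pdist M q (f i) g < e" using d(2) elim(1) unfolding pdist_def by blast
    then show ?case by (simp add: dist_real_def)
  qed
qed

text \<open>Completeness of Lebesgue measure transfers measurability. It is applied to the limit
  function, which is prescribed almost everywhere only.\<close>

lemma (in bounded_open) borel_measurable_cong_AE_L:
  fixes f g :: "'a \<Rightarrow> real"
  assumes f: "f \<in> borel_measurable L" and ae: "AE x in L. f x = g x"
  shows "g \<in> borel_measurable L"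
proof -
  have S: "\<Omega> \<inter> space lebesgue \<in> sets lebesgue" using sets_\<Omega> by simp
  have "(\<lambda>x. if x \<in> \<Omega> then f x else 0) \<in> borel_measurable lebesgue"
    by (rule borel_measurable_if_I[OF f sets_\<Omega>])
  moreover have "AE x in lebesgue. (if x \<in> \<Omega> then f x else 0) = (if x \<in> \<Omega> then g x else 0)"
    using ae unfolding AE_restrict_space_iff[OF S] by eventually_elim auto
  ultimately have "(\<lambda>x. if x \<in> \<Omega> then g x else 0) \<in> borel_measurable lebesgue"
    by (rule borel_measurable_AE)
  then have "(\<lambda>x. if x \<in> \<Omega> then g x else 0) \<in> borel_measurable L" by (rule measurable_restrict_space1)
  then show ?thesis by (subst measurable_cong[where g = "\<lambda>x. if x \<in> \<Omega> then g x else 0"]) auto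
qed

text \<open>A bump on a ball. If its gradient vanished almost everywhere, it would vanish everywhere
  by continuity, making the bump constant; but it is nonzero at the center and 0 on the
  sphere.\<close>

lemma (in bounded_open) nontrivial_test_function:
  assumes "\<Omega> \<noteq> {}" and p: "0 < p"
  obtains f where "f \<in> test_functions \<Omega>" "\<not> (AE x in L. f x = 0)"
    "0 < (\<integral>x. norm (gradient f x) powr p \<partial>L)"
proof -
  obtain c r where r: "0 < r" "cball c r \<subseteq> \<Omega>" using assms open_\<Omega> by (meson ex_in_conv open_contains_cball)
  define f where "f = ball_bump c r"
  have f: "f \<in> test_functions \<Omega>" unfolding f_def using r by (rule ball_bump_test)
  have f0: "f x = 0 \<longleftrightarrow> x \<notin> ball c r" for x unfolding f_def using r(1) by (rule ball_bump_eq_0_iff)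
  have S: "\<Omega> \<inter> space lebesgue \<in> sets lebesgue" using sets_\<Omega> by simp
  have null: "U = {}" if "open U" "U \<subseteq> \<Omega>" "AE x in L. x \<notin> U" for U
  proof (rule ccontr)
    assume "U \<noteq> {}"
    have "AE x in lebesgue. x \<notin> U" 
      using that(3) unfolding AE_restrict_space_iff[OF S]
      by (rule eventually_mono) (use that(2) in auto)
    then have "U \<in> null_sets lebesgue" using that(1) by (subst (asm) AE_iff_null_sets[symmetric]) auto
    then show False using open_not_negligible[OF that(1) \<open>U \<noteq> {}\<close>] by (simp add: negligible_iff_null_sets)
  qed
  have nz: "\<not> (AE x in L. f x = 0)"
  proof
    assume "AE x in L. f x = 0"
    then have "ball c r = {}" using r(2) f0 by (intro null) auto
    then show False using r(1) by simp
  qed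
  have "(\<integral>x. norm (gradient f x) powr p \<partial>L) \<noteq> 0"
  proof
    assume "(\<integral>x. norm (gradient f x) powr p \<partial>L) = 0"
    then have "AE x in L. norm (gradient f x) powr p = 0"
      using test_function_integral_L(3)[OF f p] by (subst (asm) integral_nonneg_eq_0_iff_AE) auto
    then have ae: "AE x in L. x \<notin> {x. gradient f x \<noteq> 0}" by eventually_elim simp
    obtain C where C: "compact C" "C \<subseteq> \<Omega>" "\<And>x. x \<notin> C \<Longrightarrow> f x = 0" using f by (rule test_functionE) blast
    have "{x. gradient f x \<noteq> 0} = {}"
    proof (rule null[OF _ _ ae])
      show "open {x. gradient f x \<noteq> 0}"
        using test_function_GDERIV(2)[OF f] by (intro open_Collect_neq continuous_on_const)
      show "{x. gradient f x \<noteq> 0} \<subseteq> \<Omega>" using test_function_gradient_eq_0[OF f C(1,3)] C(2) by auto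
    qed
    then have "GDERIV f x :> 0" for x using test_function_GDERIV(1)[OF f, of x] by auto
    then have "(f has_derivative (\<lambda>h. 0)) (at x within UNIV)" for x by (simp add: gderiv_def)
    then obtain k where k: "\<And>x. f x = k" using has_derivative_zero_constant[of UNIV f] by auto
    obtain e :: 'a where "e \<in> Basis" using nonempty_Basis by blast
    then have "f (c + r *\<^sub>R e) = 0" using r(1) unfolding f0 by (simp add: dist_norm)
    moreover have "f c \<noteq> 0" using r(1) unfolding f0 by simp
    ultimately show False using k by simp
  qed
  moreover have "0 \<le> (\<integral>x. norm (gradient f x) powr p \<partial>L)" by simp
  ultimately show thesis using that[OF f nz] by linarith
qed

section \<open>Convergence of the ground states\<close>

context subcritical_problem
begin

text \<open>One admissible function with a positive quotient bounds the supremum below. Positivity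
  guarantees that the family of ground states is given for all small \<epsilon> > 0, so that the
  limit has content.\<close>

lemma eps_e_pos:
  assumes "\<Omega> \<noteq> {}"
  shows "0 < eps_e \<Omega> p q \<gamma> a b"
proof -
  note P = exponents_pos
  obtain f where f: "f \<in> test_functions \<Omega>" "\<not> (AE x in L. f x = 0)"
    "0 < (\<integral>x. norm (gradient f x) powr p \<partial>L)" by (rule nontrivial_test_function[OF assms P(1)])
  have L: "f \<in> Lp_space L \<gamma>" by (rule test_function_Lp(1)[OF f(1) P(3)])
  have pos: "0 < (\<integral>x. c x * \<bar>f x\<bar> powr r \<partial>L)"
    if i: "integrable L (\<lambda>x. c x * norm (f x) powr r)" and c: "AE x in L. \<sigma> \<le> c x" "0 < \<sigma>" for c r \<sigma>
  proof -
    have nn: "AE x in L. 0 \<le> c x * \<bar>f x\<bar> powr r" using c(1) by eventually_elim (use c(2) in auto)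
    have "(\<integral>x. c x * \<bar>f x\<bar> powr r \<partial>L) \<noteq> 0"
    proof
      assume "(\<integral>x. c x * \<bar>f x\<bar> powr r \<partial>L) = 0"
      then have "AE x in L. c x * \<bar>f x\<bar> powr r = 0" using i nn by (subst (asm) integral_nonneg_eq_0_iff_AE) auto
      then have "AE x in L. f x = 0" using c(1) by eventually_elim (use c(2) in auto)
      then show False using f(2) by simp
    qed
    moreover have "0 \<le> (\<integral>x. c x * \<bar>f x\<bar> powr r \<partial>L)" using nn by (rule integral_nonneg_AE)
    ultimately show ?thesis by linarith
  qed
  have A: "0 < (\<integral>x. a x * \<bar>f x\<bar> powr q \<partial>L)" using integrable_a[OF L] a(4,3) by (rule pos)
  have B: "0 < (\<integral>x. b x * \<bar>f x\<bar> powr \<gamma> \<partial>L)" using integrable_b[OF L] b(4,3) by (rule pos)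
  have W: "f \<in> W1p0 \<Omega> p"
    by (rule sobolev_pair_imp_W1p0[OF sobolev_pair_test_function[OF f(1) P(1)] p(1)])
  then have adm: "f \<in> admissible_set \<Omega> p q a" using A f(2) by (simp add: admissible_set_def)
  have D: "0 < (\<integral>x. norm (weak_grad \<Omega> f x) powr p \<partial>L)"
    using f(3) unfolding weak_grad_integral[OF test_function_weak_gradient[OF open_\<Omega> f(1)]] .
  define Q where "Q = (\<lambda>u. (\<integral>x. a x * \<bar>u x\<bar> powr q \<partial>L) powr ((\<gamma> - p) / (\<gamma> - q)) /
     ((\<integral>x. norm (weak_grad \<Omega> u x) powr p \<partial>L) * (\<integral>x. b x * \<bar>u x\<bar> powr \<gamma> \<partial>L) powr ((q - p) / (\<gamma> - q))))"
  have "0 < Q f" unfolding Q_def using A B D by (intro divide_pos_pos mult_pos_pos) auto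
  then have "0 < ereal (Q f)" by simp
  also have "\<dots> \<le> (SUP u\<in>admissible_set \<Omega> p q a. ereal (Q u))" using adm by (rule SUP_upper)
  finally have S: "0 < (SUP u\<in>admissible_set \<Omega> p q a. ereal (Q u))" .
  have "0 < c_e p q \<gamma>" unfolding c_e_def using p P by (intro mult_pos_pos divide_pos_pos) (auto intro!: mult_pos_pos divide_pos_pos)
  then show ?thesis using S unfolding eps_e_def Q_def by (simp add: ereal_zero_less_0_iff)
qed

lemma ground_states_tendsto:
  fixes u :: "real \<Rightarrow> 'a \<Rightarrow> real"
  assumes \<epsilon>0: "0 < \<epsilon>0" and u: "\<And>\<epsilon>. 0 < \<epsilon> \<Longrightarrow> \<epsilon> < \<epsilon>0 \<Longrightarrow> positive_ground_state \<Omega> p q \<gamma> a b \<epsilon> (u \<epsilon>)"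
    and u0: "AE x in L. u0 x = (a x / b x) powr (1 / (\<gamma> - q))"
  shows "u0 \<in> Lp_space L \<gamma>" "\<forall>\<^sub>F \<epsilon> in at_right 0. u \<epsilon> \<in> Lp_space L \<gamma>"
    "((\<lambda>\<epsilon>. pdist L \<gamma> (u \<epsilon>) u0) \<longlongrightarrow> 0) (at_right 0)"
proof -
  note P = exponents_pos
  have "(\<lambda>x. (a x / b x) powr (1 / (\<gamma> - q))) \<in> borel_measurable L" using a(1) b(1) by measurable
  then have u0m: "u0 \<in> borel_measurable L"
    by (rule borel_measurable_cong_AE_L) (use u0 in \<open>eventually_elim, simp\<close>)
  define M where "M = (K / \<sigma>\<^sub>b) powr (1 / (\<gamma> - q))"
  have u0M: "AE x in L. \<bar>u0 x\<bar> \<le> M" using u0 a(2,4) b(4)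
  proof eventually_elim
    case (elim x)
    have "a x / b x \<le> K / \<sigma>\<^sub>b" using elim a(3) b(3) by (intro frac_le) auto
    then show ?case unfolding elim(1) M_def using elim a(3) b(3) p by (auto intro!: powr_mono2)
  qed
  have M: "0 \<le> M" by (simp add: M_def)
  have "(\<lambda>x. M) \<in> Lp_space L \<gamma>" by (simp add: Lp_space_def)
  then show u0L: "u0 \<in> Lp_space L \<gamma>"
    by (rule Lp_space_bound(1)[OF _ P(9) u0m]) (use u0M in \<open>eventually_elim, simp\<close>)
  have ev: "\<forall>\<^sub>F \<epsilon> in at_right 0. 0 < \<epsilon> \<and> \<epsilon> < \<epsilon>1" if "\<epsilon>1 > 0" for \<epsilon>1 :: real
    using that by (auto simp: eventually_at_right_field)
  have uL: "u \<epsilon> \<in> Lp_space L \<gamma>" and upot: "f \<in> test_functions \<Omega> \<Longrightarrow>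
      potential (u \<epsilon>) \<le> \<epsilon> / p * (\<integral>x. norm (gradient f x) powr p \<partial>L) + potential f"
    and upos: "AE x in L. 0 < u \<epsilon> x" if "0 < \<epsilon>" "\<epsilon> < \<epsilon>0" for \<epsilon> f
    using u[OF that] ground_state_energy_le[OF that(1)] test_functions_0
    unfolding positive_ground_state_def by blast+
  show "\<forall>\<^sub>F \<epsilon> in at_right 0. u \<epsilon> \<in> Lp_space L \<gamma>"
    using ev[OF \<epsilon>0] by eventually_elim (use uL in blast)
  define W where "W = (\<integral>x. b x * norm (u0 x) powr \<gamma> \<partial>L)"
  have W: "W \<ge> 0" unfolding W_def
    by (rule integral_nonneg_AE) (use b(3,4) in \<open>auto elim!: eventually_mono\<close>)
  show "((\<lambda>\<epsilon>. pdist L \<gamma> (u \<epsilon>) u0) \<longlongrightarrow> 0) (at_right 0)"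
  proof (rule tendstoI)
    fix e :: real assume e: "0 < e"
    \<comment> \<open>The choices are made in the order \<delta>, C, \<eta>, f, \<epsilon>1, each
      depending on the earlier ones. Here \<delta> W is at most one third of
      \<open>\<sigma>\<^sub>b * e\<close>.\<close>
    define \<delta> where "\<delta> = \<sigma>\<^sub>b * e / (3 * (W + 1))"
    have \<delta>: "\<delta> > 0" using e b(3) W by (simp add: \<delta>_def)
    obtain C where C: "0 \<le> C" "\<And>t. 0 \<le> t \<Longrightarrow> \<bar>t - 1\<bar> powr \<gamma> \<le>
        \<delta> + C * (t powr \<gamma> / \<gamma> - t powr q / q - (1 / \<gamma> - 1 / q))"
      by (rule powr_gap_coercive[OF P(2) p(3) \<delta>]) blast
    \<comment> \<open>\<open>powr_gap_scaled\<close> with \<alpha> = a x, \<beta> = b x, s = v x,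
      integrated over \<Omega>. Positivity of v identifies v with |v|, and the lower bound on b
      removes the weight on the left.\<close>
    have gap: "\<sigma>\<^sub>b * pdist L \<gamma> v u0 \<le> \<delta> * W + C * (potential v - potential u0)"
      if v: "v \<in> Lp_space L \<gamma>" and pos: "AE x in L. 0 < v x" for v
    proof -
      have d: "integrable L (\<lambda>x. norm (v x - u0 x) powr \<gamma>)"
        by (intro Lp_space_integrable Lp_space_diff v u0L P)
      note i = integrable_a[OF v] integrable_b[OF v] integrable_a[OF u0L] integrable_b[OF u0L]
      have "\<sigma>\<^sub>b * pdist L \<gamma> v u0 = (\<integral>x. \<sigma>\<^sub>b * norm (v x - u0 x) powr \<gamma> \<partial>L)" by (simp add: pdist_def)
      also have "\<dots> \<le> (\<integral>x. \<delta> * (b x * norm (u0 x) powr \<gamma>) +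
          C * ((1 / \<gamma> * (b x * norm (v x) powr \<gamma>) - 1 / q * (a x * norm (v x) powr q)) -
            (1 / \<gamma> * (b x * norm (u0 x) powr \<gamma>) - 1 / q * (a x * norm (u0 x) powr q))) \<partial>L)"
      proof (rule integral_mono_AE)
        show "AE x in L. \<sigma>\<^sub>b * norm (v x - u0 x) powr \<gamma> \<le> \<delta> * (b x * norm (u0 x) powr \<gamma>) +
          C * ((1 / \<gamma> * (b x * norm (v x) powr \<gamma>) - 1 / q * (a x * norm (v x) powr q)) -
            (1 / \<gamma> * (b x * norm (u0 x) powr \<gamma>) - 1 / q * (a x * norm (u0 x) powr q)))"
          using u0 a(4) b(4) pos
        proof eventually_elim
          case (elim x)
          have ab: "0 < a x" "0 < b x" using elim a(3) b(3) by auto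
          have "\<sigma>\<^sub>b * norm (v x - u0 x) powr \<gamma> \<le> b x * \<bar>v x - u0 x\<bar> powr \<gamma>"
            using elim by (auto intro!: mult_right_mono)
          also have "\<dots> \<le> \<delta> * (b x * u0 x powr \<gamma>) +
              C * ((1 / \<gamma> * (b x * v x powr \<gamma>) - 1 / q * (a x * v x powr q)) -
                (1 / \<gamma> * (b x * u0 x powr \<gamma>) - 1 / q * (a x * u0 x powr q)))"
            unfolding elim(1) using elim by (intro powr_gap_scaled[OF P(2) p(3) ab _ C(2)]) auto
          finally have *: "\<sigma>\<^sub>b * norm (v x - u0 x) powr \<gamma> \<le> \<delta> * (b x * u0 x powr \<gamma>) +
              C * ((1 / \<gamma> * (b x * v x powr \<gamma>) - 1 / q * (a x * v x powr q)) -
                (1 / \<gamma> * (b x * u0 x powr \<gamma>) - 1 / q * (a x * u0 x powr q)))" .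
          have "norm (u0 x) = u0 x" "norm (v x) = v x" using elim by auto
          with * show ?case by simp
        qed
      qed (intro integrable_mult_right d Bochner_Integration.integrable_add Bochner_Integration.integrable_diff i)+
      also have "\<dots> = \<delta> * W + C * (potential v - potential u0)"
        unfolding W_def potential_def using i
        by (simp only: Bochner_Integration.integral_add Bochner_Integration.integral_diff
          Bochner_Integration.integrable_add Bochner_Integration.integrable_diff integrable_mult_right
          integral_mult_right_zero)
      finally show ?thesis .
    qed
    \<comment> \<open>Two errors of size \<eta> occur, one from the potential of f and one from its
      Dirichlet term; multiplied by C they use at most another third of
      \<open>\<sigma>\<^sub>b * e\<close>.\<close>
    define \<eta> where "\<eta> = \<sigma>\<^sub>b * e / (6 * (C + 1))"
    have \<eta>: "\<eta> > 0" using e b(3) C by (simp add: \<eta>_def)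
    obtain d where d: "0 < d" "\<And>v. v \<in> Lp_space L \<gamma> \<Longrightarrow> pdist L \<gamma> v u0 < d \<Longrightarrow> \<bar>potential v - potential u0\<bar> < \<eta>"
      using potential_continuous[OF u0L \<eta>] by blast
    obtain f where f: "f \<in> test_functions \<Omega>" "(\<integral>x. norm (f x - u0 x) powr \<gamma> \<partial>L) < d"
      using test_functions_dense[OF open_\<Omega> bounded_\<Omega> u0m u0M P(3) d(1)] by blast
    have Tf: "potential f < potential u0 + \<eta>"
      using d(2)[OF test_function_Lp(1)[OF f(1) P(3)]] f(2) unfolding pdist_def by linarith
    define D where "D = (\<integral>x. norm (gradient f x) powr p \<partial>L)"
    have D: "D \<ge> 0" by (simp add: D_def)
    \<comment> \<open>Below this threshold the Dirichlet term of the fixed f is at most \<eta>; D +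
      1 keeps the quotient defined when D = 0.\<close>
    define \<epsilon>1 where "\<epsilon>1 = \<eta> * p / (D + 1)"
    have \<epsilon>1: "\<epsilon>1 > 0" using \<eta> P D by (simp add: \<epsilon>1_def)
    show "\<forall>\<^sub>F \<epsilon> in at_right 0. dist (pdist L \<gamma> (u \<epsilon>) u0) 0 < e"
      using ev[OF \<epsilon>0] ev[OF \<epsilon>1]
    proof eventually_elim
      case (elim \<epsilon>)
      have e0: "0 < \<epsilon>" "\<epsilon> < \<epsilon>0" using elim by auto
      have "\<epsilon> / p * D \<le> \<epsilon>1 / p * D" using elim P D by (intro mult_right_mono divide_right_mono) auto
      also have "\<dots> = \<eta> * (D / (D + 1))" using P by (simp add: \<epsilon>1_def)
      also have "\<dots> \<le> \<eta> * 1" using \<eta> D by (intro mult_left_mono) auto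
      finally have "\<epsilon> / p * D \<le> \<eta>" by simp
      then have "potential (u \<epsilon>) - potential u0 \<le> 2 * \<eta>" using upot[OF e0 f(1)] Tf unfolding D_def by linarith
      then have "C * (potential (u \<epsilon>) - potential u0) \<le> C * (2 * \<eta>)" using C(1) by (rule mult_left_mono)
      also have "\<dots> \<le> (C + 1) * (2 * \<eta>)" using \<eta> by (intro mult_right_mono) auto
      also have "\<dots> = \<sigma>\<^sub>b * e / 3"
      proof -
        have "x * (2 * (y / (6 * x))) = y / 3" if "x > 0" for x y :: real using that by simp
        from this[of "C + 1" "\<sigma>\<^sub>b * e"] show ?thesis unfolding \<eta>_def using C(1) by linarith
      qed
      finally have 1: "C * (potential (u \<epsilon>) - potential u0) \<le> \<sigma>\<^sub>b * e / 3" .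
      have "\<delta> * W \<le> \<delta> * (W + 1)" using \<delta> by (intro mult_left_mono) auto
      also have "\<dots> = \<sigma>\<^sub>b * e / 3"
      proof -
        have "y / (3 * x) * x = y / 3" if "x > 0" for x y :: real using that by simp
        from this[of "W + 1" "\<sigma>\<^sub>b * e"] show ?thesis unfolding \<delta>_def using W by linarith
      qed
      finally have "\<delta> * W \<le> \<sigma>\<^sub>b * e / 3" .
      then have "\<sigma>\<^sub>b * pdist L \<gamma> (u \<epsilon>) u0 \<le> \<sigma>\<^sub>b * e / 3 + \<sigma>\<^sub>b * e / 3"
        using gap[OF uL[OF e0] upos[OF e0]] 1 by linarith
      also have "\<dots> < \<sigma>\<^sub>b * e" using e b(3) by simp
      finally have "pdist L \<gamma> (u \<epsilon>) u0 < e" using b(3) by simp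
      then show ?case by (simp add: dist_real_def)
    qed
  qed
qed

end

text \<open>For p < N this is clearing of denominators. For p >= N it follows from N (\<gamma> - p)
  <= p (\<gamma> - p) < p \<gamma>.\<close>

lemma subcritical_if_less_critical_exponent:
  fixes p \<gamma> :: real
  assumes "1 < p" "p < \<gamma>" "ereal \<gamma> < critical_exponent N p"
  shows "0 < \<gamma> - real N * (\<gamma> - p) / p"
proof (cases "p < real N")
  case True
  then have "\<gamma> < p * real N / (real N - p)" using assms(3) by (simp add: critical_exponent_def)
  then have "\<gamma> * (real N - p) < p * real N" using True by (simp add: field_simps)
  then show ?thesis using assms by (simp add: field_simps)
next
  case False
  then have "real N * (\<gamma> - p) \<le> p * (\<gamma> - p)" using assms by (intro mult_right_mono) auto
  also have "\<dots> < p * \<gamma>" using assms by simp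
  finally show ?thesis using assms by (simp add: field_simps)
qed

theorem theorem1p2:
  fixes \<Omega> :: "(real ^ 'n) set"
    and p q \<gamma> \<sigma>\<^sub>a \<sigma>\<^sub>b :: real
    and a b u\<^sub>0 :: "real ^ 'n \<Rightarrow> real"
    and u :: "real \<Rightarrow> real ^ 'n \<Rightarrow> real"
  assumes "open \<Omega>" "\<Omega> \<noteq> {}" "connected \<Omega>" "bounded \<Omega>" "C1_boundary \<Omega>"
    and "1 < p" "p < q" "q < \<gamma>" "ereal \<gamma> < critical_exponent CARD('n) p"
    and "a \<in> Linfty_space (lebesgue_on \<Omega>)" "b \<in> Linfty_space (lebesgue_on \<Omega>)"
    and "\<sigma>\<^sub>a > 0" "AE x in lebesgue_on \<Omega>. a x \<ge> \<sigma>\<^sub>a"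
    and "\<sigma>\<^sub>b > 0" "AE x in lebesgue_on \<Omega>. b x \<ge> \<sigma>\<^sub>b"
    and "\<And>\<epsilon>. 0 < \<epsilon> \<Longrightarrow> ereal \<epsilon> < eps_e \<Omega> p q \<gamma> a b \<Longrightarrow> positive_ground_state \<Omega> p q \<gamma> a b \<epsilon> (u \<epsilon>)"
    and "AE x in lebesgue_on \<Omega>. u\<^sub>0 x = (a x / b x) powr (1 / (\<gamma> - q))"
  shows "tendsto_in_measure (lebesgue_on \<Omega>) u u\<^sub>0 (at_right 0)
    \<and> (\<forall>r. 1 \<le> r \<and> r < \<gamma> \<longrightarrow>
          tendsto_strongly_Lp (lebesgue_on \<Omega>) r (\<lambda>\<epsilon> x. u \<epsilon> x - u\<^sub>0 x) (\<lambda>_. 0) (at_right 0))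
    \<and> (\<forall>r. 1 < r \<and> r \<le> \<gamma> \<longrightarrow>
          tendsto_weakly_Lp (lebesgue_on \<Omega>) r (\<lambda>\<epsilon> x. u \<epsilon> x - u\<^sub>0 x) (\<lambda>_. 0) (at_right 0))
    \<and> (AE x in lebesgue_on \<Omega>. a x * u\<^sub>0 x powr (q - 1) - b x * u\<^sub>0 x powr (\<gamma> - 1) = 0)"
proof -
  obtain Ka where Ka: "AE x in lebesgue_on \<Omega>. \<bar>a x\<bar> \<le> Ka" using assms(10) by (auto simp: Linfty_space_def)
  obtain Kb where Kb: "AE x in lebesgue_on \<Omega>. \<bar>b x\<bar> \<le> Kb" using assms(11) by (auto simp: Linfty_space_def)
  interpret subcritical_problem \<Omega> p q \<gamma> "max Ka Kb" \<sigma>\<^sub>a \<sigma>\<^sub>b a b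
  proof
    show "AE x in lebesgue_on \<Omega>. \<bar>a x\<bar> \<le> max Ka Kb" using Ka by eventually_elim simp
    show "AE x in lebesgue_on \<Omega>. \<bar>b x\<bar> \<le> max Ka Kb" using Kb by eventually_elim simp
    show "0 < \<gamma> - real DIM(real ^ 'n) * (\<gamma> - p) / p"
      using subcritical_if_less_critical_exponent[OF assms(6) _ assms(9)] assms(7,8) by simp
  qed (use assms in \<open>auto simp: Linfty_space_def\<close>)
  note P = exponents_pos
  \<comment> \<open>\<open>eps_e\<close> is an extended real; a real threshold strictly between 0
    and it suffices for a limit at 0.\<close>
  obtain \<epsilon>0 where \<epsilon>0: "0 < \<epsilon>0" "ereal \<epsilon>0 < eps_e \<Omega> p q \<gamma> a b"
  proof -
    obtain z where z: "0 < z" "z < eps_e \<Omega> p q \<gamma> a b" using dense[OF eps_e_pos[OF assms(2)]] by blast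
    then obtain r where "z = ereal r" by (cases z) auto
    with z show thesis by (intro that[of r]) auto
  qed
  have pgs: "positive_ground_state \<Omega> p q \<gamma> a b \<epsilon> (u \<epsilon>)" if "0 < \<epsilon>" "\<epsilon> < \<epsilon>0" for \<epsilon>
    using assms(16)[OF that(1)] that(2) \<epsilon>0(2) by (meson ereal_less_eq(3) le_less_trans less_imp_le)
  have lim: "u\<^sub>0 \<in> Lp_space L \<gamma>" "\<forall>\<^sub>F \<epsilon> in at_right 0. u \<epsilon> \<in> Lp_space L \<gamma>"
    "((\<lambda>\<epsilon>. pdist L \<gamma> (u \<epsilon>) u\<^sub>0) \<longlongrightarrow> 0) (at_right 0)"
    by (rule ground_states_tendsto[OF \<epsilon>0(1) _ assms(17)], erule (1) pgs)+
  \<comment> \<open>\<Omega> has finite measure, so convergence in L^\<gamma> descends to every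
    smaller exponent.\<close>
  have ev: "\<forall>\<^sub>F \<epsilon> in at_right 0. u \<epsilon> \<in> Lp_space L r" and mem: "u\<^sub>0 \<in> Lp_space L r"
    and conv: "((\<lambda>\<epsilon>. pdist L r (u \<epsilon>) u\<^sub>0) \<longlongrightarrow> 0) (at_right 0)" if r: "0 < r" "r \<le> \<gamma>" for r
  proof -
    show "\<forall>\<^sub>F \<epsilon> in at_right 0. u \<epsilon> \<in> Lp_space L r"
      using lim(2) by (rule eventually_mono) (rule Lp_space_mono[OF _ r])
    show "u\<^sub>0 \<in> Lp_space L r" by (rule Lp_space_mono[OF lim(1) r])
    show "((\<lambda>\<epsilon>. pdist L r (u \<epsilon>) u\<^sub>0) \<longlongrightarrow> 0) (at_right 0)"
      by (rule pdist_tendsto_mono_filter[OF r lim(2,1,3)])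
  qed
  have "AE x in L. a x * u\<^sub>0 x powr (q - 1) - b x * u\<^sub>0 x powr (\<gamma> - 1) = 0"
    using assms(17) assms(13) assms(15)
  proof eventually_elim
    case (elim x)
    have ab: "0 < a x" "0 < b x" using elim assms(12,14) by auto
    have "u\<^sub>0 x powr (\<gamma> - q) = a x / b x" using ab p(3) by (simp add: elim(1) powr_powr)
    moreover have "u\<^sub>0 x powr (\<gamma> - 1) = u\<^sub>0 x powr (\<gamma> - q) * u\<^sub>0 x powr (q - 1)" by (simp flip: powr_add)
    ultimately show ?case using ab by simp
  qed
  moreover have "tendsto_in_measure L u u\<^sub>0 (at_right 0)"
    by (rule measure_from_pdist[OF lim(2,1,3) P(3)])
  moreover have "tendsto_strongly_Lp L r (\<lambda>\<epsilon> x. u \<epsilon> x - u\<^sub>0 x) (\<lambda>_. 0) (at_right 0)" if "1 \<le> r" "r < \<gamma>" for r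
    using that by (intro Lp_strong_from_pdist ev mem conv) auto
  moreover have "tendsto_weakly_Lp L r (\<lambda>\<epsilon> x. u \<epsilon> x - u\<^sub>0 x) (\<lambda>_. 0) (at_right 0)" if "1 < r" "r \<le> \<gamma>" for r
    using that by (intro Lp_weak_from_pdist ev mem conv) auto
  ultimately show ?thesis by blast
qed

end
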